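(* Let $0<\alpha\le 1$, $A\in\mathbb{R}^{n\times n}$, $B\in\mathbb{R}^{n\times m}$. The forward trajectory $\gamma(t,\psi,u)$ of the initialized fractional system $\Sigma_{\alpha,\psi}$, $D^{\alpha}_{0+}x(t)=Ax(t)+Bu(t)$, with initialization function $\psi$ and control $u$, evaluated at $t>0$, has the form $$\gamma(t,\psi,u)=\int_0^t S(t-\tau)\bigl(Bu(\tau)-\psi(\tau)\bigr)\,d\tau,\qquad S(t)=e_\alpha^{At}.$$ Moreover, if the history is constant, $x(t)=a$ for all $t\in(-\infty,0]$ with $a\in\mathbb{R}^n$, then the forward trajectory, denoted $\gamma(t,a,u)$, is $$\gamma(t,a,u)=E_\alpha(At^\alpha)a+\int_0^t S(t-\tau)Bu(\tau)\,d\tau .$$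
   Context: Special functions: for $A\in\mathbb{R}^{n\times n}$, $\alpha>0$, $\beta>0$, $E_{\alpha,\beta}(At^\alpha)=\sum_{k=0}^\infty A^k\frac{t^{k\alpha}}{\Gamma(k\alpha+\beta)}$, $E_\alpha=E_{\alpha,1}$, and the $\alpha$-exponential matrix is $e_\alpha^{At}=t^{\alpha-1}E_{\alpha,\alpha}(At^\alpha)=\sum_{k=0}^\infty A^k\frac{t^{(k+1)\alpha-1}}{\Gamma((k+1)\alpha)}$. System: in $\Sigma_{\alpha,\psi}$ one has $x(t)\in\mathbb{R}^n$, $u(t)\in\mathbb{R}^m$, controls $u$ are piecewise constant on $[0,\infty)$, and the initialized derivative is $D^\alpha_{0+}x(t)={}_0d^\alpha_t x(t)+\psi(t)$, where ${}_0d^\alpha_t x=\mathcal{L}^{-1}[s^\alpha X(s)]$ is the uninitialized derivative, $X=\mathcal{L}[x]$ is the Laplace transform of $x$ on $(0,\infty)$, and $\psi$ is an $\mathbb{R}^n$-valued initialization function on $(0,\infty)$. The functions $u$ and $\psi$ are assumed to be Laplace transformable, with $U=\mathcal{L}[u]$, $\Psi=\mathcal{L}[\psi]$. The forward trajectory $\gamma(\cdot,\psi,u)$ is the solution $x$ on $t>0$, that is, the function whose Laplace transform satisfies $s^\alpha X(s)+\Psi(s)=AX(s)+BU(s)$. Convolution integrals are understood where they converge. The initialization function generated by a history $x(\tau)$, $\tau\le 0$, is $\psi(t)=\lim_{\omega\to-\infty}\frac{d}{dt}\Bigl(\frac{1}{\Gamma(1-\alpha)}\int_\omega^0\frac{x(\tau)}{(t-\tau)^\alpha}d\tau\Bigr)$.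 For the constant history $x\equiv a$ on $(-\infty,0]$ it is $\psi(t)=-\frac{a\,t^{-\alpha}}{\Gamma(1-\alpha)}$, with $\Psi(s)=-s^{\alpha-1}a$; for $\alpha=1$ this $\psi$ is understood through its Laplace transform $\Psi(s)=-a$, i.e. $\psi=-a\,\delta_0$ with $\delta_0$ the Dirac delta at $0$. *)

theory Defs
  imports "HOL-Analysis.Analysis"
begin

primrec mat_power :: "real^'n^'n \<Rightarrow> nat \<Rightarrow> real^'n^'n" where
  "mat_power A 0 = mat 1"
| "mat_power A (Suc k) = A ** mat_power A k"

definition mittag_leffler :: "real \<Rightarrow> real \<Rightarrow> real^'n^'n \<Rightarrow> real^'n^'n" where
  "mittag_leffler \<alpha> \<beta> M = (\<Sum>k. (1 / Gamma (real k * \<alpha> + \<beta>)) *\<^sub>R mat_power M k)"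

definition alpha_exp :: "real \<Rightarrow> real^'n^'n \<Rightarrow> real \<Rightarrow> real^'n^'n" where
  "alpha_exp \<alpha> A t = (t powr (\<alpha> - 1)) *\<^sub>R mittag_leffler \<alpha> \<alpha> ((t powr \<alpha>) *\<^sub>R A)"

definition cvec :: "real^'n \<Rightarrow> complex^'n" where
  "cvec v = (\<chi> i. complex_of_real (v $ i))"

definition laplace_partial :: "(real \<Rightarrow> real^'n) \<Rightarrow> complex \<Rightarrow> real \<Rightarrow> complex^'n" where
  "laplace_partial f s T = integral {0..T} (\<lambda>t. exp (- (s * of_real t)) *s cvec (f t))"

text \<open>
  Functions on \<open>(0, \<infinity>)\<close> are total functions on the reals whose values at \<open>t \<le> 0\<close> play no role.
  The Laplace integral is only required to converge as an improper integral at infinity;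
  on bounded intervals integrability is Lebesgue integrability.
\<close>

definition laplace_converges :: "(real \<Rightarrow> real^'n) \<Rightarrow> complex \<Rightarrow> bool" where
  "laplace_converges f s \<longleftrightarrow>
     (\<forall>T>0. f absolutely_integrable_on {0..T}) \<and>
     (\<exists>L. (laplace_partial f s \<longlongrightarrow> L) at_top)"

definition laplace :: "(real \<Rightarrow> real^'n) \<Rightarrow> complex \<Rightarrow> complex^'n" where
  "laplace f s = Lim at_top (laplace_partial f s)"

definition laplace_transformable :: "(real \<Rightarrow> real^'n) \<Rightarrow> bool" where
  "laplace_transformable f \<longleftrightarrow> (\<exists>s. laplace_converges f s)"

text \<open>Values at the finitely many break points in each \<open>[0, T]\<close> are left arbitrary.\<close>

definition piecewise_constant :: "(real \<Rightarrow> real^'m) \<Rightarrow> bool" where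
  "piecewise_constant u \<longleftrightarrow>
     (\<forall>T>0. \<exists>P. finite P \<and>
        (\<forall>a b. 0 \<le> a \<and> a < b \<and> b \<le> T \<and> {a<..<b} \<inter> P = {} \<longrightarrow> u constant_on {a<..<b}))"

text \<open>
  The equation \<open>s\<^sup>\<alpha> X(s) + \<Psi>(s) = A X(s) + B U(s)\<close> on some right half-plane, with the principal
  branch of \<open>s\<^sup>\<alpha>\<close>.  The initialization enters through \<open>\<Psi>\<close> only, so that initializations which
  are not functions (such as a multiple of the Dirac delta at 0) are covered.
\<close>

definition solves_transformed_system ::
  "real \<Rightarrow> real^'n^'n \<Rightarrow> real^'m^'n \<Rightarrow> (complex \<Rightarrow> complex^'n) \<Rightarrow> (real \<Rightarrow> real^'m) \<Rightarrow>
   (real \<Rightarrow> real^'n) \<Rightarrow> bool" where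
  "solves_transformed_system \<alpha> A B \<Psi> u x \<longleftrightarrow>
     (\<exists>\<sigma>. \<forall>s. Re s > \<sigma> \<longrightarrow>
        laplace_converges x s \<and> laplace_converges u s \<and>
        (s powr of_real \<alpha>) *s laplace x s + \<Psi> s = map_matrix of_real A *v laplace x s + map_matrix of_real B *v laplace u s)"

text \<open>
  A Laplace transform determines a function only up to null sets, so being the forward
  trajectory is a property of \<open>x\<close> that is stable under changes on null sets.
\<close>

definition forward_trajectory ::
  "real \<Rightarrow> real^'n^'n \<Rightarrow> real^'m^'n \<Rightarrow> (real \<Rightarrow> real^'n) \<Rightarrow> (real \<Rightarrow> real^'m) \<Rightarrow>
   (real \<Rightarrow> real^'n) \<Rightarrow> bool" where
  "forward_trajectory \<alpha> A B \<psi> u x \<longleftrightarrow>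
     laplace_transformable \<psi> \<and> solves_transformed_system \<alpha> A B (laplace \<psi>) u x"

definition history_init :: "real \<Rightarrow> (real \<Rightarrow> real^'n) \<Rightarrow> real \<Rightarrow> real^'n" where
  "history_init \<alpha> h t =
     Lim at_bot (\<lambda>\<omega>. vector_derivative
       (\<lambda>r. (1 / Gamma (1 - \<alpha>)) *\<^sub>R integral {\<omega>..0} (\<lambda>\<tau>. (1 / (r - \<tau>) powr \<alpha>) *\<^sub>R h \<tau>)) (at t))"

text \<open>
  For \<open>\<alpha> = 1\<close> the initialization generated by the constant history \<open>a\<close> is \<open>- a\<close> times the Dirac
  delta at 0, given here by its transform \<open>- a\<close>.
\<close>

definition forward_trajectory_const ::
  "real \<Rightarrow> real^'n^'n \<Rightarrow> real^'m^'n \<Rightarrow> real^'n \<Rightarrow> (real \<Rightarrow> real^'m) \<Rightarrow>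
   (real \<Rightarrow> real^'n) \<Rightarrow> bool" where
  "forward_trajectory_const \<alpha> A B a u x \<longleftrightarrow>
     (if \<alpha> = 1 then solves_transformed_system \<alpha> A B (\<lambda>s. - cvec a) u x
      else forward_trajectory \<alpha> A B (history_init \<alpha> (\<lambda>\<tau>. a)) u x)"

end

theory Submission
  imports Defs
begin

text \<open>
  In the Laplace domain the system reads \<open>(s\<^sup>\<alpha> - A) X(s) = B U(s) - \<Psi>(s)\<close>.  Termwise integration of the
  Mittag-Leffler series gives the transform \<open>(s\<^sup>\<alpha> - A)\<^sup>-\<^sup>1\<close> of \<open>e\<^sub>\<alpha>\<^sup>A\<^sup>t\<close>, absolutely convergent once
  \<open>Re s\<close> is large, so that the convolution of \<open>e\<^sub>\<alpha>\<^sup>A\<^sup>t\<close> with \<open>B u - \<psi>\<close> solves the transformed equation even though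
  the transforms of \<open>u\<close> and \<open>\<psi>\<close> may converge only conditionally.  Since \<open>s\<^sup>\<alpha> - A\<close> is injective for
  large real \<open>s\<close>, Lerch's theorem makes the solution unique up to null sets.  For a constant history,
  \<open>- \<Psi>(s) = s\<^sup>\<alpha>\<^sup>-\<^sup>1 a\<close>, and \<open>s\<^sup>\<alpha>\<^sup>-\<^sup>1 (s\<^sup>\<alpha> - A)\<^sup>-\<^sup>1\<close> is the transform of \<open>E\<^sub>\<alpha>(A t\<^sup>\<alpha>)\<close>.
\<close>


section \<open>Convolutions of locally integrable functions\<close>

text \<open>It is therefore used only over bounded intervals; there it turns the partial transform
  of a convolution into the integral of an absolutely integrable kernel against shifted partial
  integrals of f. These are bounded and convergent, so dominated convergence gives the limit. The
  same bounded primitive, reached by integration by parts, gives convergence in a half-plane and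
  reduces Lerch's theorem to moments of a continuous function. A second obstacle is pointwise
  meaning. For \<alpha> < 1 the kernel is in general singular at 0, and \<psi> may be unbounded, so
  the convolution at a given t may diverge. It exists for almost every t, and at every t > 0 near
  which \<psi> is bounded. At such t it is also continuous, which upgrades almost-everywhere
  uniqueness to equality for solutions continuous at t. The matrix problem is reduced to scalar
  kernels, one for each entry, controlled through the sum of the absolute values of all entries of
  A.\<close>

lemma absolutely_integrable_AE_lborel:
  fixes g h :: "real \<Rightarrow> 'a::euclidean_space"
  assumes g: "integrable lborel g" and eq: "AE x in lborel. g x = (if x \<in> S then h x else 0)"
  shows "h absolutely_integrable_on S" and "integral S h = integral\<^sup>L lborel g"
proof -
  let ?h = "\<lambda>x. if x \<in> S then h x else 0"
  have "AE x in lebesgue. g x = ?h x"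
    using eq by (rule AE_completion)
  then obtain N where N: "N \<in> null_sets lebesgue" "{x. g x \<noteq> ?h x} \<subseteq> N"
    by (auto simp: eventually_ae_filter)
  then have neg: "negligible N"
    by (simp add: negligible_iff_null_sets)
  have "g absolutely_integrable_on UNIV"
    using g by (simp add: set_integrable_def integrable_completion)
  then have "?h absolutely_integrable_on UNIV"
    by (rule absolutely_integrable_spike[OF _ neg]) (use N in force)
  then show "h absolutely_integrable_on S"
    by (simp only: absolutely_integrable_restrict_UNIV)
  have "(?h has_integral integral\<^sup>L lborel g) UNIV"
    by (rule has_integral_spike[OF neg _ has_integral_integral_lborel[OF g]]) (use N in force)
  then show "integral S h = integral\<^sup>L lborel g"
    by (simp add: has_integral_restrict_UNIV integral_unique)
qed

lemma integrable_lebesgue_borel_version_real: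
  fixes f :: "real \<Rightarrow> real"
  assumes "integrable lebesgue f"
  obtains g where "integrable lborel g" "AE x in lborel. f x = g x"
proof -
  obtain g where g: "g \<in> borel_measurable lborel" "AE x in lborel. f x = g x"
    using completion_ex_borel_measurable_real[OF borel_measurable_integrable[OF assms]] by auto
  have "integrable lebesgue g"
    using assms g by (subst integrable_cong_AE[of _ _ f])
      (auto intro: AE_completion measurable_completion)
  then have "integrable lborel g"
    using g by (simp add: integrable_completion)
  with g that show ?thesis by blast
qed

text \<open>Fubini is applied on \<open>lborel\<close>, where a Lebesgue measurable function
  composed with (\<tau>, t) -> t - \<tau> has no evident measurability; a Borel version does.
  Vanishing outside the interval holds everywhere, not just almost everywhere, so that supports of
  translates can be computed exactly.\<close>

lemma absolutely_integrable_borel_version: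
  fixes f :: "real \<Rightarrow> complex"
  assumes "f absolutely_integrable_on {a..b}"
  obtains g where "integrable lborel g" "AE x in lborel. g x = (if x \<in> {a..b} then f x else 0)"
    "\<forall>x. x \<notin> {a..b} \<longrightarrow> g x = 0"
proof -
  let ?f = "\<lambda>x. if x \<in> {a..b} then f x else 0"
  have f: "integrable lebesgue ?f"
    using assms absolutely_integrable_restrict_UNIV[of "{a..b}" f]
    by (simp add: set_integrable_def)
  obtain g1 where g1: "integrable lborel g1" "AE x in lborel. Re (?f x) = g1 x"
    using integrable_lebesgue_borel_version_real[OF integrable_Re[OF f]] .
  obtain g2 where g2: "integrable lborel g2" "AE x in lborel. Im (?f x) = g2 x"
    using integrable_lebesgue_borel_version_real[OF integrable_Im[OF f]] .
  \<comment> \<open>The indicator enforces the exact vanishing; \<open>g1\<close> and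
    \<open>g2\<close> are zero there only almost everywhere.\<close>
  define g where "g = (\<lambda>x. indicator {a..b} x *\<^sub>R (complex_of_real (g1 x) + \<i> * complex_of_real (g2 x)))"
  show ?thesis
  proof
    show "integrable lborel g"
      unfolding g_def using g1 g2
      by (intro integrable_mult_indicator Bochner_Integration.integrable_add
           integrable_of_real integrable_mult_right) auto
    show "AE x in lborel. g x = ?f x"
      using g1(2) g2(2) by eventually_elim (auto simp: g_def complex_eq_iff indicator_def split: if_splits)
    show "\<forall>x. x \<notin> {a..b} \<longrightarrow> g x = 0"
      by (simp add: g_def)
  qed
qed

lemma AE_lborel_reflect:
  assumes "AE x in lborel. P (x::real)"
  shows "AE x in lborel. P (t - x)"
proof -
  obtain N where N: "N \<in> sets borel" "N \<in> null_sets lborel" "{x. \<not> P x} \<subseteq> N"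
    using assms unfolding eventually_ae_filter null_sets_def by auto
  have "AE x in lborel. x \<notin> N"
    using N(2) by (rule AE_not_in)
  then have "AE x in lborel. t + (-1) * x \<notin> N"
    using N by (intro AE_borel_affine[where P="\<lambda>x. x \<notin> N"]) auto
  then show ?thesis
    by eventually_elim (use N in auto)
qed

text \<open>Since \<open>k'\<close> vanishes at negative arguments, cutting t at T leaves exactly
  the arguments t - \<tau> in [0, T - \<tau>]. This is the inner integral after the order of
  integration is exchanged.\<close>

lemma integral_shift_indicator:
  fixes k :: "real \<Rightarrow> complex"
  assumes "\<tau> \<in> {0..T}" and k': "integrable lborel k'" and
    k: "AE x in lborel. k' x = (if x \<in> {0..T} then k x else 0)" "\<forall>x. x \<notin> {0..T} \<longrightarrow> k' x = 0"
  shows "(\<integral>t. indicator {0..T} t *\<^sub>R k' (t - \<tau>) \<partial>lborel) = integral {0..T-\<tau>} k"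
proof -
  have "(\<integral>t. indicator {0..T} t *\<^sub>R k' (t - \<tau>) \<partial>lborel)
      = (\<integral>t. indicator {0..T} (\<tau> + t) *\<^sub>R k' t \<partial>lborel)"
    by (subst lborel_integral_real_affine[where c=1 and t=\<tau>]) auto
  also have "\<dots> = integral {0..T-\<tau>} k"
  proof (rule absolutely_integrable_AE_lborel(2)[symmetric])
    show "integrable lborel (\<lambda>t. indicator {0..T} (\<tau> + t) *\<^sub>R k' t)"
    proof (rule Bochner_Integration.integrable_bound[OF k'])
      show "(\<lambda>t. indicator {0..T} (\<tau> + t) *\<^sub>R k' t) \<in> borel_measurable lborel"
        using borel_measurable_integrable[OF k'] by measurable
    qed (auto simp: indicator_def)
    show "AE x in lborel. indicator {0..T} (\<tau> + x) *\<^sub>R k' x = (if x \<in> {0..T-\<tau>} then k x else 0)"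
      using k(1) by eventually_elim (use assms in \<open>auto simp: indicator_def\<close>)
  qed
  finally show ?thesis .
qed

text \<open>Tonelli with translation invariance: for every \<tau> the inner integral of the norm is
  |f(\<tau>)| times the L1 norm of \<open>k\<close>.\<close>

lemma integrable_product_convolution:
  fixes k f :: "real \<Rightarrow> complex"
  assumes k: "integrable lborel k" and f: "integrable lborel f"
  shows "integrable (lborel \<Otimes>\<^sub>M lborel) (\<lambda>(\<tau>, t). f \<tau> * k (t - \<tau>))"
proof (rule lborel_pair.Fubini_integrable)
  note [measurable] = borel_measurable_integrable[OF k] borel_measurable_integrable[OF f]
  show "(\<lambda>(\<tau>, t). f \<tau> * k (t - \<tau>)) \<in> borel_measurable (lborel \<Otimes>\<^sub>M lborel)"
    by measurable
  have sh: "integrable lborel (\<lambda>t. k (t - \<tau>))" for \<tau>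
    using lborel_integrable_real_affine[OF k, of 1 "-\<tau>"] by simp
  have "(\<integral>t. norm (k (t - \<tau>)) \<partial>lborel) = (\<integral>t. norm (k t) \<partial>lborel)" for \<tau>
    by (subst lborel_integral_real_affine[where c=1 and t=\<tau>]) auto
  then show "integrable lborel (\<lambda>\<tau>. \<integral>t. norm (case (\<tau>, t) of (\<tau>, t) \<Rightarrow> f \<tau> * k (t - \<tau>)) \<partial>lborel)"
    using f by (simp add: norm_mult)
  show "AE \<tau> in lborel. integrable lborel (\<lambda>t. case (\<tau>, t) of (\<tau>, t) \<Rightarrow> f \<tau> * k (t - \<tau>))"
    using sh by simp
qed

text \<open>With both functions cut to [0, T], the product f(\<tau>) k(t - \<tau>) is integrable
  over the plane, and for t in [0, T] its slice in \<tau> is supported in [0, t]. Integrability of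
  almost every slice, integrability of the marginal and exchange of the integrals then all come from
  one application of Fubini.\<close>

lemma
  fixes k f :: "real \<Rightarrow> complex"
  assumes k: "k absolutely_integrable_on {0..T}" and f: "f absolutely_integrable_on {0..T}"
  shows convolution_AE_integrable:
      "AE t in lborel. t \<in> {0..T} \<longrightarrow> (\<lambda>\<tau>. k (t - \<tau>) * f \<tau>) absolutely_integrable_on {0..t}"
    and convolution_absolutely_integrable:
      "(\<lambda>t. integral {0..t} (\<lambda>\<tau>. k (t - \<tau>) * f \<tau>)) absolutely_integrable_on {0..T}"
    and integral_convolution:
      "integral {0..T} (\<lambda>t. integral {0..t} (\<lambda>\<tau>. k (t - \<tau>) * f \<tau>))
         = integral {0..T} (\<lambda>\<tau>. f \<tau> * integral {0..T-\<tau>} k)"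
proof -
  obtain k' where k': "integrable lborel k'"
    "AE x in lborel. k' x = (if x \<in> {0..T} then k x else 0)" "\<forall>x. x \<notin> {0..T} \<longrightarrow> k' x = 0"
    using absolutely_integrable_borel_version[OF k] .
  obtain f' where f': "integrable lborel f'"
    "AE x in lborel. f' x = (if x \<in> {0..T} then f x else 0)" "\<forall>x. x \<notin> {0..T} \<longrightarrow> f' x = 0"
    using absolutely_integrable_borel_version[OF f] .
  \<comment> \<open>For \<tau> < 0 or \<tau> > t one of the factors vanishes exactly; elsewhere the
    exceptional null set of \<open>k'\<close> is carried to a null set by \<tau> -> t -
    \<tau>.\<close>
  have eq: "AE \<tau> in lborel. f' \<tau> * k' (t - \<tau>) = (if \<tau> \<in> {0..t} then k (t - \<tau>) * f \<tau> else 0)"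
    if "t \<in> {0..T}" for t
    using AE_lborel_reflect[OF k'(2), of t] f'(2)
    by eventually_elim (use that in \<open>auto simp: f'(3) k'(3)\<close>)
  have P: "integrable (lborel \<Otimes>\<^sub>M lborel) (\<lambda>(\<tau>, t). f' \<tau> * k' (t - \<tau>))"
    by (rule integrable_product_convolution[OF k'(1) f'(1)])
  note [measurable] = borel_measurable_integrable[OF k'(1)] borel_measurable_integrable[OF f'(1)]
  have AEi: "AE t in lborel. integrable lborel (\<lambda>\<tau>. f' \<tau> * k' (t - \<tau>))"
    using lborel_pair.AE_integrable_snd[OF P] .
  then show "AE t in lborel. t \<in> {0..T} \<longrightarrow> (\<lambda>\<tau>. k (t - \<tau>) * f \<tau>) absolutely_integrable_on {0..t}"
    by eventually_elim (use absolutely_integrable_AE_lborel(1)[OF _ eq] in blast)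
  \<comment> \<open>The full product lives on t in [0, 2T]; the cut to [0, T] keeps the part on
    which \<open>eq\<close> identifies the slices.\<close>
  have P': "integrable (lborel \<Otimes>\<^sub>M lborel) (\<lambda>(\<tau>, t). indicator {0..T} t *\<^sub>R (f' \<tau> * k' (t - \<tau>)))"
    by (rule Bochner_Integration.integrable_bound[OF P]) (auto simp: indicator_def)
  let ?c = "\<lambda>t. \<integral>\<tau>. indicator {0..T} t *\<^sub>R (f' \<tau> * k' (t - \<tau>)) \<partial>lborel"
  have c_int: "integrable lborel ?c"
    using lborel_pair.integrable_snd[OF P'] .
  have c_eq: "AE t in lborel. ?c t = (if t \<in> {0..T} then integral {0..t} (\<lambda>\<tau>. k (t - \<tau>) * f \<tau>) else 0)"
    using AEi by eventually_elim (use absolutely_integrable_AE_lborel(2)[OF _ eq] in auto)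
  show "(\<lambda>t. integral {0..t} (\<lambda>\<tau>. k (t - \<tau>) * f \<tau>)) absolutely_integrable_on {0..T}"
    by (rule absolutely_integrable_AE_lborel(1)[OF c_int c_eq])
  have "integral {0..T} (\<lambda>t. integral {0..t} (\<lambda>\<tau>. k (t - \<tau>) * f \<tau>)) = (\<integral>t. ?c t \<partial>lborel)"
    by (rule absolutely_integrable_AE_lborel(2)[OF c_int c_eq])
  also have "\<dots> = (\<integral>\<tau>. (\<integral>t. indicator {0..T} t *\<^sub>R (f' \<tau> * k' (t - \<tau>)) \<partial>lborel) \<partial>lborel)"
    by (rule lborel_pair.Fubini_integral[OF P'])
  also have "\<dots> = integral {0..T} (\<lambda>\<tau>. f \<tau> * integral {0..T-\<tau>} k)"
  proof (rule absolutely_integrable_AE_lborel(2)[OF lborel_pair.integrable_fst[OF P'], symmetric])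
    have "(\<integral>t. indicator {0..T} t *\<^sub>R (f' \<tau> * k' (t - \<tau>)) \<partial>lborel) = f' \<tau> * (if \<tau> \<in> {0..T} then integral {0..T-\<tau>} k else 0)" for \<tau>
    proof (cases "\<tau> \<in> {0..T}")
      case True
      have "(\<integral>t. indicator {0..T} t *\<^sub>R (f' \<tau> * k' (t - \<tau>)) \<partial>lborel) = (\<integral>t. f' \<tau> * (indicator {0..T} t *\<^sub>R k' (t - \<tau>)) \<partial>lborel)"
        by simp
      also have "\<dots> = f' \<tau> * (\<integral>t. (indicator {0..T} t *\<^sub>R k' (t - \<tau>)) \<partial>lborel)"
        by (rule integral_mult_right_zero)
      finally show ?thesis
        using integral_shift_indicator[OF True k'] True by simp
    next
      case False then show ?thesis by (simp add: f'(3))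
    qed
    then show "AE \<tau> in lborel. (\<integral>t. indicator {0..T} t *\<^sub>R (f' \<tau> * k' (t - \<tau>)) \<partial>lborel) =
        (if \<tau> \<in> {0..T} then f \<tau> * integral {0..T-\<tau>} k else 0)"
      by (simp only:) (use f'(2) in eventually_elim, simp)
  qed
  finally show "integral {0..T} (\<lambda>t. integral {0..t} (\<lambda>\<tau>. k (t - \<tau>) * f \<tau>))
         = integral {0..T} (\<lambda>\<tau>. f \<tau> * integral {0..T-\<tau>} k)" .
qed

lemma has_integral_reflect_shift:
  fixes h :: "real \<Rightarrow> 'a::euclidean_space"
  assumes "(h has_integral i) {a..b}"
  shows "((\<lambda>x. h (t - x)) has_integral i) {t-b..t-a}"
proof -
  have "((\<lambda>x. h ((-1) *\<^sub>R x + t)) has_integral (1 / (\<bar>-1\<bar> ^ DIM(real))) *\<^sub>R i) ((\<lambda>x. (1 / (-1)) *\<^sub>R x + - ((1 / (-1)) *\<^sub>R t)) ` cbox a b)"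
    by (rule has_integral_affinity) (use assms in auto)
  moreover have "(\<lambda>x. (1 / (-1)) *\<^sub>R x + - ((1 / (-1)) *\<^sub>R t)) ` cbox a b = {t-b..t-a}"
    by (auto simp: image_iff intro: bexI[of _ "t - _"])
  ultimately show ?thesis
    by simp
qed

text \<open>No integrability is assumed: reflection preserves \<open>has_integral\<close> in both
  directions, so in the divergent case both sides take the same default value.\<close>

lemma integral_reflect_interval:
  fixes h :: "real \<Rightarrow> 'a::euclidean_space"
  shows "integral {0..t} (\<lambda>x. h (t - x)) = integral {0..t} h"
proof -
  have "((\<lambda>x. h (t - x)) has_integral i) {0..t} \<longleftrightarrow> (h has_integral i) {0..t}" for i
    using has_integral_reflect_shift[of h i 0 t t] has_integral_reflect_shift[of "\<lambda>x. h (t - x)" i 0 t t]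
    by auto
  then show ?thesis
    unfolding integral_def integrable_on_def by simp
qed

text \<open>The other order of integration: here the inner primitive is that of f, the function
  whose transform may converge only conditionally.\<close>

lemma integral_convolution_commuted:
  fixes k f :: "real \<Rightarrow> complex"
  assumes k: "k absolutely_integrable_on {0..T}" and f: "f absolutely_integrable_on {0..T}"
  shows "integral {0..T} (\<lambda>t. integral {0..t} (\<lambda>\<tau>. k (t - \<tau>) * f \<tau>))
         = integral {0..T} (\<lambda>r. k r * integral {0..T-r} f)"
proof -
  have "integral {0..t} (\<lambda>\<tau>. k (t - \<tau>) * f \<tau>) = integral {0..t} (\<lambda>\<tau>. f (t - \<tau>) * k \<tau>)" for t
    by (subst integral_reflect_interval[symmetric]) (simp add: mult.commute)
  then show ?thesis
    using integral_convolution[OF f k] by simp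
qed

section \<open>Conditionally convergent Laplace transforms\<close>

lemma absolutely_integrable_continuous_times:
  fixes f h :: "real \<Rightarrow> 'a::{euclidean_space,real_normed_algebra}"
  assumes "continuous_on {a..b} h" "f absolutely_integrable_on {a..b}"
  shows "(\<lambda>t. h t * f t) absolutely_integrable_on {a..b}"
proof (rule absolutely_integrable_bounded_measurable_product[where h="(*)"])
  show "bilinear ((*) :: 'a \<Rightarrow> 'a \<Rightarrow> 'a)"
    by (simp add: bilinear_conv_bounded_bilinear bounded_bilinear_mult)
  show "h \<in> borel_measurable (lebesgue_on {a..b})"
    using assms(1) by (intro continuous_imp_measurable_on_sets_lebesgue) auto
  show "bounded (h ` {a..b})"
    using assms(1) by (intro compact_imp_bounded compact_continuous_image) auto
qed (use assms in auto)

text \<open>Relational form of the scalar transform: convergence and value come together, so that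
  linear combinations and limits never go through \<open>Lim\<close>.\<close>

definition has_laplace :: "(real \<Rightarrow> complex) \<Rightarrow> complex \<Rightarrow> complex \<Rightarrow> bool" where
  "has_laplace f s L \<longleftrightarrow> (\<forall>T>0. f absolutely_integrable_on {0..T}) \<and>
     ((\<lambda>T. integral {0..T} (\<lambda>t. exp (- (s * of_real t)) * f t)) \<longlongrightarrow> L) at_top"

lemma has_laplace_unique: "has_laplace f s L \<Longrightarrow> has_laplace f s M \<Longrightarrow> L = M"
  by (auto simp: has_laplace_def intro: tendsto_unique[OF trivial_limit_at_top_linorder])

lemma absolutely_integrable_exp_times:
  fixes f :: "real \<Rightarrow> complex"
  assumes "f absolutely_integrable_on {a..b}"
  shows "(\<lambda>t. exp (- (s * of_real t)) * f t) absolutely_integrable_on {a..b}"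
  using assms by (intro absolutely_integrable_continuous_times continuous_intros) auto

lemma has_laplaceD:
  assumes "has_laplace f s L"
  shows "f absolutely_integrable_on {0..T}"
    and "(\<lambda>t. exp (- (w * of_real t)) * f t) absolutely_integrable_on {0..T}"
    and "((\<lambda>T. integral {0..T} (\<lambda>t. exp (- (s * of_real t)) * f t)) \<longlongrightarrow> L) at_top"
proof -
  \<comment> \<open>\<open>max T 1\<close> reaches the endpoints T <= 0, about which the definition
    says nothing.\<close>
  have "f absolutely_integrable_on {0..max T 1}"
    using assms by (simp add: has_laplace_def)
  then show "f absolutely_integrable_on {0..T}"
    by (rule absolutely_integrable_on_subinterval) auto
  then show "(\<lambda>t. exp (- (w * of_real t)) * f t) absolutely_integrable_on {0..T}"
    by (rule absolutely_integrable_exp_times)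
qed (use assms in \<open>auto simp: has_laplace_def\<close>)

lemma has_laplace_add:
  assumes "has_laplace f s L" "has_laplace g s M"
  shows "has_laplace (\<lambda>t. f t + g t) s (L + M)"
  unfolding has_laplace_def
proof (intro conjI allI impI)
  fix T :: real assume "T > 0"
  show "(\<lambda>t. f t + g t) absolutely_integrable_on {0..T}"
    by (intro set_integral_add(1) has_laplaceD(1)[OF assms(1)] has_laplaceD(1)[OF assms(2)])
next
  have "integral {0..T} (\<lambda>t. exp (- (s * of_real t)) * (f t + g t)) =
     integral {0..T} (\<lambda>t. exp (- (s * of_real t)) * f t) + integral {0..T} (\<lambda>t. exp (- (s * of_real t)) * g t)" for T
    unfolding distrib_left
    by (intro Henstock_Kurzweil_Integration.integral_add set_lebesgue_integral_eq_integral(1)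
        has_laplaceD(2)[OF assms(1)] has_laplaceD(2)[OF assms(2)])
  then show "((\<lambda>T. integral {0..T} (\<lambda>t. exp (- (s * of_real t)) * (f t + g t))) \<longlongrightarrow> L + M) at_top"
    by (simp only:) (intro tendsto_add has_laplaceD(3)[OF assms(1)] has_laplaceD(3)[OF assms(2)])
qed

lemma has_laplace_cmult:
  assumes "has_laplace f s L"
  shows "has_laplace (\<lambda>t. c * f t) s (c * L)"
  unfolding has_laplace_def
proof (intro conjI allI impI)
  fix T :: real assume "T > 0"
  show "(\<lambda>t. c * f t) absolutely_integrable_on {0..T}"
    by (intro absolutely_integrable_continuous_times continuous_intros has_laplaceD(1)[OF assms(1)])
next
  have "integral {0..T} (\<lambda>t. exp (- (s * of_real t)) * (c * f t)) =
     c * integral {0..T} (\<lambda>t. exp (- (s * of_real t)) * f t)" for T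
    by (subst mult.left_commute) (rule integral_mult_right)
  then show "((\<lambda>T. integral {0..T} (\<lambda>t. exp (- (s * of_real t)) * (c * f t))) \<longlongrightarrow> c * L) at_top"
    by (simp only:) (intro tendsto_mult_left has_laplaceD(3)[OF assms(1)])
qed

lemma has_laplace_zero: "has_laplace (\<lambda>t. 0) s 0"
  by (simp add: has_laplace_def)

lemma has_laplace_sum:
  assumes "finite I" "\<And>i. i \<in> I \<Longrightarrow> has_laplace (f i) s (L i)"
  shows "has_laplace (\<lambda>t. \<Sum>i\<in>I. f i t) s (\<Sum>i\<in>I. L i)"
  using assms by (induction I rule: finite_induct) (auto intro: has_laplace_zero has_laplace_add)

lemma has_laplace_diff:
  assumes "has_laplace f s L" "has_laplace g s M"
  shows "has_laplace (\<lambda>t. f t - g t) s (L - M)"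
  using has_laplace_add[OF assms(1) has_laplace_cmult[OF assms(2), of "-1"]] by simp

lemma AE_lebesgue_negligible:
  assumes "AE t in lebesgue. P t"
  obtains N where "negligible N" "\<And>t. t \<notin> N \<Longrightarrow> P t"
proof -
  obtain N where "N \<in> null_sets lebesgue" "{t. \<not> P t} \<subseteq> N"
    using assms by (auto simp: eventually_ae_filter)
  then show ?thesis
    using that[of N] by (auto simp: negligible_iff_null_sets)
qed

text \<open>Lets a formula valid only for almost every t > 0 be used under the transform, notably
  for convolutions that exist only almost everywhere.\<close>

lemma has_laplace_AE_cong:
  assumes f: "has_laplace f s L" and eq: "AE t in lebesgue. 0 < t \<longrightarrow> f t = g t"
  shows "has_laplace g s L"
proof -
  obtain N where N: "negligible N" "\<And>t. t \<notin> N \<Longrightarrow> 0 < t \<longrightarrow> f t = g t"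
    using eq by (rule AE_lebesgue_negligible) blast
  have neg: "negligible (insert 0 N)"
    using N by simp
  have "g absolutely_integrable_on {0..T}" for T
    by (rule absolutely_integrable_spike[OF has_laplaceD(1)[OF f] neg]) (use N in force)
  moreover have "integral {0..T} (\<lambda>t. exp (- (s * of_real t)) * f t) =
      integral {0..T} (\<lambda>t. exp (- (s * of_real t)) * g t)" for T
    by (rule integral_spike[OF neg]) (use N in force)
  ultimately show ?thesis
    using has_laplaceD(3)[OF f] by (simp add: has_laplace_def)
qed

text \<open>Integration by parts for a merely integrable f, whose primitive need not be
  differentiable everywhere. The convolution of f with r -> exp(w r) is integrated in both orders:
  one has the primitive of f inside, the other the elementary primitive of the exponential.\<close>

lemma laplace_by_parts:
  fixes f :: "real \<Rightarrow> complex"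
  assumes f: "f absolutely_integrable_on {0..T}" and w: "w \<noteq> 0"
  shows "integral {0..T} (\<lambda>t. exp (- (w * of_real t)) * f t) =
    exp (- (w * of_real T)) * integral {0..T} f
      + w * integral {0..T} (\<lambda>t. exp (- (w * of_real t)) * integral {0..t} f)"
proof -
  let ?k = "\<lambda>r. exp (w * complex_of_real r)"
  let ?G = "\<lambda>t. integral {0..t} f"
  have k: "?k absolutely_integrable_on {0..T}"
    by (intro absolutely_integrable_continuous_real continuous_intros)
  have fi: "f integrable_on {0..T}"
    using f by (rule set_lebesgue_integral_eq_integral(1))
  have Ef: "(\<lambda>t. exp (- (w * of_real t)) * f t) integrable_on {0..T}"
    using absolutely_integrable_exp_times[OF f] by (rule set_lebesgue_integral_eq_integral(1))
  have ki: "integral {0..T-\<tau>} ?k = (?k (T - \<tau>) - 1) / w" if "\<tau> \<in> {0..T}" for \<tau>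
  proof -
    have "(?k has_integral (exp (w * of_real (T - \<tau>)) / w - exp (w * of_real 0) / w)) {0..T-\<tau>}"
      using that w
      by (intro fundamental_theorem_of_calculus)
         (auto intro!: derivative_eq_intros has_vector_derivative_real_field)
    then show ?thesis by (simp add: integral_unique diff_divide_distrib)
  qed
  have "integral {0..T} (\<lambda>r. ?k r * ?G (T - r)) = integral {0..T} (\<lambda>\<tau>. f \<tau> * integral {0..T-\<tau>} ?k)"
    using integral_convolution_commuted[OF k f] integral_convolution[OF k f] by simp
  also have "\<dots> = integral {0..T} (\<lambda>\<tau>. (?k T / w) * (exp (- (w * of_real \<tau>)) * f \<tau>) - (1 / w) * f \<tau>)"
  proof (rule Henstock_Kurzweil_Integration.integral_cong)
    fix \<tau> assume "\<tau> \<in> {0..T}"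
    then have "f \<tau> * integral {0..T-\<tau>} ?k = f \<tau> * ((?k T * exp (- (w * of_real \<tau>)) - 1) / w)"
      by (subst ki) (auto simp: exp_diff exp_minus field_simps)
    then show "f \<tau> * integral {0..T-\<tau>} ?k = (?k T / w) * (exp (- (w * of_real \<tau>)) * f \<tau>) - (1 / w) * f \<tau>"
      using w by (simp add: field_simps)
  qed
  also have "\<dots> = (?k T / w) * integral {0..T} (\<lambda>t. exp (- (w * of_real t)) * f t) - (1 / w) * ?G T"
    by (subst Henstock_Kurzweil_Integration.integral_diff)
       (auto intro: integrable_on_mult_right Ef fi simp del: times_divide_eq_left mult_cancel_left1)
  finally have 1: "integral {0..T} (\<lambda>r. ?k r * ?G (T - r)) = 
      (?k T / w) * integral {0..T} (\<lambda>t. exp (- (w * of_real t)) * f t) - (1 / w) * ?G T" .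
  \<comment> \<open>Reflection r = T - t pulls out exp(w T) and leaves the transform of the
    primitive.\<close>
  have "integral {0..T} (\<lambda>r. ?k r * ?G (T - r)) = integral {0..T} (\<lambda>t. ?k (T - t) * ?G t)"
    by (subst integral_reflect_interval[symmetric]) simp
  also have "\<dots> = integral {0..T} (\<lambda>t. ?k T * (exp (- (w * of_real t)) * ?G t))"
    by (rule arg_cong[where f="integral _"]) (auto simp: exp_diff exp_minus field_simps)
  also have "\<dots> = ?k T * integral {0..T} (\<lambda>t. exp (- (w * of_real t)) * ?G t)"
    by simp
  finally have "?k T * integral {0..T} (\<lambda>t. exp (- (w * of_real t)) * ?G t) =
      (?k T / w) * integral {0..T} (\<lambda>t. exp (- (w * of_real t)) * f t) - (1 / w) * ?G T"
    using 1 by simp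
  then have "integral {0..T} (\<lambda>t. exp (- (w * of_real t)) * f t)
     = ?G T / ?k T + w * integral {0..T} (\<lambda>t. exp (- (w * of_real t)) * ?G t)"
    using w by (simp add: field_simps)
  then show ?thesis
    by (simp add: exp_minus field_simps)
qed

lemma continuous_on_indefinite_integral_ray:
  fixes f :: "real \<Rightarrow> 'a::euclidean_space"
  assumes "\<And>T. f integrable_on {0..T}"
  shows "continuous_on {0..} (\<lambda>t. integral {0..t} f)"
proof (subst continuous_on_eq_continuous_within, intro ballI)
  fix x :: real assume x: "x \<in> {0..}"
  have "continuous_on {0..x+1} (\<lambda>t. integral {0..t} f)"
    using assms by (rule indefinite_integral_continuous_1)
  then have "continuous (at x within {0..x+1}) (\<lambda>t. integral {0..t} f)"
    using x by (simp add: continuous_on_eq_continuous_within)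
  moreover have "at x within {0..x+1} = at x within {0..}"
    by (rule at_within_nhd[of _ "{..<x+1}"]) auto
  ultimately show "continuous (at x within {0..}) (\<lambda>t. integral {0..t} f)"
    by simp
qed

lemma bounded_convergent_indefinite_integral:
  fixes f :: "real \<Rightarrow> 'a::euclidean_space"
  assumes f: "\<And>T. f integrable_on {0..T}" and L: "((\<lambda>t. integral {0..t} f) \<longlongrightarrow> L) at_top"
  obtains C where "\<And>t. norm (integral {0..t} f) \<le> C"
proof -
  let ?G = "\<lambda>t. integral {0..t} f"
  have "eventually (\<lambda>t. dist (?G t) L < 1) at_top"
    using L by (rule tendstoD) simp
  then obtain T where T: "\<And>t. t \<ge> T \<Longrightarrow> dist (?G t) L < 1"
    by (auto simp: eventually_at_top_linorder)
  have "bounded (?G ` {0..T})"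
    using f by (intro compact_imp_bounded compact_continuous_image indefinite_integral_continuous_1) auto
  then obtain B where B: "\<forall>t\<in>{0..T}. norm (?G t) \<le> B"
    by (auto simp: bounded_iff)
  \<comment> \<open>The 0 covers t < 0, where the interval is empty and the integral is 0;
    \<open>B\<close> alone may be negative when T < 0.\<close>
  have "norm (?G t) \<le> max 0 (max B (norm L + 1))" for t
  proof -
    consider "t < 0" | "t \<in> {0..T}" | "t \<ge> T" by force
    then show ?thesis
    proof cases
      case 3
      then have "norm (?G t - L) < 1" using T[of t] by (simp add: dist_norm)
      then have "norm (?G t) \<le> norm L + 1" using norm_triangle_sub[of "?G t" L] by simp
      then show ?thesis by simp
    next
      case 2 show ?thesis using bspec[OF B 2] by simp
    qed simp
  qed
  then show ?thesis by (rule that)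
qed

lemma tendsto_integral_ray:
  fixes f :: "real \<Rightarrow> 'a::euclidean_space"
  assumes "f absolutely_integrable_on {0..}"
  shows "((\<lambda>T. integral {0..T} f) \<longlongrightarrow> integral {0..} f) at_top"
proof -
  have "((\<lambda>T. LINT x:{0..T}|lebesgue. f x) \<longlongrightarrow> (LINT x:{0..}|lebesgue. f x)) at_top"
    by (rule tendsto_set_lebesgue_integral_at_top) (use assms in auto)
  moreover have "(LINT x:{0..T}|lebesgue. f x) = integral {0..T} f" for T
    by (rule set_lebesgue_integral_eq_integral(2)) (rule set_integrable_subset[OF assms], auto)
  moreover have "(LINT x:{0..}|lebesgue. f x) = integral {0..} f"
    by (rule set_lebesgue_integral_eq_integral(2)[OF assms])
  ultimately show ?thesis by simp
qed

lemma absolutely_integrable_exp_bounded: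
  fixes G :: "real \<Rightarrow> complex"
  assumes G: "continuous_on {0..} G" "\<And>t. t \<ge> 0 \<Longrightarrow> norm (G t) \<le> C" and w: "Re w > 0"
  shows "(\<lambda>t. exp (- (w * of_real t)) * G t) absolutely_integrable_on {0..}"
proof (rule measurable_bounded_by_integrable_imp_absolutely_integrable)
  show "(\<lambda>t. exp (- (w * of_real t)) * G t) \<in> borel_measurable (lebesgue_on {0..})"
    by (intro continuous_imp_measurable_on_sets_lebesgue continuous_intros G) auto
  show "(\<lambda>t. C * exp (- Re w * t)) integrable_on {0..}"
    using integrable_on_exp_minus_to_infinity[OF w, of 0] by (intro integrable_on_mult_right) simp
  show "norm (exp (- (w * of_real t)) * G t) \<le> C * exp (- Re w * t)" if "t \<in> {0..}" for t
    using G(2)[of t] that by (simp add: norm_mult mult_right_mono)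
qed auto

text \<open>Abel's device: after integration by parts, possibly conditional convergence at s becomes
  absolute convergence at s + w, since the partial transform \<open>G\<close> is bounded. The same
  formula later produces the moments in Lerch's theorem.\<close>

lemma laplace_abel:
  fixes f :: "real \<Rightarrow> complex"
  assumes f: "has_laplace f s L" and w: "Re w > 0"
  defines "G \<equiv> \<lambda>t. integral {0..t} (\<lambda>t. exp (- (s * of_real t)) * f t)"
  shows "(\<lambda>t. exp (- (w * of_real t)) * G t) absolutely_integrable_on {0..}"
    and "has_laplace f (s + w) (w * integral {0..} (\<lambda>t. exp (- (w * of_real t)) * G t))"
proof -
  let ?g = "\<lambda>t. exp (- (s * of_real t)) * f t"
  have ga: "?g absolutely_integrable_on {0..T}" for T
    by (rule has_laplaceD(2)[OF f])
  then have gi: "?g integrable_on {0..T}" for T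
    by (rule set_lebesgue_integral_eq_integral(1))
  have G: "(G \<longlongrightarrow> L) at_top"
    unfolding G_def by (rule has_laplaceD(3)[OF f])
  obtain C where C: "\<And>t. norm (G t) \<le> C"
    using bounded_convergent_indefinite_integral[OF gi has_laplaceD(3)[OF f]] unfolding G_def by blast
  show int: "(\<lambda>t. exp (- (w * of_real t)) * G t) absolutely_integrable_on {0..}"
    by (rule absolutely_integrable_exp_bounded[OF _ C w])
       (auto simp: G_def intro!: continuous_on_indefinite_integral_ray gi)
  \<comment> \<open>This makes the boundary term exp(- w T) G(T) tend to 0, as \<open>G\<close>
    converges.\<close>
  have "((\<lambda>T. exp (- (Re w * T))) \<longlongrightarrow> 0) at_top"
    using w by (intro filterlim_compose[OF exp_at_bot] filterlim_compose[OF filterlim_uminus_at_bot_at_top]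
      filterlim_tendsto_pos_mult_at_top[OF tendsto_const _ filterlim_ident])
  then have "((\<lambda>T. exp (- (w * of_real T))) \<longlongrightarrow> 0) at_top"
    by (subst tendsto_norm_zero_iff[symmetric]) simp
  from tendsto_mult[OF this G]
  have 1: "((\<lambda>T. exp (- (w * of_real T)) * G T + w * integral {0..T} (\<lambda>t. exp (- (w * of_real t)) * G t))
     \<longlongrightarrow> 0 * L + w * integral {0..} (\<lambda>t. exp (- (w * of_real t)) * G t)) at_top"
    by (intro tendsto_add tendsto_mult_left tendsto_integral_ray int)
  have "w \<noteq> 0" using w by auto
  then have "integral {0..T} (\<lambda>t. exp (- ((s + w) * of_real t)) * f t) =
     exp (- (w * of_real T)) * G T + w * integral {0..T} (\<lambda>t. exp (- (w * of_real t)) * G t)" for T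
    using laplace_by_parts[OF ga, of w T] unfolding G_def
    by (simp add: distrib_right exp_add algebra_simps mult_exp_exp)
  then show "has_laplace f (s + w) (w * integral {0..} (\<lambda>t. exp (- (w * of_real t)) * G t))"
    using 1 f by (simp add: has_laplace_def)
qed

lemma has_laplace_halfplane:
  assumes "has_laplace f s L" "Re s < Re z"
  obtains M where "has_laplace f z M"
  using laplace_abel(2)[OF assms(1), of "z - s"] assms(2) by auto

text \<open>Dominated convergence in T: for each fixed r >= 0 the factor \<Phi>(T - r) tends to F,
  and C |k(r)| dominates. Absolute integrability is asked of the kernel alone, so \<Phi> may come
  from a conditionally convergent integral.\<close>

lemma tendsto_integral_convolution:
  fixes k :: "real \<Rightarrow> complex" and \<Phi> :: "real \<Rightarrow> complex"
  assumes k: "k absolutely_integrable_on {0..}"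
    and cont: "continuous_on {0..} \<Phi>" and lim: "(\<Phi> \<longlongrightarrow> F) at_top"
    and bd: "\<And>t. norm (\<Phi> t) \<le> C"
  shows "((\<lambda>T. integral {0..T} (\<lambda>r. k r * \<Phi> (T - r))) \<longlongrightarrow> integral {0..} k * F) at_top"
proof -
  let ?s = "\<lambda>T r. indicator {0..T} r *\<^sub>R (k r * \<Phi> (T - r))"
  have kT: "k absolutely_integrable_on {0..T}" for T
    by (rule set_integrable_subset[OF k]) auto
  have s_ai: "(\<lambda>r. k r * \<Phi> (T - r)) absolutely_integrable_on {0..T}" for T
  proof -
    have "(\<lambda>r. \<Phi> (T - r) * k r) absolutely_integrable_on {0..T}"
      by (intro absolutely_integrable_continuous_times kT continuous_on_compose2[OF cont] continuous_intros) auto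
    then show ?thesis by (simp add: mult.commute)
  qed
  then have s_int: "integrable lebesgue (?s T)" for T
    by (simp add: set_integrable_def)
  have k_int: "integrable lebesgue (\<lambda>r. indicator {0..} r *\<^sub>R k r)"
    using k by (simp add: set_integrable_def)
  have "((\<lambda>T. integral\<^sup>L lebesgue (?s T)) \<longlongrightarrow> integral\<^sup>L lebesgue (\<lambda>r. (indicator {0..} r *\<^sub>R k r) * F)) at_top"
  proof (rule integral_dominated_convergence_at_top)
    show "(\<lambda>r. (indicator {0..} r *\<^sub>R k r) * F) \<in> borel_measurable lebesgue"
      using borel_measurable_integrable[OF k_int] by measurable
    show "?s T \<in> borel_measurable lebesgue" for T
      using borel_measurable_integrable[OF s_int] .
    show "integrable lebesgue (\<lambda>r. norm (indicator {0..} r *\<^sub>R k r) * C)"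
      by (intro integrable_mult_left integrable_norm k_int)
    show "AE r in lebesgue. ((\<lambda>T. ?s T r) \<longlongrightarrow> (indicator {0..} r *\<^sub>R k r) * F) at_top"
    proof (rule AE_I2)
      fix r :: real
      show "((\<lambda>T. ?s T r) \<longlongrightarrow> (indicator {0..} r *\<^sub>R k r) * F) at_top"
      proof (cases "r \<ge> 0")
        case True
        have "filterlim (\<lambda>T. -r + T) at_top at_top"
          by (rule filterlim_tendsto_add_at_top[OF tendsto_const filterlim_ident])
        then have "((\<lambda>T. \<Phi> (T - r)) \<longlongrightarrow> F) at_top"
          using filterlim_compose[OF lim] by simp
        then have "((\<lambda>T. k r * \<Phi> (T - r)) \<longlongrightarrow> k r * F) at_top"
          by (rule tendsto_mult_left)
        moreover have "eventually (\<lambda>T. k r * \<Phi> (T - r) = ?s T r) at_top"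
          using eventually_ge_at_top[of r] by eventually_elim (use True in auto)
        ultimately have "((\<lambda>T. ?s T r) \<longlongrightarrow> k r * F) at_top"
          by (rule Lim_transform_eventually)
        then show ?thesis using True by simp
      qed auto
    qed
    show "\<forall>\<^sub>F T in at_top. AE r in lebesgue. norm (?s T r) \<le> norm (indicator {0..} r *\<^sub>R k r) * C"
      using bd order_trans[OF norm_ge_zero bd[of 0]]
      by (intro always_eventually allI AE_I2) (auto simp: indicator_def norm_mult intro!: mult_left_mono)
  qed
  moreover have "integral\<^sup>L lebesgue (?s T) = integral {0..T} (\<lambda>r. k r * \<Phi> (T - r))" for T
    using set_lebesgue_integral_eq_integral(2)[OF s_ai] by (simp add: set_lebesgue_integral_def)
  moreover have "integral\<^sup>L lebesgue (\<lambda>r. (indicator {0..} r *\<^sub>R k r) * F) = integral {0..} k * F"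
    using set_lebesgue_integral_eq_integral(2)[OF k] unfolding set_lebesgue_integral_def integral_mult_left_zero by simp
  ultimately show ?thesis by simp
qed

text \<open>A continuous analogue of Mertens' theorem on Cauchy products: one factor converges
  absolutely, the other perhaps only conditionally. Writing exp(- s t) = exp(- s (t - \<tau>)) exp(-
  s \<tau>) makes the weighted convolution a convolution of weighted functions, and integration over
  [0, T] puts the partial transform of f inside.\<close>

lemma has_laplace_convolution:
  fixes k f :: "real \<Rightarrow> complex"
  assumes k: "(\<lambda>t. exp (- (s * of_real t)) * k t) absolutely_integrable_on {0..}"
    and f: "has_laplace f s F"
  shows "has_laplace (\<lambda>t. integral {0..t} (\<lambda>\<tau>. k (t - \<tau>) * f \<tau>)) s
     (integral {0..} (\<lambda>t. exp (- (s * of_real t)) * k t) * F)"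
  unfolding has_laplace_def
proof (intro conjI allI impI)
  let ?e = "\<lambda>t::real. exp (- (s * of_real t))"
  let ?ks = "\<lambda>t. ?e t * k t" and ?fs = "\<lambda>t. ?e t * f t"
  let ?\<Phi> = "\<lambda>t. integral {0..t} ?fs"
  have ksT: "?ks absolutely_integrable_on {0..T}" for T
    by (rule set_integrable_subset[OF k]) auto
  have fsT: "?fs absolutely_integrable_on {0..T}" for T
    by (rule has_laplaceD(2)[OF f])
  then have fsi: "?fs integrable_on {0..T}" for T
    by (rule set_lebesgue_integral_eq_integral(1))
  have kT: "k absolutely_integrable_on {0..T}" for T
  proof -
    have "(\<lambda>t. exp (s * of_real t) * ?ks t) absolutely_integrable_on {0..T}"
      by (intro absolutely_integrable_continuous_times ksT continuous_intros)
    then show ?thesis by (simp add: mult_exp_exp flip: mult.assoc)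
  qed
  show "(\<lambda>t. integral {0..t} (\<lambda>\<tau>. k (t - \<tau>) * f \<tau>)) absolutely_integrable_on {0..T}" for T
    by (rule convolution_absolutely_integrable[OF kT has_laplaceD(1)[OF f]])
  have "?e t * integral {0..t} (\<lambda>\<tau>. k (t - \<tau>) * f \<tau>) = integral {0..t} (\<lambda>\<tau>. ?ks (t - \<tau>) * ?fs \<tau>)" for t
  proof -
    have "?ks (t - \<tau>) * ?fs \<tau> = ?e t * (k (t - \<tau>) * f \<tau>)" for \<tau>
      by (simp add: algebra_simps exp_add exp_diff exp_minus field_simps)
    then show ?thesis by (simp only: integral_mult_right)
  qed
  then have eq: "integral {0..T} (\<lambda>t. ?e t * integral {0..t} (\<lambda>\<tau>. k (t - \<tau>) * f \<tau>)) =
      integral {0..T} (\<lambda>r. ?ks r * ?\<Phi> (T - r))" for T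
    using integral_convolution_commuted[OF ksT fsT] by simp
  obtain C where C: "\<And>t. norm (?\<Phi> t) \<le> C"
    using bounded_convergent_indefinite_integral[OF fsi has_laplaceD(3)[OF f]] by blast
  show "((\<lambda>T. integral {0..T} (\<lambda>t. ?e t * integral {0..t} (\<lambda>\<tau>. k (t - \<tau>) * f \<tau>))) \<longlongrightarrow>
     integral {0..} ?ks * F) at_top"
    unfolding eq
    by (rule tendsto_integral_convolution[OF k _ _ C])
       (auto intro!: continuous_on_indefinite_integral_ray fsi has_laplaceD(3)[OF f])
qed

section \<open>Lerch's theorem\<close>

text \<open>Lebesgue differentiation: right-hand averages of \<open>g\<close> tend to
  \<open>g\<close> almost everywhere, and these averages are all 0. Extension by 0 to the negative
  axis makes the function locally integrable on the whole line, as
  \<open>integrable_ccontinuous_explicit\<close> requires.\<close>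

lemma AE_zero_of_indefinite_integral_zero:
  fixes g :: "real \<Rightarrow> real"
  assumes g: "\<And>T. g absolutely_integrable_on {0..T}" and zero: "\<And>t. 0 \<le> t \<Longrightarrow> integral {0..t} g = 0"
  shows "AE t in lebesgue. 0 < t \<longrightarrow> g t = 0"
proof -
  let ?g = "\<lambda>x. if x \<in> {0..} then g x else 0"
  have gi: "g integrable_on {0..T}" for T
    using g by (rule set_lebesgue_integral_eq_integral(1))
  have gi': "g integrable_on {a..b}" if "0 \<le> a" for a b
    by (rule integrable_on_subinterval[OF gi[of b]]) (use that in auto)
  have "?g integrable_on cbox a b" for a b
  proof -
    have "g integrable_on {max 0 a..b}" by (rule gi') simp
    then have "?g integrable_on {max 0 a..b}"
      by (rule integrable_eq) auto
    then have "(\<lambda>x. if x \<in> {max 0 a..b} then ?g x else 0) integrable_on UNIV"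
      by (simp only: integrable_restrict_UNIV)
    also have "(\<lambda>x. if x \<in> {max 0 a..b} then ?g x else 0) = (\<lambda>x. if x \<in> {a..b} then ?g x else 0)"
      by auto
    finally show ?thesis by (simp only: integrable_restrict_UNIV cbox_interval)
  qed
  then obtain N where N: "negligible N"
    "\<And>x e. \<lbrakk>x \<notin> N; 0 < e\<rbrakk> \<Longrightarrow> \<exists>d>0. \<forall>h. 0 < h \<and> h < d \<longrightarrow>
        norm (integral (cbox x (x + h *\<^sub>R One)) ?g /\<^sub>R h ^ DIM(real) - ?g x) < e"
    using integrable_ccontinuous_explicit by blast
  have "g x = 0" if x: "x \<notin> N" "0 < x" for x
  proof (rule ccontr)
    assume "g x \<noteq> 0"
    \<comment> \<open>With |g x| itself as tolerance, an average equal to 0 contradicts the strict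
      inequality.\<close>
    then obtain d where d: "d > 0" "\<And>h. 0 < h \<Longrightarrow> h < d \<Longrightarrow>
        norm (integral (cbox x (x + h *\<^sub>R One)) ?g /\<^sub>R h ^ DIM(real) - ?g x) < \<bar>g x\<bar>"
      using N(2)[OF x(1), of "\<bar>g x\<bar>"] by auto
    have "integral {x..x + d/2} ?g = integral {x..x + d/2} g"
      by (rule Henstock_Kurzweil_Integration.integral_cong) (use x in auto)
    also have "\<dots> = 0"
      using Henstock_Kurzweil_Integration.integral_combine[of 0 x "x + d/2" g] gi x d zero by simp
    finally show False
      using d(2)[of "d/2"] d(1) x by simp
  qed
  then have "{t. \<not> (0 < t \<longrightarrow> g t = 0)} \<subseteq> N" by auto
  with N(1) show ?thesis
    by (auto simp: eventually_ae_filter negligible_iff_null_sets)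
qed

text \<open>Substituting \<open>y = exp (- t)\<close>, the hypotheses say that all moments of a continuous function on
  \<open>[0, 1]\<close> vanish.\<close>

lemma zero_of_exp_moments_zero:
  fixes G :: "real \<Rightarrow> real"
  assumes cont: "continuous_on {0..} G" and lim: "(G \<longlongrightarrow> 0) at_top"
    and int: "\<And>n::nat. n > 0 \<Longrightarrow> (\<lambda>t. exp (- (real n * t)) * G t) absolutely_integrable_on {0..}"
    and zero: "\<And>n::nat. n > 0 \<Longrightarrow> integral {0..} (\<lambda>t. exp (- (real n * t)) * G t) = 0"
    and t: "0 \<le> t"
  shows "G t = 0"
proof -
  \<comment> \<open>In the variable y = exp(- t), the value 0 at y = 0 is the limit of
    \<open>G\<close> at infinity; it makes \<open>h\<close> continuous on the closed interval, as
    Weierstrass approximation needs.\<close>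
  define h where "h = (\<lambda>y. if y \<le> 0 then 0 else G (- ln y))"
  have h_exp: "h (exp (- t)) = G t" for t
    by (simp add: h_def)
  have conth: "continuous_on {0..1} h"
  proof (subst continuous_on_eq_continuous_within, intro ballI)
    fix y :: real assume y: "y \<in> {0..1}"
    show "continuous (at y within {0..1}) h"
    proof (cases "y = 0")
      case True
      have "filterlim (\<lambda>y::real. - ln y) at_top (at_right 0)"
        using ln_at_0 filterlim_uminus_at_top by (simp add: filterlim_uminus_at_top)
      then have "((\<lambda>y. G (- ln y)) \<longlongrightarrow> 0) (at_right 0)"
        by (rule filterlim_compose[OF lim])
      moreover have "eventually (\<lambda>y. G (- ln y) = h y) (at_right 0)"
        by (auto simp: h_def eventually_at_filter)
      ultimately have "(h \<longlongrightarrow> h 0) (at_right 0)"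
        by (simp add: h_def tendsto_cong)
      moreover have "at 0 within {0..1} = at_right (0::real)"
        by (rule at_within_nhd[of _ "{..<1}"]) auto
      ultimately show ?thesis using True by (simp add: continuous_within)
    next
      case False
      have "continuous_on {0<..1} (\<lambda>y. G (- ln y))"
        by (intro continuous_on_compose2[OF cont] continuous_intros) auto
      then have "continuous_on {0<..1} h"
        by (rule continuous_on_eq) (auto simp: h_def)
      then have "continuous (at y within {0<..1}) h"
        using y False by (simp add: continuous_on_eq_continuous_within)
      moreover have "at y within {0<..1} = at y within {0..1}"
        by (rule at_within_nhd[of _ "{0<..}"]) (use y False in auto)
      ultimately show ?thesis by simp
    qed
  qed
  let ?E = "\<lambda>t::real. exp (- t)"
  have int1: "(\<lambda>t. ?E t * G t) absolutely_integrable_on {0..}"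
    using int[of 1] by simp
  define M where "M = integral {0..} (\<lambda>t. norm (?E t * G t))"
  have M: "M \<ge> 0" unfolding M_def
    by (rule Henstock_Kurzweil_Integration.integral_nonneg) (use int1 in \<open>auto simp: absolutely_integrable_on_def\<close>)
  have normint: "(\<lambda>t. norm (?E t * G t)) integrable_on {0..}"
    using int1 by (simp only: absolutely_integrable_on_def)
  \<comment> \<open>A polynomial p uniformly e-close to \<open>h\<close> integrates to 0 against
    exp(- t) G, because the weight exp(- t), which is dy up to sign, raises every exponent to at
    least 1. Hence the integral of exp(- t) G^2 over the half-line equals that of exp(- t) G (G -
    p), which is at most e M.\<close>
  have small: "integral {0..T} (\<lambda>t. ?E t * (G t)\<^sup>2) \<le> e * M" if e: "e > 0" for e T
  proof -
    obtain p where p: "real_polynomial_function p" "\<And>y. y \<in> {0..1} \<Longrightarrow> \<bar>h y - p y\<bar> < e"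
      using Stone_Weierstrass_real_polynomial_function[OF _ conth e] by auto
    obtain a n where a: "p = (\<lambda>x. \<Sum>i\<le>n. a i * x ^ i)"
      using p(1) real_polynomial_function_iff_sum by auto
    have pterm: "(\<lambda>t. ?E t * G t * p (?E t)) = (\<lambda>t. \<Sum>i\<le>n. a i * (exp (- (real (Suc i) * t)) * G t))"
    proof (rule ext)
      fix t
      have "?E t * ?E t ^ i = exp (- (real (Suc i) * t))" for i
        by (simp add: exp_of_nat_mult[symmetric] mult_exp_exp algebra_simps)
      then show "?E t * G t * p (?E t) = (\<Sum>i\<le>n. a i * (exp (- (real (Suc i) * t)) * G t))"
        unfolding a sum_distrib_left by (intro sum.cong refl) (metis mult.assoc mult.commute)
    qed
    have "((\<lambda>t. \<Sum>i\<le>n. a i * (exp (- (real (Suc i) * t)) * G t)) has_integral (\<Sum>i\<le>n. a i * 0)) {0..}"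
    proof (intro has_integral_sum has_integral_mult_right)
      fix i
      have "(\<lambda>t. exp (- (real (Suc i) * t)) * G t) integrable_on {0..}"
        by (rule set_lebesgue_integral_eq_integral(1)[OF int]) simp
      then show "((\<lambda>t. exp (- (real (Suc i) * t)) * G t) has_integral 0) {0..}"
        using zero[of "Suc i"] by (simp add: has_integral_integrable_integral)
    qed simp
    then have p0: "((\<lambda>t. ?E t * G t * p (?E t)) has_integral 0) {0..}"
      unfolding pterm by simp
    have contE: "continuous_on {0..T} (\<lambda>t. ?E t * (G t)\<^sup>2)"
      by (intro continuous_intros continuous_on_subset[OF cont]) auto
    obtain B where B: "\<And>t. t \<ge> 0 \<Longrightarrow> \<bar>G t\<bar> \<le> B"
    proof -
      have "bounded (h ` {0..1})"
        using conth by (intro compact_imp_bounded compact_continuous_image) auto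
      then obtain B where B: "\<forall>y\<in>{0..1}. \<bar>h y\<bar> \<le> B" by (auto simp: bounded_iff)
      show ?thesis
      proof (rule that[of B])
        fix t :: real assume "t \<ge> 0"
        then show "\<bar>G t\<bar> \<le> B" using bspec[OF B, of "?E t"] by (simp add: h_exp)
      qed
    qed
    have G2: "(\<lambda>t. ?E t * (G t)\<^sup>2) absolutely_integrable_on {0..}"
    proof (rule measurable_bounded_by_integrable_imp_absolutely_integrable)
      show "(\<lambda>t. ?E t * (G t)\<^sup>2) \<in> borel_measurable (lebesgue_on {0..})"
        by (intro continuous_imp_measurable_on_sets_lebesgue continuous_intros cont) auto
      show "(\<lambda>t. B * norm (?E t * G t)) integrable_on {0..}"
        by (intro integrable_on_mult_right normint)
      show "norm (?E t * (G t)\<^sup>2) \<le> B * norm (?E t * G t)" if "t \<in> {0..}" for t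
        using mult_right_mono[OF B[of t], of "?E t * \<bar>G t\<bar>"] that
        by (simp add: abs_mult power2_eq_square algebra_simps)
    qed auto
    have G2i: "(\<lambda>t. ?E t * (G t)\<^sup>2) integrable_on {0..}"
      by (rule set_lebesgue_integral_eq_integral(1)[OF G2])
    have "integral {0..T} (\<lambda>t. ?E t * (G t)\<^sup>2) \<le> integral {0..} (\<lambda>t. ?E t * (G t)\<^sup>2)"
      by (rule integral_subset_le) (use G2i contE in \<open>auto intro: integrable_continuous_real\<close>)
    also have "\<dots> = integral {0..} (\<lambda>t. ?E t * (G t)\<^sup>2 - ?E t * G t * p (?E t))"
      using p0 G2i by (subst Henstock_Kurzweil_Integration.integral_diff) (auto simp: has_integral_integrable_integral)
    also have "\<dots> \<le> integral {0..} (\<lambda>t. e * norm (?E t * G t))"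
    proof (rule integral_le)
      show "(\<lambda>t. ?E t * (G t)\<^sup>2 - ?E t * G t * p (?E t)) integrable_on {0..}"
        using p0 G2i by (intro Henstock_Kurzweil_Integration.integrable_diff) auto
      show "(\<lambda>t. e * norm (?E t * G t)) integrable_on {0..}"
        by (intro integrable_on_mult_right normint)
      fix t :: real assume t: "t \<in> {0..}"
      then have "\<bar>G t - p (?E t)\<bar> < e"
        using p(2)[of "?E t"] by (simp add: h_exp)
      have "?E t * (G t)\<^sup>2 - ?E t * G t * p (?E t) = (?E t * G t) * (G t - p (?E t))"
        by (simp add: power2_eq_square algebra_simps)
      also have "\<dots> \<le> norm (?E t * G t) * \<bar>G t - p (?E t)\<bar>"
        by (metis abs_ge_self abs_mult real_norm_def)
      also have "\<dots> \<le> norm (?E t * G t) * e"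
        using \<open>\<bar>G t - p (?E t)\<bar> < e\<close> by (intro mult_left_mono) auto
      finally show "?E t * (G t)\<^sup>2 - ?E t * G t * p (?E t) \<le> e * norm (?E t * G t)"
        by (simp add: mult.commute)
    qed
    also have "\<dots> = e * M" by (simp add: M_def)
    finally show ?thesis .
  qed
  have contE: "continuous_on {0..T} (\<lambda>t. ?E t * (G t)\<^sup>2)" for T
    by (intro continuous_intros continuous_on_subset[OF cont]) auto
  \<comment> \<open>The endpoint t + 1 keeps the interval nondegenerate for t = 0. In the next lines
    the divisor is M + 1, since M may be 0.\<close>
  have "integral {0..t+1} (\<lambda>t. ?E t * (G t)\<^sup>2) \<le> 0"
  proof (rule field_le_epsilon)
    fix e :: real assume "e > 0"
    then have "integral {0..t+1} (\<lambda>t. ?E t * (G t)\<^sup>2) \<le> e / (M + 1) * M"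
      using M by (intro small) auto
    also have "\<dots> \<le> e"
      using M \<open>e > 0\<close> by (simp add: field_simps)
    finally show "integral {0..t+1} (\<lambda>t. ?E t * (G t)\<^sup>2) \<le> 0 + e" by simp
  qed
  moreover have "integral {0..t+1} (\<lambda>t. ?E t * (G t)\<^sup>2) \<ge> 0"
    by (rule Henstock_Kurzweil_Integration.integral_nonneg) (auto intro!: integrable_continuous_real contE)
  ultimately have "integral {0..t+1} (\<lambda>t. ?E t * (G t)\<^sup>2) = 0" by simp
  then have "\<forall>x\<in>{0..t+1}. ?E x * (G x)\<^sup>2 = 0"
    using integral_eq_0_iff[OF contE, of "t+1"] t by simp
  then show ?thesis using t by auto
qed

text \<open>With s = \<sigma> + 1, the primitive \<open>G\<close> of exp(- s t) f tends to the
  transform at s, which is 0, and \<open>laplace_abel\<close> turns the transform at s + n into n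
  times the n-th exponential moment of \<open>G\<close>. All these vanish, so \<open>G\<close> is 0
  and its integrand vanishes almost everywhere.\<close>

lemma has_laplace_zero_imp_AE_zero:
  fixes f :: "real \<Rightarrow> real"
  assumes f: "\<And>s::real. s > \<sigma> \<Longrightarrow> has_laplace (\<lambda>t. of_real (f t)) (of_real s) 0"
  shows "AE t in lebesgue. 0 < t \<longrightarrow> f t = 0"
proof -
  define s where "s = \<sigma> + 1"
  let ?fc = "\<lambda>t. complex_of_real (f t)"
  define g where "g = (\<lambda>t. exp (- (s * t)) * f t)"
  define G where "G = (\<lambda>t. integral {0..t} g)"
  have F: "has_laplace ?fc (of_real s) 0" by (rule f) (simp add: s_def)
  have gc: "(\<lambda>t. exp (- (of_real s * of_real t)) * ?fc t) = (\<lambda>t. of_real (g t))"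
    by (auto simp: g_def exp_of_real[symmetric])
  have ga: "g absolutely_integrable_on {0..T}" for T
  proof -
    have "(\<lambda>t. complex_of_real (g t)) absolutely_integrable_on {0..T}"
      using has_laplaceD(2)[OF F, where w="of_real s" and T=T] unfolding gc .
    from absolutely_integrable_linear[OF this bounded_linear_Re] show ?thesis
      by (simp add: o_def)
  qed
  then have gi: "g integrable_on {0..T}" for T
    by (rule set_lebesgue_integral_eq_integral(1))
  have Gc: "integral {0..t} (\<lambda>t. complex_of_real (g t)) = of_real (G t)" for t
    unfolding G_def by (intro integral_unique has_integral_of_real integrable_integral gi)
  have limG: "(G \<longlongrightarrow> 0) at_top"
    using tendsto_Re[OF has_laplaceD(3)[OF F]] unfolding gc Gc by simp
  have contG: "continuous_on {0..} G"
    unfolding G_def by (intro continuous_on_indefinite_integral_ray gi)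
  have moments: "(\<lambda>t. exp (- (real n * t)) * G t) absolutely_integrable_on {0..} \<and>
      integral {0..} (\<lambda>t. exp (- (real n * t)) * G t) = 0" if "n > 0" for n
  proof -
    let ?c = "\<lambda>t. exp (- (complex_of_real (real n) * of_real t)) * of_real (G t)"
    have n: "Re (complex_of_real (real n)) > 0" using that by simp
    have 1: "?c absolutely_integrable_on {0..}"
      using laplace_abel(1)[OF F n] unfolding gc Gc .
    have c: "?c = (\<lambda>t. of_real (exp (- (real n * t)) * G t))"
      by (auto simp: exp_of_real[symmetric])
    from absolutely_integrable_linear[OF 1 bounded_linear_Re]
    have 2: "(\<lambda>t. exp (- (real n * t)) * G t) absolutely_integrable_on {0..}"
      unfolding c by (simp add: o_def)
    have "has_laplace ?fc (of_real s + of_real (real n)) (of_real (real n) * integral {0..} ?c)"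
      using laplace_abel(2)[OF F n] unfolding gc Gc .
    moreover have "has_laplace ?fc (of_real s + of_real (real n)) 0"
      using f[of "s + real n"] by (simp add: s_def)
    ultimately have "of_real (real n) * integral {0..} ?c = 0"
      by (rule has_laplace_unique)
    then have "integral {0..} ?c = 0" using that by simp
    moreover have "integral {0..} ?c = of_real (integral {0..} (\<lambda>t. exp (- (real n * t)) * G t))"
      unfolding c
      by (intro integral_unique has_integral_of_real integrable_integral set_lebesgue_integral_eq_integral(1)[OF 2])
    ultimately show ?thesis using 2 by simp
  qed
  have "integral {0..t} g = 0" if "0 \<le> t" for t
    using zero_of_exp_moments_zero[OF contG limG] moments that unfolding G_def by blast
  then have "AE t in lebesgue. 0 < t \<longrightarrow> g t = 0"
    by (rule AE_zero_of_indefinite_integral_zero[OF ga])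
  then show ?thesis
    by (simp add: g_def)
qed

section \<open>Transforms of powers and of Mittag-Leffler kernels\<close>

lemma has_laplace_absolutely_integrable:
  assumes k: "(\<lambda>t. exp (- (s * of_real t)) * k t) absolutely_integrable_on {0..}"
  shows "has_laplace k s (integral {0..} (\<lambda>t. exp (- (s * of_real t)) * k t))"
  unfolding has_laplace_def
proof (intro conjI allI impI)
  fix T :: real
  have "(\<lambda>t. exp (s * of_real t) * (exp (- (s * of_real t)) * k t)) absolutely_integrable_on {0..T}"
    by (intro absolutely_integrable_continuous_times set_integrable_subset[OF k] continuous_intros) auto
  then show "k absolutely_integrable_on {0..T}"
    by (simp add: mult_exp_exp flip: mult.assoc)
qed (rule tendsto_integral_ray[OF k])

text \<open>Substitution of x t in the Gamma integral; the Jacobian and the power of x combine to x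
  powr (- p).\<close>

lemma laplace_powr_real:
  fixes x p :: real
  assumes x: "x > 0" and p: "p > 0"
  shows "(\<lambda>t. exp (- (x * t)) * t powr (p - 1)) absolutely_integrable_on {0..}"
    and "integral {0..} (\<lambda>t. exp (- (x * t)) * t powr (p - 1)) = Gamma p * x powr (- p)"
proof -
  let ?f = "\<lambda>t. exp (- t) * t powr (p - 1)"
  have f: "(?f has_integral Gamma p) {0..}"
    using Gamma_integral_real[OF p] by (simp add: exp_minus field_simps)
  have fa: "?f absolutely_integrable_on {0..}"
    by (rule nonnegative_absolutely_integrable_1) (use f in auto)
  have im: "(\<lambda>t. x * t) ` {0..} = {0..}"
    using x by (auto simp: image_iff intro!: bexI[of _ "_ / x"])
  have "(\<lambda>t. \<bar>x\<bar> * ?f (x * t)) absolutely_integrable_on {0..} \<and>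
      integral {0..} (\<lambda>t. \<bar>x\<bar> * ?f (x * t)) = Gamma p"
    using x f fa
    by (subst has_absolute_integral_change_of_variables_1'[where g="\<lambda>t. x * t"])
       (auto simp: im integral_unique inj_on_def intro!: derivative_eq_intros)
  then have "(\<lambda>t. x powr (-p) * (\<bar>x\<bar> * ?f (x * t))) absolutely_integrable_on {0..} \<and>
      integral {0..} (\<lambda>t. x powr (-p) * (\<bar>x\<bar> * ?f (x * t))) = x powr (-p) * Gamma p"
    by (auto intro: set_integrable_mult_right)
  moreover have eq: "x powr (-p) * (\<bar>x\<bar> * ?f (x * t)) = exp (- (x * t)) * t powr (p - 1)" if "t \<in> {0..}" for t
  proof -
    have "x powr (-p) * (\<bar>x\<bar> * ?f (x * t)) = (x powr (-p) * x * x powr (p - 1)) * (exp (- (x * t)) * t powr (p - 1))"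
      using x that by (simp add: powr_mult mult_ac)
    also have "x powr (-p) * x * x powr (p - 1) = 1"
      using x by (simp add: powr_mult_base powr_add[symmetric] mult.commute)
    finally show ?thesis by simp
  qed
  moreover have "integral {0..} (\<lambda>t. x powr (-p) * (\<bar>x\<bar> * ?f (x * t))) =
      integral {0..} (\<lambda>t. exp (- (x * t)) * t powr (p - 1))"
    by (rule Henstock_Kurzweil_Integration.integral_cong) (rule eq)
  moreover have "(\<lambda>t. x powr (-p) * (\<bar>x\<bar> * ?f (x * t))) absolutely_integrable_on {0..} \<longleftrightarrow>
      (\<lambda>t. exp (- (x * t)) * t powr (p - 1)) absolutely_integrable_on {0..}"
    by (rule set_integrable_cong) (auto simp only: eq)
  ultimately show "(\<lambda>t. exp (- (x * t)) * t powr (p - 1)) absolutely_integrable_on {0..}"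
    "integral {0..} (\<lambda>t. exp (- (x * t)) * t powr (p - 1)) = Gamma p * x powr (- p)"
    by (simp_all only: mult.commute)
qed

lemma sums_integral_lebesgue_on:
  fixes f :: "nat \<Rightarrow> real \<Rightarrow> complex"
  assumes S: "S \<in> sets lebesgue"
    and int: "\<And>n. f n absolutely_integrable_on S"
    and sums: "\<And>t. t \<in> S \<Longrightarrow> summable (\<lambda>n. norm (f n t))"
    and bound: "\<And>n. integral S (\<lambda>t. norm (f n t)) \<le> B n" "summable B"
  shows "(\<lambda>t. \<Sum>n. f n t) absolutely_integrable_on S"
    and "(\<lambda>n. integral S (f n)) sums integral S (\<lambda>t. \<Sum>n. f n t)"
proof -
  let ?g = "\<lambda>n t. indicator S t *\<^sub>R f n t"
  have g: "integrable lebesgue (?g n)" for n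
    using int[of n] by (simp add: set_integrable_def)
  have 1: "AE t in lebesgue. summable (\<lambda>n. norm (?g n t))"
  proof (rule AE_I2)
    fix t show "summable (\<lambda>n. norm (?g n t))" using sums[of t] by (cases "t \<in> S") auto
  qed
  have n: "(\<integral>t. norm (?g n t) \<partial>lebesgue) = integral S (\<lambda>t. norm (f n t))" for n
  proof -
    have "(\<lambda>t. norm (f n t)) absolutely_integrable_on S"
      using int[of n] by (rule absolutely_integrable_norm[unfolded o_def])
    from set_lebesgue_integral_eq_integral(2)[OF this] show ?thesis
      by (simp add: set_lebesgue_integral_def)
  qed
  have 2: "summable (\<lambda>n. \<integral>t. norm (?g n t) \<partial>lebesgue)"
  proof (rule summable_comparison_test'[OF bound(2)])
    show "norm (\<integral>t. norm (?g n t) \<partial>lebesgue) \<le> B n" for n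
    proof -
      have "0 \<le> (\<integral>t. norm (?g n t) \<partial>lebesgue)"
        by (rule Bochner_Integration.integral_nonneg) simp
      then show ?thesis using bound(1)[of n] unfolding n by simp
    qed
  qed
  have sm: "(\<Sum>n. ?g n t) = indicator S t *\<^sub>R (\<Sum>n. f n t)" for t
    by (cases "t \<in> S") auto
  show A: "(\<lambda>t. \<Sum>n. f n t) absolutely_integrable_on S"
    using integrable_suminf[OF g 1 2] unfolding sm set_integrable_def .
  have "(\<lambda>n. integral\<^sup>L lebesgue (?g n)) sums (\<integral>t. (\<Sum>n. ?g n t) \<partial>lebesgue)"
    by (rule sums_integral[OF g 1 2])
  then show "(\<lambda>n. integral S (f n)) sums integral S (\<lambda>t. \<Sum>n. f n t)"
    using set_lebesgue_integral_eq_integral(2)[OF A] set_lebesgue_integral_eq_integral(2)[OF int]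
    unfolding sm by (simp add: set_lebesgue_integral_def)
qed

text \<open>Terms of the binomial series of (1 - z) powr (- a). For real a > 0 and z >= 0 the
  Pochhammer form shows them to be nonnegative, so that convergence of the series is
  absolute.\<close>

lemma gbinomial_uminus_times_power:
  fixes a z :: "'a::field_char_0"
  shows "(- a gchoose n) * (- z) ^ n = pochhammer a n / fact n * z ^ n"
proof -
  have "(- 1) ^ n * (- 1) ^ n = (1::'a)"
    by (simp flip: power_mult_distrib)
  moreover have "(- 1) ^ n * pochhammer (- (- a)) n / fact n * ((- 1) ^ n * z ^ n)
      = ((- 1) ^ n * (- 1) ^ n) * (pochhammer a n / fact n * z ^ n)"
    by simp
  ultimately show ?thesis
    unfolding gbinomial_pochhammer power_minus[of z] by simp
qed

text \<open>Both sides are expanded into binomial series around a real point \<open>x\<close> with \<open>norm (s - x) < x\<close>.\<close>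

lemma laplace_powr_complex:
  fixes s :: complex and p :: real
  assumes s: "Re s > 0" and p: "p > 0"
  shows "(\<lambda>t. exp (- (s * of_real t)) * of_real (t powr (p - 1))) absolutely_integrable_on {0..}"
    and "integral {0..} (\<lambda>t. exp (- (s * of_real t)) * of_real (t powr (p - 1))) = Gamma p * s powr (- of_real p)"
proof -
  \<comment> \<open>With this choice |x - s|^2 = x^2 - |s|^2, hence |x - s| < x: the disc around x
    on which the binomial series converges contains s.\<close>
  define x where "x = (norm s)\<^sup>2 / Re s"
  have x0: "x > 0" using s by (auto simp: x_def intro!: divide_pos_pos)
  have xs: "x * Re s = (norm s)\<^sup>2" using s by (simp add: x_def)
  define r where "r = norm (of_real x - s)"
  have "r\<^sup>2 = x\<^sup>2 - 2 * (x * Re s) + (norm s)\<^sup>2"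
    unfolding r_def cmod_power2 by (simp add: power2_eq_square algebra_simps)
  also have "\<dots> < x\<^sup>2" using s unfolding xs by auto
  finally have rx: "r < x" using x0 by (simp add: power2_less_imp_less)
  have r0: "r \<ge> 0" by (simp add: r_def)
  \<comment> \<open>The factor exp((x - s) t) is expanded, leaving real weights exp(- x t) t powr (p
    + n - 1) whose integrals are known.\<close>
  let ?f = "\<lambda>n t. (of_real x - s) ^ n / fact n * of_real (exp (- (x * t)) * t powr (p + real n - 1))"
  have real_int: "(\<lambda>t. exp (- (x * t)) * t powr (p + real n - 1)) absolutely_integrable_on {0..}"
    "integral {0..} (\<lambda>t. exp (- (x * t)) * t powr (p + real n - 1)) = Gamma (p + real n) * x powr (- (p + real n))" for n
    using laplace_powr_real[OF x0, of "p + real n"] p by auto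
  have f_eq: "?f n t = (exp (- (x * t)) * t powr (p - 1)) *\<^sub>R (((of_real x - s) * of_real t) ^ n /\<^sub>R fact n)" if "t \<in> {0..}" for n t
  proof (cases "t = 0")
    case True then show ?thesis by simp
  next
    case False
    then have "t powr (p + real n - 1) = t powr (p - 1) * t ^ n"
      using that by (simp add: powr_add[symmetric] powr_realpow[symmetric] algebra_simps)
    then show ?thesis
      unfolding power_mult_distrib scaleR_conv_of_real
      by (simp only: of_real_mult of_real_power of_real_inverse of_real_fact divide_inverse mult_ac)
  qed
  have fsums: "(\<lambda>n. ?f n t) sums (exp (- (s * of_real t)) * of_real (t powr (p - 1)))" if "t \<in> {0..}" for t
  proof -
    have "(\<lambda>n. (exp (- (x * t)) * t powr (p - 1)) *\<^sub>R (((of_real x - s) * of_real t) ^ n /\<^sub>R fact n))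
       sums ((exp (- (x * t)) * t powr (p - 1)) *\<^sub>R exp ((of_real x - s) * of_real t))"
      by (intro sums_scaleR_right exp_converges)
    moreover have "(exp (- (x * t)) * t powr (p - 1)) *\<^sub>R exp ((of_real x - s) * of_real t)
       = exp (- (s * of_real t)) * of_real (t powr (p - 1))"
      by (simp add: scaleR_conv_of_real exp_of_real[symmetric] mult_exp_exp mult_ac flip: mult.assoc)
         (simp add: algebra_simps mult_exp_exp)
    ultimately show ?thesis
      using that by (subst sums_cong[OF f_eq]) auto
  qed
  have of_real_int: "(\<lambda>t. complex_of_real (exp (- (x * t)) * t powr (p + real n - 1))) absolutely_integrable_on {0..}" for n
    using absolutely_integrable_linear[OF real_int(1) bounded_linear_of_real] by (simp add: o_def)
  have fi: "?f n absolutely_integrable_on {0..}" for n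
    by (rule set_integrable_mult_right) (use of_real_int in auto)
  have poch: "Gamma (p + real n) = Gamma p * pochhammer p n" for n
  proof -
    have "p \<notin> \<int>\<^sub>\<le>\<^sub>0" using p by (auto dest: nonpos_Ints_nonpos)
    then show ?thesis using pochhammer_Gamma[of p n] Gamma_real_pos[OF p] by (simp add: field_simps)
  qed
  have xpow: "x powr (- (p + real n)) = x powr (-p) / x ^ n" for n
    using x0 by (simp add: powr_diff powr_realpow)
  \<comment> \<open>The integrated norms are, up to a constant, the terms of the binomial series at
    - r / x, which converges because r < x; this justifies termwise integration.\<close>
  have fnorm: "integral {0..} (\<lambda>t. norm (?f n t)) = Gamma p * x powr (-p) * norm ((- p gchoose n) * (- r / x) ^ n)" for n
  proof -
    have "integral {0..} (\<lambda>t. norm (?f n t)) = integral {0..} (\<lambda>t. r ^ n / fact n * (exp (- (x * t)) * t powr (p + real n - 1)))"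
      by (simp add: norm_mult norm_divide norm_power r_def)
    also have "\<dots> = r ^ n / fact n * (Gamma (p + real n) * x powr (- (p + real n)))"
      by (simp only: integral_mult_right real_int)
    also have "\<dots> = Gamma p * x powr (-p) * (pochhammer p n / fact n * (r / x) ^ n)"
      unfolding poch xpow by (simp add: power_divide)
    also have "pochhammer p n / fact n * (r / x) ^ n = norm ((- p gchoose n) * (- r / x) ^ n)"
      using gbinomial_uminus_times_power[of p n "r / x"] p x0 r0 by (simp add: pochhammer_nonneg)
    finally show ?thesis .
  qed
  have summ: "summable (\<lambda>n. Gamma p * x powr (-p) * norm ((- p gchoose n) * (- r / x) ^ n))"
  proof (intro summable_mult)
    have "(- p gchoose n) * (- r / x) ^ n = pochhammer p n / fact n * (r / x) ^ n" for n
      using gbinomial_uminus_times_power[of p n "r / x"] by simp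
    then have "norm ((- p gchoose n) * (- r / x) ^ n) = (- p gchoose n) * (- r / x) ^ n" for n
      using p x0 r0 by (simp add: pochhammer_nonneg)
    moreover have "summable (\<lambda>n. (- p gchoose n) * (- r / x) ^ n)"
      using gen_binomial_real[of "- r / x" "-p"] rx r0 x0 by (auto simp: sums_iff)
    ultimately show "summable (\<lambda>n. norm ((- p gchoose n) * (- r / x) ^ n))"
      by simp
  qed
  have fn: "summable (\<lambda>n. norm (?f n t))" if "t \<in> {0..}" for t
  proof -
    have "summable (\<lambda>n. \<bar>exp (- (x * t)) * t powr (p - 1)\<bar> * norm (((of_real x - s) * of_real t) ^ n /\<^sub>R fact n))"
      by (intro summable_mult summable_norm_exp)
    then show ?thesis
      by (simp only: f_eq[OF that] norm_scaleR)
  qed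
  have S: "(\<Sum>n. ?f n t) = exp (- (s * of_real t)) * of_real (t powr (p - 1))" if "t \<in> {0..}" for t
    using fsums[OF that] by (simp add: sums_iff)
  have "{0::real..} \<in> sets lebesgue" by simp
  note main = sums_integral_lebesgue_on[of "{0..}" ?f, OF this fi fn eq_refl[OF fnorm] summ]
  have "(\<lambda>t. \<Sum>n. ?f n t) absolutely_integrable_on {0..} \<longleftrightarrow>
      (\<lambda>t. exp (- (s * of_real t)) * of_real (t powr (p - 1))) absolutely_integrable_on {0..}"
    by (rule set_integrable_cong) (auto simp only: S)
  with main(1) show "(\<lambda>t. exp (- (s * of_real t)) * of_real (t powr (p - 1))) absolutely_integrable_on {0..}"
    by (rule iffD1[rotated])
  have "(\<lambda>n. integral {0..} (?f n)) sums integral {0..} (\<lambda>t. \<Sum>n. ?f n t)"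
    by (rule main(2))
  also have "integral {0..} (\<lambda>t. \<Sum>n. ?f n t) = integral {0..} (\<lambda>t. exp (- (s * of_real t)) * of_real (t powr (p - 1)))"
    using S by (intro Henstock_Kurzweil_Integration.integral_cong) auto
  also have "(\<lambda>n. integral {0..} (?f n)) = (\<lambda>n. of_real (Gamma p * x powr (-p)) * ((- of_real p gchoose n) * ((s - of_real x) / of_real x) ^ n))"
  proof
    fix n
    have "integral {0..} (?f n) = (of_real x - s) ^ n / fact n * of_real (Gamma (p + real n) * x powr (- (p + real n)))"
      using real_int(2)[of n] has_integral_of_real[OF integrable_integral[OF set_lebesgue_integral_eq_integral(1)[OF real_int(1)[of n]]], where 'b=complex]
      by (simp only: integral_mult_right integral_unique)
    also have "\<dots> = of_real (Gamma p * x powr (-p)) * (pochhammer (of_real p) n / fact n * ((of_real x - s) / of_real x) ^ n)"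
      unfolding poch xpow by (simp add: power_divide pochhammer_of_real)
    also have "pochhammer (of_real p) n / fact n * ((of_real x - s) / of_real x) ^ n = (- of_real p gchoose n) * ((s - of_real x) / of_real x) ^ n"
      using gbinomial_uminus_times_power[of "complex_of_real p" n "(of_real x - s) / of_real x"]
      by (simp add: minus_divide_left)
    finally show "integral {0..} (?f n) = of_real (Gamma p * x powr (-p)) * ((- of_real p gchoose n) * ((s - of_real x) / of_real x) ^ n)" .
  qed
  finally have A: "(\<lambda>n. of_real (Gamma p * x powr (-p)) * ((- of_real p gchoose n) * ((s - of_real x) / of_real x) ^ n)) sums
     integral {0..} (\<lambda>t. exp (- (s * of_real t)) * of_real (t powr (p - 1)))" .
  have "norm ((s - of_real x) / of_real x) < 1"
    using rx x0 by (simp add: norm_divide r_def norm_minus_commute)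
  from gen_binomial_complex[OF this, of "- of_real p"]
  have "(\<lambda>n. (- of_real p gchoose n) * ((s - of_real x) / of_real x) ^ n) sums ((s / of_real x) powr (- of_real p))"
    using x0 by (simp add: field_simps)
  then have "(\<lambda>n. of_real (Gamma p * x powr (-p)) * ((- of_real p gchoose n) * ((s - of_real x) / of_real x) ^ n)) sums
     (of_real (Gamma p * x powr (-p)) * (s / of_real x) powr (- of_real p))"
    by (rule sums_mult)
  with A have "integral {0..} (\<lambda>t. exp (- (s * of_real t)) * of_real (t powr (p - 1))) =
     of_real (Gamma p * x powr (-p)) * (s / of_real x) powr (- of_real p)"
    by (rule sums_unique2)
  also have "\<dots> = Gamma p * (of_real x powr (- of_real p) * (s / of_real x) powr (- of_real p))"
    using x0 by (simp add: powr_of_real[symmetric])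
  \<comment> \<open>Multiplicativity of the principal power holds here because the first factor is a
    positive real.\<close>
  also have "of_real x powr (- of_real p) * (s / of_real x) powr (- of_real p) = (of_real x * (s / of_real x)) powr (- of_real p)"
    using x0 by (intro powr_times_real_left[symmetric]) auto
  also have "of_real x * (s / of_real x) = s" using x0 by simp
  finally show "integral {0..} (\<lambda>t. exp (- (s * of_real t)) * of_real (t powr (p - 1))) = Gamma p * s powr (- of_real p)" .
qed

text \<open>The Gamma integral is cut to t >= R, where t powr (x - 1) is at least R powr (x - 1). As
  R is free, Gamma outgrows every exponential, which yields convergence of the Mittag-Leffler series
  without Stirling's formula.\<close>

lemma Gamma_lower_bound:
  fixes x R :: real
  assumes x: "x \<ge> 1" and R: "R > 0"
  shows "R powr (x - 1) * exp (- R) \<le> Gamma x"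
proof -
  let ?f = "\<lambda>t. exp (- t) * t powr (x - 1)"
  have G: "(?f has_integral Gamma x) {0..}"
    using Gamma_integral_real[of x] x by (simp add: exp_minus field_simps)
  have "((\<lambda>t. exp (- t)) has_integral exp (- R)) {R..}"
    using has_integral_exp_minus_to_infinity[of 1 R] by simp
  then have "((\<lambda>t. R powr (x - 1) * exp (- t)) has_integral R powr (x - 1) * exp (- R)) {R..}"
    by (rule has_integral_mult_right)
  moreover have fa: "?f absolutely_integrable_on {0..}"
    by (rule nonnegative_absolutely_integrable_1) (use G in auto)
  then have fR: "?f absolutely_integrable_on {R..}"
    by (rule set_integrable_subset) (use R in auto)
  then have fRi: "(?f has_integral integral {R..} ?f) {R..}"
    by (intro integrable_integral set_lebesgue_integral_eq_integral(1))
  ultimately have "R powr (x - 1) * exp (- R) \<le> integral {R..} ?f"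
  proof (rule has_integral_le)
    show "R powr (x - 1) * exp (- t) \<le> ?f t" if "t \<in> {R..}" for t
      using that R x by (auto intro!: mult_right_mono powr_mono2 simp: mult.commute[of "exp _"])
  qed
  also have "\<dots> \<le> integral {0..} ?f"
    by (rule integral_subset_le) (use R G fRi in auto)
  also have "\<dots> = Gamma x" using G by (rule integral_unique)
  finally show ?thesis .
qed

lemma summable_mittag_leffler:
  fixes \<alpha> \<beta> c z :: real and a :: "nat \<Rightarrow> real"
  assumes \<alpha>: "\<alpha> > 0" and \<beta>: "\<beta> > 0" and c: "c \<ge> 0" "\<And>k. \<bar>a k\<bar> \<le> c ^ k"
  shows "summable (\<lambda>k. a k / Gamma (real k * \<alpha> + \<beta>) * z ^ k)"
proof -
  define q where "q = c * \<bar>z\<bar>"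
  have q: "q \<ge> 0" using c by (simp add: q_def)
  \<comment> \<open>Chosen so that R powr \<alpha> = 2 (q + 1): the ratio q / R powr \<alpha> of the
    comparison series is then at most 1/2, and R > 0 even for q = 0.\<close>
  define R where "R = (2 * (q + 1)) powr (1 / \<alpha>)"
  have R: "R > 0" using q by (simp add: R_def)
  have R\<alpha>: "R powr \<alpha> = 2 * (q + 1)" using q \<alpha> by (simp add: R_def powr_powr)
  \<comment> \<open>From K on the argument of Gamma is at least 1, as the lower bound
    demands.\<close>
  obtain K :: nat where K: "real K * \<alpha> \<ge> 1"
    using reals_Archimedean3[OF \<alpha>, rule_format, of 1] by (auto intro: less_imp_le)
  have bound: "norm (a k / Gamma (real k * \<alpha> + \<beta>) * z ^ k) \<le> exp R * R powr (1 - \<beta>) * (1 / 2) ^ k" if k: "k \<ge> K" for k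
  proof -
    let ?x = "real k * \<alpha> + \<beta>"
    have "real K * \<alpha> \<le> real k * \<alpha>" using k \<alpha> by (simp add: mult_right_mono)
    then have x: "?x \<ge> 1" using K \<beta> by linarith
    have "R powr (?x - 1) = (R powr \<alpha>) powr real k * R powr (\<beta> - 1)"
      by (simp add: powr_powr powr_add[symmetric] algebra_simps)
    also have "(R powr \<alpha>) powr real k = (R powr \<alpha>) ^ k"
      using R by (simp add: powr_realpow)
    finally have Rx: "R powr (?x - 1) = (R powr \<alpha>) ^ k * R powr (\<beta> - 1)" .
    have G: "R powr (?x - 1) * exp (- R) \<le> Gamma ?x"
      by (rule Gamma_lower_bound[OF x R])
    have pos: "0 < R powr (?x - 1) * exp (- R)" using R by simp
    have "norm (a k / Gamma ?x * z ^ k) = \<bar>a k\<bar> * \<bar>z\<bar> ^ k / Gamma ?x"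
      using pos G by (simp add: abs_mult power_abs)
    also have "\<dots> \<le> q ^ k / (R powr (?x - 1) * exp (- R))"
      using G pos c(2)[of k] unfolding q_def power_mult_distrib
      by (intro frac_le mult_right_mono mult_nonneg_nonneg) (auto simp: c)
    also have "\<dots> = exp R * R powr (1 - \<beta>) * (q / R powr \<alpha>) ^ k"
      using R unfolding Rx by (simp add: exp_minus powr_diff power_divide field_simps)
    also have "\<dots> \<le> exp R * R powr (1 - \<beta>) * (1 / 2) ^ k"
      using q unfolding R\<alpha> by (intro mult_left_mono power_mono) (auto simp: field_simps)
    finally show ?thesis .
  qed
  have "summable (\<lambda>k. exp R * R powr (1 - \<beta>) * (1 / 2) ^ k)"
    by (intro summable_mult summable_geometric) simp
  then show ?thesis
    by (rule summable_comparison_test'[OF _ bound])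
qed

text \<open>Scalar model of the matrix functions: with a k the (i, j) entry of A^k, the choice
  \<beta> = \<alpha> gives that entry of the \<alpha>-exponential, and \<beta> = 1 gives that of
  E_alpha(A t^\<alpha>) for t > 0.\<close>

definition ml_kernel :: "real \<Rightarrow> real \<Rightarrow> (nat \<Rightarrow> real) \<Rightarrow> real \<Rightarrow> real" where
  "ml_kernel \<alpha> \<beta> a t = t powr (\<beta> - 1) * (\<Sum>k. a k / Gamma (real k * \<alpha> + \<beta>) * (t powr \<alpha>) ^ k)"

lemma isCont_ml_kernel:
  assumes "\<alpha> > 0" "\<beta> > 0" "c \<ge> 0" "\<And>k. \<bar>a k\<bar> \<le> c ^ k" and t: "t > 0"
  shows "isCont (ml_kernel \<alpha> \<beta> a) t"
proof -
  have "isCont (\<lambda>z. \<Sum>k. a k / Gamma (real k * \<alpha> + \<beta>) * z ^ k) z" for z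
    by (intro isCont_powser_converges_everywhere summable_mittag_leffler[OF assms(1-4)])
  moreover have "isCont (\<lambda>t. t powr \<alpha>) t"
    using t by (auto intro!: continuous_intros)
  ultimately have "isCont (\<lambda>t. \<Sum>k. a k / Gamma (real k * \<alpha> + \<beta>) * (t powr \<alpha>) ^ k) t"
    by (rule isCont_o2[rotated])
  then show ?thesis
    using t unfolding ml_kernel_def by (auto intro!: continuous_intros)
qed

text \<open>Termwise, t powr (k \<alpha> + \<beta> - 1) / Gamma (k \<alpha> + \<beta>) has the
  transform s powr (- (k \<alpha> + \<beta>)). The norm of exp(- s t) depends on x = Re s only, so
  the integrated norms are dominated by x powr (- \<beta>) (c / x powr \<alpha>)^k; the bound on Re
  s makes this geometric series converge.\<close>

lemma laplace_ml_kernel: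
  fixes s :: complex
  assumes \<alpha>: "\<alpha> > 0" and \<beta>: "\<beta> > 0" and c: "c \<ge> 0" "\<And>k. \<bar>a k\<bar> \<le> c ^ k"
    and s: "Re s > 0" "c < Re s powr \<alpha>"
  shows "(\<lambda>t. exp (- (s * of_real t)) * of_real (ml_kernel \<alpha> \<beta> a t)) absolutely_integrable_on {0..}"
    and "(\<lambda>k. of_real (a k) * s powr (- of_real (real k * \<alpha> + \<beta>))) sums
      integral {0..} (\<lambda>t. exp (- (s * of_real t)) * of_real (ml_kernel \<alpha> \<beta> a t))"
proof -
  let ?p = "\<lambda>k. real k * \<alpha> + \<beta>"
  have p: "?p k > 0" for k using \<alpha> \<beta> by (simp add: add_nonneg_pos)
  have Gp: "Gamma (?p k) > 0" for k by (rule Gamma_real_pos[OF p])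
  let ?f = "\<lambda>k t. of_real (a k / Gamma (?p k)) * (exp (- (s * of_real t)) * of_real (t powr (?p k - 1)))"
  have f_eq: "?f k t = exp (- (s * of_real t)) * of_real (t powr (\<beta> - 1) * (a k / Gamma (?p k) * (t powr \<alpha>) ^ k))" if "t \<in> {0..}" for k t
  proof (cases "t = 0")
    case False
    then have "t powr (?p k - 1) = t powr (\<beta> - 1) * (t powr \<alpha>) ^ k"
      using that by (simp add: powr_realpow[symmetric] powr_powr powr_add[symmetric] algebra_simps)
    then show ?thesis by simp
  qed simp
  have fi: "?f k absolutely_integrable_on {0..}" for k
    by (rule set_integrable_mult_right) (use laplace_powr_complex(1)[OF s(1) p] in auto)
  have summ_real: "summable (\<lambda>k. a k / Gamma (?p k) * z ^ k)" for z
    by (rule summable_mittag_leffler[OF \<alpha> \<beta> c])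
  have summ_norm: "summable (\<lambda>k. \<bar>a k / Gamma (?p k) * z ^ k\<bar>)" for z
  proof -
    have "summable (\<lambda>k. \<bar>a k\<bar> / Gamma (?p k) * \<bar>z\<bar> ^ k)"
      by (rule summable_mittag_leffler[OF \<alpha> \<beta> c(1)]) (use c in auto)
    then show ?thesis using Gp by (simp add: abs_mult power_abs less_imp_le)
  qed
  have fn: "summable (\<lambda>k. norm (?f k t))" if "t \<in> {0..}" for t
  proof -
    have "summable (\<lambda>k. norm (exp (- (s * of_real t))) * \<bar>t powr (\<beta> - 1)\<bar> * \<bar>a k / Gamma (?p k) * (t powr \<alpha>) ^ k\<bar>)"
      by (intro summable_mult summ_norm)
    then show ?thesis
      by (simp only: f_eq[OF that] norm_mult norm_of_real abs_mult mult.assoc)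
  qed
  have fsum: "(\<Sum>k. ?f k t) = exp (- (s * of_real t)) * of_real (ml_kernel \<alpha> \<beta> a t)" if "t \<in> {0..}" for t
  proof -
    have "(\<lambda>k. exp (- (s * of_real t)) * of_real (t powr (\<beta> - 1) * (a k / Gamma (?p k) * (t powr \<alpha>) ^ k))) sums
       (exp (- (s * of_real t)) * of_real (ml_kernel \<alpha> \<beta> a t))"
      unfolding ml_kernel_def
      by (intro sums_mult sums_of_real summable_sums summ_real)
    then show ?thesis
      by (simp only: f_eq[OF that] sums_iff)
  qed
  define x where "x = Re s"
  have x: "x > 0" "c < x powr \<alpha>" using s by (auto simp: x_def)
  have fb: "integral {0..} (\<lambda>t. norm (?f k t)) \<le> x powr (- \<beta>) * (c / x powr \<alpha>) ^ k" for k
  proof -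
    have "integral {0..} (\<lambda>t. norm (?f k t)) = integral {0..} (\<lambda>t. \<bar>a k\<bar> / Gamma (?p k) * (exp (- (x * t)) * t powr (?p k - 1)))"
      by (rule Henstock_Kurzweil_Integration.integral_cong)
         (use Gp[of k] in \<open>simp add: norm_mult norm_divide x_def\<close>)
    also have "\<dots> = \<bar>a k\<bar> / Gamma (?p k) * (Gamma (?p k) * x powr (- ?p k))"
      by (simp only: integral_mult_right laplace_powr_real(2)[OF x(1) p])
    also have "\<dots> = \<bar>a k\<bar> * x powr (- ?p k)"
      using Gp[of k] by simp
    also have "x powr (- ?p k) = x powr (- \<beta>) / (x powr \<alpha>) ^ k"
      using x by (simp add: powr_realpow[symmetric] powr_powr powr_diff[symmetric] algebra_simps)
    also have "\<bar>a k\<bar> * (x powr (- \<beta>) / (x powr \<alpha>) ^ k) \<le> c ^ k * (x powr (- \<beta>) / (x powr \<alpha>) ^ k)"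
      using c x by (intro mult_right_mono) auto
    finally show ?thesis by (simp add: power_divide mult.commute)
  qed
  have bs: "summable (\<lambda>k. x powr (- \<beta>) * (c / x powr \<alpha>) ^ k)"
    using c x by (intro summable_mult summable_geometric) simp
  have "{0::real..} \<in> sets lebesgue" by simp
  note main = sums_integral_lebesgue_on[of "{0..}" ?f, OF this fi fn fb bs]
  have "(\<lambda>t. \<Sum>k. ?f k t) absolutely_integrable_on {0..} \<longleftrightarrow>
      (\<lambda>t. exp (- (s * of_real t)) * of_real (ml_kernel \<alpha> \<beta> a t)) absolutely_integrable_on {0..}"
    by (rule set_integrable_cong) (auto simp only: fsum)
  with main(1) show "(\<lambda>t. exp (- (s * of_real t)) * of_real (ml_kernel \<alpha> \<beta> a t)) absolutely_integrable_on {0..}"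
    by (rule iffD1[rotated])
  have "(\<lambda>k. integral {0..} (?f k)) sums integral {0..} (\<lambda>t. \<Sum>k. ?f k t)"
    by (rule main(2))
  also have "integral {0..} (\<lambda>t. \<Sum>k. ?f k t) = integral {0..} (\<lambda>t. exp (- (s * of_real t)) * of_real (ml_kernel \<alpha> \<beta> a t))"
    using fsum by (intro Henstock_Kurzweil_Integration.integral_cong) auto
  also have "(\<lambda>k. integral {0..} (?f k)) = (\<lambda>k. of_real (a k) * s powr (- of_real (?p k)))"
  proof
    fix k
    have "integral {0..} (?f k) = of_real (a k / Gamma (?p k)) * (Gamma (?p k) * s powr (- of_real (?p k)))"
      by (simp only: integral_mult_right laplace_powr_complex(2)[OF s(1) p])
    then show "integral {0..} (?f k) = of_real (a k) * s powr (- of_real (?p k))"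
      using Gp[of k] by simp
  qed
  finally show "(\<lambda>k. of_real (a k) * s powr (- of_real (?p k))) sums
      integral {0..} (\<lambda>t. exp (- (s * of_real t)) * of_real (ml_kernel \<alpha> \<beta> a t))" .
qed

section \<open>Continuity of trajectories and the constant history\<close>

lemma absolutely_integrable_reflect_shift:
  fixes h :: "real \<Rightarrow> 'a::euclidean_space"
  assumes "h absolutely_integrable_on {a..b}"
  shows "(\<lambda>x. h (t - x)) absolutely_integrable_on {t-b..t-a}"
  using assms has_integral_reflect_shift[of h _ a b t] has_integral_reflect_shift[of "\<lambda>x. norm (h x)" _ a b t]
  unfolding absolutely_integrable_on_def integrable_on_def by blast

text \<open>The kernel can be singular only at 0, that is at \<tau> = t. Away from t it is
  continuous and f is integrable; near t the roles change, f being bounded and the kernel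
  integrable.\<close>

lemma convolution_integrable_of_bounded:
  fixes k f :: "real \<Rightarrow> real"
  assumes k: "\<And>T. k absolutely_integrable_on {0..T}" "\<And>t. t > 0 \<Longrightarrow> isCont k t"
    and f: "\<And>T. f absolutely_integrable_on {0..T}"
    and t: "0 < t" and e: "e > 0" "\<And>\<tau>. \<tau> \<in> ball t e \<Longrightarrow> \<bar>f \<tau>\<bar> \<le> C"
  shows "(\<lambda>\<tau>. k (t - \<tau>) * f \<tau>) absolutely_integrable_on {0..t}"
proof -
  define d where "d = min (e / 2) (t / 2)"
  have d: "0 < d" "d < e" "d < t" using t e by (auto simp: d_def min_def)
  have fT: "f absolutely_integrable_on {a..b}" if "0 \<le> a" for a b
    using f[of b] by (rule absolutely_integrable_on_subinterval) (use that in auto)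
  have "continuous_on {0..t-d} (\<lambda>\<tau>. k (t - \<tau>))"
    by (intro continuous_on_compose2[of "{0<..}" k "{0..t-d}" "\<lambda>\<tau>. t - \<tau>"] continuous_at_imp_continuous_on ballI k(2) continuous_intros)
       (use d in auto)
  then have 1: "(\<lambda>\<tau>. k (t - \<tau>) * f \<tau>) absolutely_integrable_on {0..t-d}"
    by (rule absolutely_integrable_continuous_times) (rule f)
  have "(\<lambda>\<tau>. k (t - \<tau>)) absolutely_integrable_on {t-d..t}"
    using absolutely_integrable_reflect_shift[OF k(1)[of d], of t] by simp
  moreover have "f \<in> borel_measurable (lebesgue_on {t-d..t})"
    using fT[of "t-d" t] d by (simp add: absolutely_integrable_measurable)
  moreover have "\<bar>f \<tau>\<bar> \<le> C" if "\<tau> \<in> {t-d..t}" for \<tau>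
    by (rule e(2)) (use that d in \<open>auto simp: dist_real_def\<close>)
  then have "bounded (f ` {t-d..t})" unfolding bounded_iff by (intro exI[of _ C]) auto
  ultimately have "(\<lambda>\<tau>. f \<tau> * k (t - \<tau>)) absolutely_integrable_on {t-d..t}"
    by (intro absolutely_integrable_bounded_measurable_product_real) auto
  then have 2: "(\<lambda>\<tau>. k (t - \<tau>) * f \<tau>) absolutely_integrable_on {t-d..t}"
    by (simp add: mult.commute)
  have "(\<lambda>\<tau>. k (t - \<tau>) * f \<tau>) absolutely_integrable_on ({0..t-d} \<union> {t-d..t})"
    by (rule set_integrable_Un[OF 1 2]) auto
  also have "{0..t-d} \<union> {t-d..t} = {0..t}" using d by auto
  finally show ?thesis .
qed

text \<open>The integral is split at t - \<delta>. The part after it is at most C times the integral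
  of |k| over [0, t' - t + \<delta>], small by continuity of that integral at 0; the part before it
  moves little with t, as k is uniformly continuous away from its singularity.\<close>

lemma isCont_convolution_of_bounded:
  fixes k f :: "real \<Rightarrow> real"
  assumes k: "\<And>T. k absolutely_integrable_on {0..T}" "\<And>t. t > 0 \<Longrightarrow> isCont k t"
    and f: "\<And>T. f absolutely_integrable_on {0..T}"
    and t: "0 < t" and e: "e > 0" "\<And>\<tau>. \<tau> \<in> ball t e \<Longrightarrow> \<bar>f \<tau>\<bar> \<le> C"
  shows "isCont (\<lambda>t. integral {0..t} (\<lambda>\<tau>. k (t - \<tau>) * f \<tau>)) t"
proof -
  let ?\<gamma> = "\<lambda>t. integral {0..t} (\<lambda>\<tau>. k (t - \<tau>) * f \<tau>)"
  let ?\<kappa> = "\<lambda>x. integral {0..x} (\<lambda>r. \<bar>k r\<bar>)"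
  have C: "C \<ge> 0" using e(2)[of t] e(1) by auto
  have ka: "(\<lambda>r. \<bar>k r\<bar>) integrable_on {0..T}" for T
    using k(1)[of T] by (simp add: absolutely_integrable_on_def)
  have fa: "(\<lambda>r. \<bar>f r\<bar>) integrable_on {0..T}" for T
    using f[of T] by (simp add: absolutely_integrable_on_def)
  define F where "F = integral {0..t} (\<lambda>r. \<bar>f r\<bar>)"
  have F: "F \<ge> 0" unfolding F_def by (intro Henstock_Kurzweil_Integration.integral_nonneg fa) auto
  have conv: "(\<lambda>\<tau>. k (t' - \<tau>) * f \<tau>) integrable_on {0..t'}" if "\<bar>t' - t\<bar> < e / 2" "0 < t'" for t'
  proof -
    have "\<bar>f \<tau>\<bar> \<le> C" if "\<tau> \<in> ball t' (e / 2)" for \<tau>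
      by (rule e(2)) (use that \<open>\<bar>t' - t\<bar> < e / 2\<close> in \<open>unfold mem_ball dist_real_def, arith\<close>)
    then show ?thesis
      using e(1) by (intro set_lebesgue_integral_eq_integral(1)
        convolution_integrable_of_bounded[OF k f \<open>0 < t'\<close>, of "e/2" C]) auto
  qed
  show ?thesis
  proof (unfold continuous_at_eps_delta, intro allI impI)
    fix \<epsilon> :: real assume \<epsilon>: "\<epsilon> > 0"
    have "continuous_on {0..} ?\<kappa>" by (rule continuous_on_indefinite_integral_ray[OF ka])
    then obtain \<delta>0 where \<delta>0: "\<delta>0 > 0" "\<And>x. 0 \<le> x \<Longrightarrow> x < \<delta>0 \<Longrightarrow> \<bar>?\<kappa> x\<bar> < \<epsilon> / (3 * (C + 1))"
      unfolding continuous_on_iff using \<epsilon> C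
      by (metis (no_types, lifting) abs_of_nonneg add_nonneg_pos atLeast_iff diff_zero dist_real_def divide_pos_pos
          integral_singleton interval_cbox order_refl zero_less_mult_iff zero_less_numeral zero_less_one cbox_idem)
    \<comment> \<open>\<delta>0 / 3 yields 2 \<delta> < \<delta>0, which covers the tail length t' -
      t + \<delta>; e / 2 keeps the tail where f is bounded, and t / 2 keeps t' positive.\<close>
    define \<delta> where "\<delta> = min (\<delta>0 / 3) (min (e / 2) (t / 2))"
    have \<delta>: "\<delta> > 0" "2 * \<delta> < \<delta>0" "\<delta> \<le> e / 2" "\<delta> \<le> t / 2"
      using \<delta>0 e t by (auto simp: \<delta>_def min_def)
    \<comment> \<open>All arguments t' - \<tau> of the head, with 0 <= \<tau> <= t - \<delta> and
      |t' - t| < \<delta> / 2, lie in this interval.\<close>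
    have "continuous_on {\<delta>/2..t+\<delta>} k"
      using \<delta> by (intro continuous_at_imp_continuous_on ballI k(2)) auto
    then have "uniformly_continuous_on {\<delta>/2..t+\<delta>} k"
      by (intro compact_uniformly_continuous) auto
    then obtain \<eta> where \<eta>: "\<eta> > 0" "\<And>x y. x \<in> {\<delta>/2..t+\<delta>} \<Longrightarrow> y \<in> {\<delta>/2..t+\<delta>} \<Longrightarrow> dist y x < \<eta> \<Longrightarrow> dist (k y) (k x) < \<epsilon> / (3 * (F + 1))"
      unfolding uniformly_continuous_on_def using \<epsilon> F
      by (metis add_nonneg_pos divide_pos_pos mult_pos_pos zero_less_numeral zero_less_one)
    have near: "0 < t'" "\<bar>t' - t\<bar> < e / 2" "t - \<delta> \<le> t'" if "\<bar>t' - t\<bar> < \<delta> / 2" for t'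
      using that \<delta> t by arith+
    let ?P = "\<lambda>t'. integral {0..t-\<delta>} (\<lambda>\<tau>. k (t' - \<tau>) * f \<tau>)"
    have tail: "\<bar>?\<gamma> t' - ?P t'\<bar> < \<epsilon> / 3" if t': "\<bar>t' - t\<bar> < \<delta> / 2" for t'
    proof -
      have c: "(\<lambda>\<tau>. k (t' - \<tau>) * f \<tau>) integrable_on {0..t'}"
        using near[OF t'] by (intro conv)
      have "?P t' + integral {t-\<delta>..t'} (\<lambda>\<tau>. k (t' - \<tau>) * f \<tau>) = ?\<gamma> t'"
        by (rule Henstock_Kurzweil_Integration.integral_combine[OF _ _ c]) (use near[OF t'] \<delta> in auto)
      then have "\<bar>?\<gamma> t' - ?P t'\<bar> = norm (integral {t-\<delta>..t'} (\<lambda>\<tau>. k (t' - \<tau>) * f \<tau>))"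
        by simp
      also have "\<dots> \<le> integral {t-\<delta>..t'} (\<lambda>\<tau>. \<bar>k (t' - \<tau>)\<bar> * C)"
      proof (rule integral_norm_bound_integral)
        show "(\<lambda>\<tau>. k (t' - \<tau>) * f \<tau>) integrable_on {t-\<delta>..t'}"
          by (rule integrable_on_subinterval[OF c]) (use t' \<delta> in auto)
        have "(\<lambda>\<tau>. \<bar>k (t' - \<tau>)\<bar>) integrable_on {t-\<delta>..t'}"
          using has_integral_reflect_shift[OF integrable_integral[OF ka[of "t' - t + \<delta>"]], of t']
          by (auto simp: integrable_on_def)
        then show "(\<lambda>\<tau>. \<bar>k (t' - \<tau>)\<bar> * C) integrable_on {t-\<delta>..t'}"
          by (rule integrable_on_mult_left)
        show "norm (k (t' - \<tau>) * f \<tau>) \<le> \<bar>k (t' - \<tau>)\<bar> * C" if "\<tau> \<in> {t-\<delta>..t'}" for \<tau>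
        proof -
          have "\<bar>t - \<tau>\<bar> < e"
            using that t' \<delta> by (simp only: atLeastAtMost_iff) arith
          then show ?thesis
            by (auto simp: abs_mult dist_real_def intro!: mult_left_mono e(2))
        qed
      qed
      also have "\<dots> = ?\<kappa> (t' - t + \<delta>) * C"
        using has_integral_reflect_shift[OF integrable_integral[OF ka[of "t' - t + \<delta>"]], of t']
        by (simp add: integral_unique)
      also have "\<dots> \<le> \<epsilon> / (3 * (C + 1)) * C"
      proof (rule mult_right_mono[OF _ C])
        have "0 \<le> t' - t + \<delta>" "t' - t + \<delta> < \<delta>0" using t' \<delta> by arith+
        then show "?\<kappa> (t' - t + \<delta>) \<le> \<epsilon> / (3 * (C + 1))"
          using \<delta>0(2)[of "t' - t + \<delta>"] by (simp only: abs_less_iff less_imp_le)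
      qed
      also have "\<dots> < \<epsilon> / 3"
        using C \<epsilon> by (simp add: field_simps)
      finally show ?thesis .
    qed
    have head: "\<bar>?P t' - ?P t\<bar> < \<epsilon> / 3" if t': "\<bar>t' - t\<bar> < \<delta> / 2" "\<bar>t' - t\<bar> < \<eta>" for t'
    proof -
      have i: "(\<lambda>\<tau>. k (t' - \<tau>) * f \<tau>) integrable_on {0..t-\<delta>}" if "\<bar>t' - t\<bar> < \<delta> / 2" for t'
        by (rule integrable_on_subinterval[OF conv[of t']]) (use that \<delta> near[OF that] in auto)
      have "?P t' - ?P t = integral {0..t-\<delta>} (\<lambda>\<tau>. k (t' - \<tau>) * f \<tau> - k (t - \<tau>) * f \<tau>)"
        using i[OF t'(1)] i[of t] \<delta> by (subst Henstock_Kurzweil_Integration.integral_diff) auto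
      then have "\<bar>?P t' - ?P t\<bar> = norm (integral {0..t-\<delta>} (\<lambda>\<tau>. k (t' - \<tau>) * f \<tau> - k (t - \<tau>) * f \<tau>))"
        by simp
      also have "\<dots> \<le> integral {0..t-\<delta>} (\<lambda>\<tau>. \<epsilon> / (3 * (F + 1)) * \<bar>f \<tau>\<bar>)"
      proof (rule integral_norm_bound_integral)
        show "(\<lambda>\<tau>. k (t' - \<tau>) * f \<tau> - k (t - \<tau>) * f \<tau>) integrable_on {0..t-\<delta>}"
          using i[OF t'(1)] i[of t] \<delta> by (intro Henstock_Kurzweil_Integration.integrable_diff) auto
        show "(\<lambda>\<tau>. \<epsilon> / (3 * (F + 1)) * \<bar>f \<tau>\<bar>) integrable_on {0..t-\<delta>}"
          by (intro integrable_on_mult_right fa)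
        fix \<tau> assume \<tau>: "\<tau> \<in> {0..t-\<delta>}"
        have "dist (k (t' - \<tau>)) (k (t - \<tau>)) < \<epsilon> / (3 * (F + 1))"
          by (rule \<eta>(2)) (use t' \<tau> \<delta> in \<open>simp_all only: dist_real_def atLeastAtMost_iff, arith+\<close>)
        then have "\<bar>k (t' - \<tau>) - k (t - \<tau>)\<bar> * \<bar>f \<tau>\<bar> \<le> \<epsilon> / (3 * (F + 1)) * \<bar>f \<tau>\<bar>"
          by (intro mult_right_mono) (auto simp: dist_real_def)
        then show "norm (k (t' - \<tau>) * f \<tau> - k (t - \<tau>) * f \<tau>) \<le> \<epsilon> / (3 * (F + 1)) * \<bar>f \<tau>\<bar>"
          by (simp add: abs_mult flip: left_diff_distrib)
      qed
      also have "\<dots> = \<epsilon> / (3 * (F + 1)) * integral {0..t-\<delta>} (\<lambda>\<tau>. \<bar>f \<tau>\<bar>)"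
        by (rule integral_mult_right)
      also have "\<dots> \<le> \<epsilon> / (3 * (F + 1)) * F"
        unfolding F_def using \<epsilon> F \<delta> by (intro mult_left_mono integral_subset_le fa) (auto simp: F_def)
      also have "\<dots> < \<epsilon> / 3"
        using F \<epsilon> by (simp add: field_simps)
      finally show ?thesis .
    qed
    have three: "\<bar>x - y\<bar> < \<epsilon>" if "\<bar>x - p\<bar> < \<epsilon> / 3" "\<bar>y - q\<bar> < \<epsilon> / 3" "\<bar>p - q\<bar> < \<epsilon> / 3" for x y p q :: real
      using that by arith
    show "\<exists>d>0. \<forall>t'. dist t' t < d \<longrightarrow> dist (?\<gamma> t') (?\<gamma> t) < \<epsilon>"
    proof (intro exI conjI allI impI)
      show "min (\<delta> / 2) \<eta> > 0" using \<delta> \<eta> by simp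
      fix t' assume "dist t' t < min (\<delta> / 2) \<eta>"
      then have "\<bar>t' - t\<bar> < \<delta> / 2" "\<bar>t' - t\<bar> < \<eta>" by (auto simp: dist_real_def)
      then show "dist (?\<gamma> t') (?\<gamma> t) < \<epsilon>"
        unfolding dist_real_def by (intro three[OF tail tail head]) (use \<delta>(1) in auto)
    qed
  qed
qed

text \<open>Two functions that differ at t and are continuous there differ on an open neighbourhood,
  which is not negligible.\<close>

lemma isCont_AE_eq:
  fixes x y :: "real \<Rightarrow> 'a::real_normed_vector"
  assumes eq: "AE t in lebesgue. 0 < t \<longrightarrow> x t = y t" and cont: "isCont x t" "isCont y t" and t: "0 < t"
  shows "x t = y t"
proof (rule ccontr)
  assume ne: "x t \<noteq> y t"
  have "isCont (\<lambda>r. x r - y r) t" using cont by (intro continuous_intros)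
  then have "eventually (\<lambda>r. x r - y r \<noteq> 0) (nhds t)"
    using ne unfolding continuous_within by (intro tendsto_imp_eventually_ne) (auto simp: tendsto_nhds_iff)
  moreover have "eventually (\<lambda>r. 0 < r) (nhds t)"
    using t eventually_nhds_in_open[of "{0<..}" t] by simp
  ultimately have "eventually (\<lambda>r. 0 < r \<and> x r \<noteq> y r) (nhds t)"
    by eventually_elim auto
  then obtain U where U: "open U" "t \<in> U" "\<And>r. r \<in> U \<Longrightarrow> 0 < r \<and> x r \<noteq> y r"
    unfolding eventually_nhds by auto
  obtain N where N: "negligible N" "\<And>r. r \<notin> N \<Longrightarrow> 0 < r \<longrightarrow> x r = y r"
    using AE_lebesgue_negligible[OF eq] by blast
  have "U \<subseteq> N" using U(3) N(2) by auto
  then have "negligible U" using N(1) negligible_subset by blast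
  then show False
    using U open_not_negligible by blast
qed

text \<open>Close to t only t itself can be a break point, so u takes at most three values there:
  one on each side and an arbitrary one at t.\<close>

lemma piecewise_constant_locally_bounded:
  assumes u: "piecewise_constant u" and t: "0 < t"
  obtains e where "e > 0" "bounded (u ` ball t e)"
proof -
  obtain P where P: "finite P" "\<And>a b. 0 \<le> a \<Longrightarrow> a < b \<Longrightarrow> b \<le> t + 1 \<Longrightarrow> {a<..<b} \<inter> P = {} \<Longrightarrow> u constant_on {a<..<b}"
    using u t unfolding piecewise_constant_def by (metis add_pos_pos zero_less_one)
  obtain d where d: "d > 0" "\<forall>x\<in>P. x \<noteq> t \<longrightarrow> d \<le> dist t x"
    using finite_set_avoid[OF P(1)] by blast
  \<comment> \<open>d excludes the other break points, t keeps the ball on the positive axis, and 1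
    keeps it inside [0, t + 1], the range of \<open>P\<close>.\<close>
  define e where "e = min d (min t 1)"
  have e: "e > 0" "e \<le> d" "e \<le> t" "e \<le> 1" using d t by (auto simp: e_def)
  have "u constant_on {t-e<..<t}" "u constant_on {t<..<t+e}"
    by (intro P(2); use e d in \<open>force simp: dist_real_def\<close>)+
  then obtain p q where pq: "\<And>x. x \<in> {t-e<..<t} \<Longrightarrow> u x = p" "\<And>x. x \<in> {t<..<t+e} \<Longrightarrow> u x = q"
    unfolding constant_on_def by blast
  have "u ` ball t e \<subseteq> {p, q, u t}"
  proof
    fix y assume "y \<in> u ` ball t e"
    then obtain r where r: "y = u r" "\<bar>t - r\<bar> < e" by (auto simp: dist_real_def)
    then consider "r \<in> {t-e<..<t}" | "r = t" | "r \<in> {t<..<t+e}" by fastforce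
    then show "y \<in> {p, q, u t}" using pq r by cases auto
  qed
  then have "bounded (u ` ball t e)"
    by (rule bounded_subset[rotated]) (simp add: finite_imp_bounded)
  with e(1) show ?thesis by (rule that)
qed

text \<open>Explicit antiderivatives. For nonzero a the integral over [\<omega>, 0] is unbounded as
  \<omega> -> - infinity, but its derivative in t converges, because (t - \<omega>) powr (-
  \<alpha>) tends to 0.\<close>

lemma history_init_const:
  fixes a :: "real^'n"
  assumes \<alpha>: "0 < \<alpha>" "\<alpha> < 1" and t: "0 < t"
  shows "history_init \<alpha> (\<lambda>\<tau>. a) t = (- (t powr (- \<alpha>)) / Gamma (1 - \<alpha>)) *\<^sub>R a"
proof -
  have int: "((\<lambda>\<tau>. (1 / (r - \<tau>) powr \<alpha>) *\<^sub>R a) has_integral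
      (((r - \<omega>) powr (1 - \<alpha>) - r powr (1 - \<alpha>)) / (1 - \<alpha>)) *\<^sub>R a) {\<omega>..0}" if "\<omega> \<le> 0" "0 < r" for r \<omega>
  proof -
    have "((\<lambda>\<tau>. (- ((r - \<tau>) powr (1 - \<alpha>)) / (1 - \<alpha>)) *\<^sub>R a) has_vector_derivative
        (1 / (r - \<tau>) powr \<alpha>) *\<^sub>R a) (at \<tau> within {\<omega>..0})" if "\<tau> \<in> {\<omega>..0}" for \<tau>
    proof (rule bounded_linear.has_vector_derivative[OF bounded_linear_scaleR_left])
      have r\<tau>: "r - \<tau> > 0" using that \<open>0 < r\<close> by simp
      have "DERIV (\<lambda>\<tau>. r - \<tau>) \<tau> :> -1"
        by (auto intro!: derivative_eq_intros)
      from DERIV_cmult[OF DERIV_fun_powr[OF this r\<tau>, of "1 - \<alpha>"], of "- 1 / (1 - \<alpha>)"]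
      have "DERIV (\<lambda>\<tau>. - ((r - \<tau>) powr (1 - \<alpha>)) / (1 - \<alpha>)) \<tau> :> 1 / (r - \<tau>) powr \<alpha>"
        using \<alpha> by (simp add: powr_minus_divide)
      then show "((\<lambda>\<tau>. - ((r - \<tau>) powr (1 - \<alpha>)) / (1 - \<alpha>)) has_vector_derivative
          1 / (r - \<tau>) powr \<alpha>) (at \<tau> within {\<omega>..0})"
        by (simp add: has_real_derivative_iff_has_vector_derivative[symmetric] has_field_derivative_at_within)
    qed
    then have "((\<lambda>\<tau>. (1 / (r - \<tau>) powr \<alpha>) *\<^sub>R a) has_integral
       ((- ((r - 0) powr (1 - \<alpha>)) / (1 - \<alpha>)) *\<^sub>R a - (- ((r - \<omega>) powr (1 - \<alpha>)) / (1 - \<alpha>)) *\<^sub>R a)) {\<omega>..0}"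
      using that by (intro fundamental_theorem_of_calculus) auto
    then show ?thesis
      by (simp add: scaleR_left_diff_distrib[symmetric] diff_divide_distrib)
  qed
  have vd: "vector_derivative (\<lambda>r. (1 / Gamma (1 - \<alpha>)) *\<^sub>R integral {\<omega>..0} (\<lambda>\<tau>. (1 / (r - \<tau>) powr \<alpha>) *\<^sub>R a)) (at t)
     = (((t - \<omega>) powr (- \<alpha>) - t powr (- \<alpha>)) / Gamma (1 - \<alpha>)) *\<^sub>R a" if \<omega>: "\<omega> \<le> 0" for \<omega>
  proof (rule vector_derivative_at)
    have "DERIV (\<lambda>r. r - \<omega>) t :> 1" "DERIV (\<lambda>r. r) t :> 1" "t - \<omega> > 0"
      using t \<omega> by (auto intro!: derivative_eq_intros)
    note D = DERIV_fun_powr[OF this(1,3), of "1 - \<alpha>"] DERIV_fun_powr[OF this(2) t, of "1 - \<alpha>"]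
    have "DERIV (\<lambda>r. ((r - \<omega>) powr (1 - \<alpha>) - r powr (1 - \<alpha>)) / (1 - \<alpha>) / Gamma (1 - \<alpha>)) t
        :> (((t - \<omega>) powr (- \<alpha>) - t powr (- \<alpha>)) / Gamma (1 - \<alpha>))"
      using DERIV_cdivide[OF DERIV_cdivide[OF DERIV_diff[OF D], of "1 - \<alpha>"], of "Gamma (1 - \<alpha>)"] \<alpha>
      by (simp add: right_diff_distrib[symmetric])
    then have "((\<lambda>r. (((r - \<omega>) powr (1 - \<alpha>) - r powr (1 - \<alpha>)) / (1 - \<alpha>) / Gamma (1 - \<alpha>)) *\<^sub>R a) has_vector_derivative
      (((t - \<omega>) powr (- \<alpha>) - t powr (- \<alpha>)) / Gamma (1 - \<alpha>)) *\<^sub>R a) (at t)"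
      by (intro bounded_linear.has_vector_derivative[OF bounded_linear_scaleR_left])
         (simp add: has_real_derivative_iff_has_vector_derivative[symmetric])
    then show "((\<lambda>r. (1 / Gamma (1 - \<alpha>)) *\<^sub>R integral {\<omega>..0} (\<lambda>\<tau>. (1 / (r - \<tau>) powr \<alpha>) *\<^sub>R a)) has_vector_derivative
      (((t - \<omega>) powr (- \<alpha>) - t powr (- \<alpha>)) / Gamma (1 - \<alpha>)) *\<^sub>R a) (at t)"
      by (rule has_vector_derivative_transform_within_open[of _ _ _ "{0<..}"])
         (use t in \<open>auto simp: integral_unique[OF int[OF \<omega>]]\<close>)
  qed
  have "filterlim (\<lambda>\<omega>. t - \<omega>) at_top at_bot"
    using filterlim_tendsto_add_at_top[OF tendsto_const filterlim_uminus_at_top_at_bot, of t] by simp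
  then have "((\<lambda>\<omega>. (t - \<omega>) powr (- \<alpha>)) \<longlongrightarrow> 0) at_bot"
    using \<alpha> by (intro tendsto_neg_powr) auto
  then have "((\<lambda>\<omega>. (((t - \<omega>) powr (- \<alpha>) - t powr (- \<alpha>)) / Gamma (1 - \<alpha>)) *\<^sub>R a) \<longlongrightarrow>
      ((0 - t powr (- \<alpha>)) / Gamma (1 - \<alpha>)) *\<^sub>R a) at_bot"
    using less_imp_neq[OF Gamma_real_pos[of "1 - \<alpha>"]] \<alpha> by (intro tendsto_intros) auto
  moreover have "eventually (\<lambda>\<omega>. (((t - \<omega>) powr (- \<alpha>) - t powr (- \<alpha>)) / Gamma (1 - \<alpha>)) *\<^sub>R a =
     vector_derivative (\<lambda>r. (1 / Gamma (1 - \<alpha>)) *\<^sub>R integral {\<omega>..0} (\<lambda>\<tau>. (1 / (r - \<tau>) powr \<alpha>) *\<^sub>R a)) (at t)) at_bot"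
    using eventually_le_at_bot[of 0] by eventually_elim (use vd in simp)
  ultimately have "((\<lambda>\<omega>. vector_derivative (\<lambda>r. (1 / Gamma (1 - \<alpha>)) *\<^sub>R integral {\<omega>..0} (\<lambda>\<tau>. (1 / (r - \<tau>) powr \<alpha>) *\<^sub>R a)) (at t)) \<longlongrightarrow>
      ((0 - t powr (- \<alpha>)) / Gamma (1 - \<alpha>)) *\<^sub>R a) at_bot"
    by (rule Lim_transform_eventually)
  then show ?thesis
    unfolding history_init_def by (simp add: tendsto_Lim)
qed

section \<open>The vector-valued system\<close>

lemma absolutely_integrable_vec_iff:
  fixes f :: "real \<Rightarrow> 'a::euclidean_space ^ 'n"
  shows "f absolutely_integrable_on S \<longleftrightarrow> (\<forall>i. (\<lambda>t. f t $ i) absolutely_integrable_on S)"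
  by (subst absolutely_integrable_componentwise_iff, subst absolutely_integrable_componentwise_iff)
     (auto simp: Basis_vec_def inner_axis)

lemma has_integral_vec_iff:
  fixes f :: "real \<Rightarrow> 'a::euclidean_space ^ 'n"
  shows "(f has_integral I) S \<longleftrightarrow> (\<forall>i. ((\<lambda>t. f t $ i) has_integral (I $ i)) S)"
  by (subst has_integral_componentwise_iff, subst has_integral_componentwise_iff)
     (auto simp: Basis_vec_def inner_axis)

lemma integral_vec_nth:
  fixes f :: "real \<Rightarrow> 'a::euclidean_space ^ 'n"
  assumes "\<And>i. (\<lambda>t. f t $ i) integrable_on S"
  shows "integral S f $ i = integral S (\<lambda>t. f t $ i)"
proof -
  have "(f has_integral (\<chi> i. integral S (\<lambda>t. f t $ i))) S"
    using assms by (subst has_integral_vec_iff) (auto simp: integrable_integral)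
  then show ?thesis by (simp add: integral_unique)
qed

lemma absolutely_integrable_of_real_iff:
  fixes f :: "real \<Rightarrow> real"
  shows "(\<lambda>t. complex_of_real (f t)) absolutely_integrable_on S \<longleftrightarrow> f absolutely_integrable_on S"
proof
  assume "(\<lambda>t. complex_of_real (f t)) absolutely_integrable_on S"
  from absolutely_integrable_linear[OF this bounded_linear_Re] show "f absolutely_integrable_on S"
    by (simp add: o_def)
next
  assume "f absolutely_integrable_on S"
  from absolutely_integrable_linear[OF this bounded_linear_of_real]
  show "(\<lambda>t. complex_of_real (f t)) absolutely_integrable_on S"
    by (simp add: o_def)
qed

lemma integral_complex_of_real_eq:
  fixes f :: "real \<Rightarrow> real"
  assumes "f integrable_on S"
  shows "integral S (\<lambda>t. complex_of_real (f t)) = of_real (integral S f)"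
  by (intro integral_unique has_integral_of_real integrable_integral assms)

text \<open>Componentwise relational form, through which the scalar theory applies;
  \<open>has_vec_laplace_iff\<close> connects it with \<open>laplace_converges\<close> and
  \<open>laplace\<close>.\<close>

definition has_vec_laplace :: "(real \<Rightarrow> real^'n) \<Rightarrow> complex \<Rightarrow> complex^'n \<Rightarrow> bool" where
  "has_vec_laplace f s L \<longleftrightarrow> (\<forall>i. has_laplace (\<lambda>t. of_real (f t $ i)) s (L $ i))"

lemma has_vec_laplace_absolutely_integrable:
  assumes "has_vec_laplace f s L"
  shows "f absolutely_integrable_on {0..T}"
proof -
  have "(\<lambda>t. complex_of_real (f t $ i)) absolutely_integrable_on {0..T}" for i
    by (rule has_laplaceD(1)[of _ s "L $ i"]) (use assms in \<open>simp add: has_vec_laplace_def\<close>)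
  then show ?thesis
    by (simp add: absolutely_integrable_vec_iff absolutely_integrable_of_real_iff)
qed

lemma laplace_partial_nth:
  assumes "\<And>i. (\<lambda>t. complex_of_real (f t $ i)) absolutely_integrable_on {0..T}"
  shows "laplace_partial f s T $ i = integral {0..T} (\<lambda>t. exp (- (s * of_real t)) * of_real (f t $ i))"
proof -
  have "laplace_partial f s T $ i = integral {0..T} (\<lambda>t. (exp (- (s * of_real t)) *s cvec (f t)) $ i)"
    unfolding laplace_partial_def
    by (rule integral_vec_nth)
       (auto simp: cvec_def intro!: set_lebesgue_integral_eq_integral(1) absolutely_integrable_exp_times assms)
  then show ?thesis by (simp add: cvec_def)
qed

lemma has_vec_laplace_iff:
  "has_vec_laplace f s L \<longleftrightarrow> laplace_converges f s \<and> laplace f s = L"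
proof
  assume h: "has_vec_laplace f s L"
  then have i: "has_laplace (\<lambda>t. of_real (f t $ i)) s (L $ i)" for i
    by (simp add: has_vec_laplace_def)
  have lim: "(laplace_partial f s \<longlongrightarrow> L) at_top"
    using has_laplaceD(3)[OF i]
    by (intro vec_tendstoI) (simp add: laplace_partial_nth[OF has_laplaceD(1)[OF i]])
  then show "laplace_converges f s \<and> laplace f s = L"
    using has_vec_laplace_absolutely_integrable[OF h]
    by (auto simp: laplace_converges_def laplace_def intro!: tendsto_Lim)
next
  assume "laplace_converges f s \<and> laplace f s = L"
  then have f: "\<And>T. T > 0 \<Longrightarrow> f absolutely_integrable_on {0..T}" and lim: "(laplace_partial f s \<longlongrightarrow> L) at_top"
    by (auto simp: laplace_converges_def laplace_def tendsto_Lim)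
  have fi: "(\<lambda>t. complex_of_real (f t $ i)) absolutely_integrable_on {0..T}" if "T > 0" for i T
    using f[OF that] by (simp add: absolutely_integrable_of_real_iff absolutely_integrable_vec_iff)
  show "has_vec_laplace f s L"
    unfolding has_vec_laplace_def has_laplace_def
  proof (intro allI conjI impI)
    fix i
    \<comment> \<open>Integrability is available for T > 0, so the partial integrals are matched
      eventually.\<close>
    have "eventually (\<lambda>T. laplace_partial f s T $ i = integral {0..T} (\<lambda>t. exp (- (s * of_real t)) * of_real (f t $ i))) at_top"
      using eventually_gt_at_top[of 0] by eventually_elim (use laplace_partial_nth[OF fi] in blast)
    with tendsto_vec_nth[OF lim, of i]
    show "((\<lambda>T. integral {0..T} (\<lambda>t. exp (- (s * of_real t)) * of_real (f t $ i))) \<longlongrightarrow> L $ i) at_top"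
      by (rule Lim_transform_eventually)
  qed (rule fi)
qed

lemma has_vec_laplaceI: "laplace_converges f s \<Longrightarrow> has_vec_laplace f s (laplace f s)"
  by (simp add: has_vec_laplace_iff)

lemma laplace_converges_halfplane:
  assumes "laplace_converges f s" "Re s < Re z"
  shows "laplace_converges f z"
proof -
  have "\<forall>i. \<exists>M. has_laplace (\<lambda>t. of_real (f t $ i)) z M"
    using has_laplace_halfplane[OF _ assms(2)] has_vec_laplaceI[OF assms(1)]
    unfolding has_vec_laplace_def by blast
  then obtain M where "\<forall>i. has_laplace (\<lambda>t. of_real (f t $ i)) z (M i)" by metis
  then have "has_vec_laplace f z (\<chi> i. M i)" by (simp add: has_vec_laplace_def)
  then show ?thesis by (simp add: has_vec_laplace_iff)
qed

lemma has_vec_laplace_add: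
  "has_vec_laplace f s L \<Longrightarrow> has_vec_laplace g s M \<Longrightarrow> has_vec_laplace (\<lambda>t. f t + g t) s (L + M)"
  by (simp add: has_vec_laplace_def has_laplace_add)

lemma has_vec_laplace_diff:
  "has_vec_laplace f s L \<Longrightarrow> has_vec_laplace g s M \<Longrightarrow> has_vec_laplace (\<lambda>t. f t - g t) s (L - M)"
  by (simp add: has_vec_laplace_def has_laplace_diff)

lemma has_vec_laplace_matrix_mult:
  fixes B :: "real^'m^'n"
  assumes "has_vec_laplace f s L"
  shows "has_vec_laplace (\<lambda>t. B *v f t) s (map_matrix of_real B *v L)"
  using assms unfolding has_vec_laplace_def
  by (simp add: matrix_vector_mult_def map_matrix_def has_laplace_sum has_laplace_cmult)

lemma has_vec_laplace_zero_imp_AE_zero: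
  fixes f :: "real \<Rightarrow> real^'n"
  assumes "\<And>s::real. s > \<sigma> \<Longrightarrow> has_vec_laplace f (of_real s) 0"
  shows "AE t in lebesgue. 0 < t \<longrightarrow> f t = 0"
proof -
  have "AE t in lebesgue. 0 < t \<longrightarrow> f t $ i = 0" for i
    by (rule has_laplace_zero_imp_AE_zero[of \<sigma>]) (use assms in \<open>simp add: has_vec_laplace_def\<close>)
  then have "AE t in lebesgue. \<forall>i\<in>UNIV. 0 < t \<longrightarrow> f t $ i = 0"
    by (intro AE_finite_allI) auto
  then show ?thesis
    by eventually_elim (simp add: vec_eq_iff)
qed

section \<open>Matrix Mittag-Leffler functions entry by entry, and the resolvent\<close>

definition entry_sum :: "real^'n^'m \<Rightarrow> real" where
  "entry_sum A = (\<Sum>i\<in>UNIV. \<Sum>j\<in>UNIV. \<bar>A $ i $ j\<bar>)"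

lemma entry_sum_nonneg: "entry_sum A \<ge> 0"
  by (simp add: entry_sum_def sum_nonneg)

lemma row_sum_le_entry_sum: "(\<Sum>j\<in>UNIV. \<bar>A $ i $ j\<bar>) \<le> entry_sum A"
  unfolding entry_sum_def by (rule member_le_sum) (auto intro: sum_nonneg)

text \<open>Induction through the product of A with A^k, each row sum of A being at most
  \<open>entry_sum A\<close>. This supplies the constant c of the scalar kernel lemmas, uniformly in
  i and j.\<close>

lemma abs_mat_power_le: "\<bar>mat_power A k $ i $ j\<bar> \<le> entry_sum A ^ k"
proof (induction k arbitrary: i)
  case (Suc k)
  have "\<bar>mat_power A (Suc k) $ i $ j\<bar> \<le> (\<Sum>l\<in>UNIV. \<bar>A $ i $ l\<bar> * \<bar>mat_power A k $ l $ j\<bar>)"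
    by (simp add: matrix_matrix_mult_def sum_abs flip: abs_mult)
  also have "\<dots> \<le> (\<Sum>l\<in>UNIV. \<bar>A $ i $ l\<bar> * entry_sum A ^ k)"
    by (intro sum_mono mult_left_mono Suc.IH) auto
  also have "\<dots> = (\<Sum>l\<in>UNIV. \<bar>A $ i $ l\<bar>) * entry_sum A ^ k"
    by (simp add: sum_distrib_right)
  also have "\<dots> \<le> entry_sum A * entry_sum A ^ k"
    by (intro mult_right_mono row_sum_le_entry_sum zero_le_power entry_sum_nonneg)
  finally show ?case by simp
qed (simp add: mat_def)

lemma mat_power_scaleR: "mat_power (z *\<^sub>R A) k = z ^ k *\<^sub>R mat_power A k"
  by (induction k) (simp_all add: matrix_scalar_ac scalar_matrix_assoc mult.commute flip: scalar_mult_eq_scaleR)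

lemma sums_vecI:
  assumes "\<And>i. (\<lambda>k. f k $ i) sums (l $ i)"
  shows "f sums l"
  using assms unfolding sums_def by (intro vec_tendstoI) simp

text \<open>The matrix series is a sum in the matrix space, so its convergence there is established
  first, from that of the entries.\<close>

lemma mittag_leffler_nth:
  assumes "\<alpha> > 0" "\<beta> > 0"
  shows "mittag_leffler \<alpha> \<beta> (z *\<^sub>R A) $ i $ j =
    (\<Sum>k. mat_power A k $ i $ j / Gamma (real k * \<alpha> + \<beta>) * z ^ k)"
proof -
  have "(\<lambda>k. (1 / Gamma (real k * \<alpha> + \<beta>)) *\<^sub>R mat_power (z *\<^sub>R A) k) sums
     (\<chi> i j. \<Sum>k. mat_power A k $ i $ j / Gamma (real k * \<alpha> + \<beta>) * z ^ k)"
  proof (intro sums_vecI)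
    fix i j
    have "(\<lambda>k. mat_power A k $ i $ j / Gamma (real k * \<alpha> + \<beta>) * z ^ k) sums
       (\<Sum>k. mat_power A k $ i $ j / Gamma (real k * \<alpha> + \<beta>) * z ^ k)"
      by (intro summable_sums summable_mittag_leffler[OF assms entry_sum_nonneg[of A]] abs_mat_power_le)
    then show "(\<lambda>k. ((1 / Gamma (real k * \<alpha> + \<beta>)) *\<^sub>R mat_power (z *\<^sub>R A) k) $ i $ j) sums
      ((\<chi> i j. \<Sum>k. mat_power A k $ i $ j / Gamma (real k * \<alpha> + \<beta>) * z ^ k) $ i $ j)"
      by (simp add: mat_power_scaleR mult.commute)
  qed
  then show ?thesis
    unfolding mittag_leffler_def by (simp add: sums_iff)
qed

lemma alpha_exp_nth:
  assumes "\<alpha> > 0"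
  shows "alpha_exp \<alpha> A t $ i $ j = ml_kernel \<alpha> \<alpha> (\<lambda>k. mat_power A k $ i $ j) t"
  using assms by (simp add: alpha_exp_def ml_kernel_def mittag_leffler_nth)

text \<open>At t = 0 the kernel vanishes because \<open>0 powr 0 = 0\<close>, whereas E_alpha(0) is
  the identity; hence the restriction to t > 0.\<close>

lemma mittag_leffler_one_nth:
  assumes "\<alpha> > 0" "t > 0"
  shows "mittag_leffler \<alpha> 1 ((t powr \<alpha>) *\<^sub>R A) $ i $ j = ml_kernel \<alpha> 1 (\<lambda>k. mat_power A k $ i $ j) t"
  using assms by (simp add: ml_kernel_def mittag_leffler_nth)

text \<open>Neumann series: multiplication by s powr \<alpha> shifts the index, so term k + 1
  becomes A times the old term k, and the term k = 0 leaves s powr (\<alpha> - \<beta>) times the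
  identity. For fixed j this is column j of (s^\<alpha> - A) K = s^(\<alpha> - \<beta>) I.\<close>

lemma ml_resolvent_identity:
  fixes A :: "real^'n^'n" and K :: "'n \<Rightarrow> complex"
  assumes s: "s \<noteq> 0" and K: "\<And>l. (\<lambda>k. of_real (mat_power A k $ l $ j) * s powr (- of_real (real k * \<alpha> + \<beta>))) sums K l"
  shows "s powr of_real \<alpha> * K i = (\<Sum>l\<in>UNIV. of_real (A $ i $ l) * K l) + (if i = j then s powr of_real (\<alpha> - \<beta>) else 0)"
proof -
  let ?g = "\<lambda>k. s powr of_real \<alpha> * (of_real (mat_power A k $ i $ j) * s powr (- of_real (real k * \<alpha> + \<beta>)))"
  have "?g sums (s powr of_real \<alpha> * K i)"
    by (intro sums_mult K)
  then have "(\<lambda>k. ?g (Suc k)) sums (s powr of_real \<alpha> * K i - ?g 0)"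
    by (subst sums_Suc_iff) simp
  moreover have "(\<lambda>k. \<Sum>l\<in>UNIV. of_real (A $ i $ l) * (of_real (mat_power A k $ l $ j) * s powr (- of_real (real k * \<alpha> + \<beta>))))
      sums (\<Sum>l\<in>UNIV. of_real (A $ i $ l) * K l)"
    by (intro sums_sum sums_mult K)
  moreover have "(\<Sum>l\<in>UNIV. of_real (A $ i $ l) * (of_real (mat_power A k $ l $ j) * s powr (- of_real (real k * \<alpha> + \<beta>)))) = ?g (Suc k)" for k
  proof -
    have "s powr of_real \<alpha> * s powr (- of_real (real (Suc k) * \<alpha> + \<beta>)) = s powr (- of_real (real k * \<alpha> + \<beta>))"
      by (simp add: powr_add[symmetric] algebra_simps)
    then have "?g (Suc k) = of_real (mat_power A (Suc k) $ i $ j) * s powr (- of_real (real k * \<alpha> + \<beta>))"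
      by (metis mult.left_commute)
    also have "\<dots> = (\<Sum>l\<in>UNIV. of_real (A $ i $ l) * (of_real (mat_power A k $ l $ j) * s powr (- of_real (real k * \<alpha> + \<beta>))))"
      by (simp add: matrix_matrix_mult_def sum_distrib_right mult.assoc)
    finally show ?thesis by simp
  qed
  ultimately have "s powr of_real \<alpha> * K i - ?g 0 = (\<Sum>l\<in>UNIV. of_real (A $ i $ l) * K l)"
    using sums_unique2 by fastforce
  moreover have "?g 0 = (if i = j then s powr of_real (\<alpha> - \<beta>) else 0)"
    by (simp add: mat_def powr_add[symmetric])
  ultimately show ?thesis by (simp add: algebra_simps)
qed

lemma powr_exceeds_entry_sum:
  assumes "\<alpha> > 0"
  obtains \<sigma> where "\<sigma> > 0" "\<And>x. x > \<sigma> \<Longrightarrow> entry_sum A < x powr \<alpha>"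
proof -
  define c where "c = entry_sum A + 1"
  have c: "c > 0" using entry_sum_nonneg[of A] by (simp add: c_def)
  show ?thesis
  proof (rule that[of "c powr (1 / \<alpha>)"])
    fix x assume "x > c powr (1 / \<alpha>)"
    then have "(c powr (1 / \<alpha>)) powr \<alpha> < x powr \<alpha>"
      using assms by (intro powr_less_mono2) auto
    then show "entry_sum A < x powr \<alpha>"
      using assms c by (simp add: powr_powr c_def)
  qed (use c in simp)
qed

abbreviation entry_kernel :: "real \<Rightarrow> real \<Rightarrow> real^'n^'n \<Rightarrow> 'n \<Rightarrow> 'n \<Rightarrow> real \<Rightarrow> real" where
  "entry_kernel \<alpha> \<beta> A i j \<equiv> ml_kernel \<alpha> \<beta> (\<lambda>k. mat_power A k $ i $ j)"

text \<open>Once Re s > 0 and (Re s)^\<alpha> exceeds \<open>entry_sum A\<close>, this is the (i, j)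
  entry of s^(\<alpha> - \<beta>) times the inverse of s^\<alpha> - A, by
  \<open>entry_laplace_resolvent\<close>.\<close>

definition entry_laplace :: "real \<Rightarrow> real \<Rightarrow> real^'n^'n \<Rightarrow> complex \<Rightarrow> 'n \<Rightarrow> 'n \<Rightarrow> complex" where
  "entry_laplace \<alpha> \<beta> A s i j = integral {0..} (\<lambda>t. exp (- (s * of_real t)) * of_real (entry_kernel \<alpha> \<beta> A i j t))"

lemma isCont_entry_kernel:
  assumes "\<alpha> > 0" "\<beta> > 0" "t > 0"
  shows "isCont (entry_kernel \<alpha> \<beta> A i j) t"
  using assms by (intro isCont_ml_kernel[OF _ _ entry_sum_nonneg[of A]] abs_mat_power_le)

lemma entry_kernel_laplace_integrable:
  assumes "\<alpha> > 0" "\<beta> > 0" "Re s > 0" "entry_sum A < Re s powr \<alpha>"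
  shows "(\<lambda>t. exp (- (s * of_real t)) * of_real (entry_kernel \<alpha> \<beta> A i j t)) absolutely_integrable_on {0..}"
  using assms by (intro laplace_ml_kernel(1)[OF _ _ entry_sum_nonneg[of A]] abs_mat_power_le)

lemma has_laplace_entry_kernel:
  assumes "\<alpha> > 0" "\<beta> > 0" "Re s > 0" "entry_sum A < Re s powr \<alpha>"
  shows "has_laplace (\<lambda>t. of_real (entry_kernel \<alpha> \<beta> A i j t)) s (entry_laplace \<alpha> \<beta> A s i j)"
  unfolding entry_laplace_def
  by (intro has_laplace_absolutely_integrable entry_kernel_laplace_integrable assms)

text \<open>Integrability at the possible singularity t = 0 is inherited from the absolutely
  convergent transform at one large real point.\<close>

lemma entry_kernel_absolutely_integrable:
  assumes "\<alpha> > 0" "\<beta> > 0"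
  shows "entry_kernel \<alpha> \<beta> A i j absolutely_integrable_on {0..T}"
proof -
  obtain \<sigma> where "\<sigma> > 0" "\<And>x. x > \<sigma> \<Longrightarrow> entry_sum A < x powr \<alpha>"
    using powr_exceeds_entry_sum[OF assms(1)] by blast
  then have "has_laplace (\<lambda>t. of_real (entry_kernel \<alpha> \<beta> A i j t)) (of_real (\<sigma> + 1)) (entry_laplace \<alpha> \<beta> A (of_real (\<sigma> + 1)) i j)"
    by (intro has_laplace_entry_kernel assms) auto
  from has_laplaceD(1)[OF this] show ?thesis
    by (simp only: absolutely_integrable_of_real_iff)
qed

lemma entry_laplace_resolvent:
  fixes A :: "real^'n^'n" and L :: "complex^'n"
  assumes "\<alpha> > 0" "\<beta> > 0" "Re s > 0" "entry_sum A < Re s powr \<alpha>"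
  defines "X \<equiv> (\<chi> i. \<Sum>j\<in>UNIV. entry_laplace \<alpha> \<beta> A s i j * L $ j)"
  shows "(s powr of_real \<alpha>) *s X = map_matrix of_real A *v X + (s powr of_real (\<alpha> - \<beta>)) *s L"
proof -
  have id: "s powr of_real \<alpha> * entry_laplace \<alpha> \<beta> A s i j =
      (\<Sum>l\<in>UNIV. of_real (A $ i $ l) * entry_laplace \<alpha> \<beta> A s l j) + (if i = j then s powr of_real (\<alpha> - \<beta>) else 0)" for i j
  proof (rule ml_resolvent_identity)
    show "s \<noteq> 0" using assms by auto
    show "(\<lambda>k. of_real (mat_power A k $ l $ j) * s powr (- of_real (real k * \<alpha> + \<beta>))) sums entry_laplace \<alpha> \<beta> A s l j" for l
      unfolding entry_laplace_def
      using assms(1-4) by (intro laplace_ml_kernel(2)[OF _ _ entry_sum_nonneg[of A]] abs_mat_power_le)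
  qed
  show ?thesis
  proof (subst vec_eq_iff, intro allI)
    fix i
    have "((s powr of_real \<alpha>) *s X) $ i = (\<Sum>j\<in>UNIV. s powr of_real \<alpha> * entry_laplace \<alpha> \<beta> A s i j * L $ j)"
      by (simp add: X_def sum_distrib_left mult.assoc)
    also have "\<dots> = (\<Sum>j\<in>UNIV. \<Sum>l\<in>UNIV. of_real (A $ i $ l) * entry_laplace \<alpha> \<beta> A s l j * L $ j)
        + (\<Sum>j\<in>UNIV. (if i = j then s powr of_real (\<alpha> - \<beta>) else 0) * L $ j)"
      unfolding id by (simp add: distrib_right sum.distrib sum_distrib_right)
    also have "(\<Sum>j\<in>UNIV. \<Sum>l\<in>UNIV. of_real (A $ i $ l) * entry_laplace \<alpha> \<beta> A s l j * L $ j)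
        = (\<Sum>l\<in>UNIV. \<Sum>j\<in>UNIV. of_real (A $ i $ l) * entry_laplace \<alpha> \<beta> A s l j * L $ j)"
      by (rule sum.swap)
    also have "\<dots> = (map_matrix of_real A *v X) $ i"
      by (simp add: matrix_vector_mult_def X_def sum_distrib_left mult.assoc)
    also have "(\<Sum>j\<in>UNIV. (if i = j then s powr of_real (\<alpha> - \<beta>) else 0) * L $ j) = ((s powr of_real (\<alpha> - \<beta>)) *s L) $ i"
      by (simp add: if_distrib[of "\<lambda>x. x * _"] cong: if_cong)
    finally show "((s powr of_real \<alpha>) *s X) $ i = (map_matrix of_real A *v X + (s powr of_real (\<alpha> - \<beta>)) *s L) $ i"
      by simp
  qed
qed

section \<open>Convolution with the \<alpha>-exponential: transform, uniqueness, continuity\<close>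

definition duhamel :: "real \<Rightarrow> real^'n^'n \<Rightarrow> (real \<Rightarrow> real^'n) \<Rightarrow> real \<Rightarrow> real^'n" where
  "duhamel \<alpha> A v t = integral {0..t} (\<lambda>\<tau>. alpha_exp \<alpha> A (t - \<tau>) *v v \<tau>)"

lemma duhamel_componentwise:
  fixes A :: "real^'n^'n"
  assumes "\<alpha> > 0"
    and int: "\<And>i j. (\<lambda>\<tau>. entry_kernel \<alpha> \<alpha> A i j (t - \<tau>) * v \<tau> $ j) absolutely_integrable_on {0..t}"
  shows "(\<lambda>\<tau>. alpha_exp \<alpha> A (t - \<tau>) *v v \<tau>) absolutely_integrable_on {0..t}"
    and "duhamel \<alpha> A v t $ i = (\<Sum>j\<in>UNIV. integral {0..t} (\<lambda>\<tau>. entry_kernel \<alpha> \<alpha> A i j (t - \<tau>) * v \<tau> $ j))"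
proof -
  have nth: "(alpha_exp \<alpha> A (t - \<tau>) *v v \<tau>) $ i = (\<Sum>j\<in>UNIV. entry_kernel \<alpha> \<alpha> A i j (t - \<tau>) * v \<tau> $ j)" for i \<tau>
    by (simp add: matrix_vector_mult_def alpha_exp_nth[OF assms(1)])
  show *: "(\<lambda>\<tau>. alpha_exp \<alpha> A (t - \<tau>) *v v \<tau>) absolutely_integrable_on {0..t}"
    unfolding absolutely_integrable_vec_iff nth
    by (intro allI absolutely_integrable_sum int) auto
  have "duhamel \<alpha> A v t $ i = integral {0..t} (\<lambda>\<tau>. \<Sum>j\<in>UNIV. entry_kernel \<alpha> \<alpha> A i j (t - \<tau>) * v \<tau> $ j)"
    using * unfolding duhamel_def absolutely_integrable_vec_iff nth[symmetric]
    by (intro integral_vec_nth set_lebesgue_integral_eq_integral(1)) blast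
  also have "\<dots> = (\<Sum>j\<in>UNIV. integral {0..t} (\<lambda>\<tau>. entry_kernel \<alpha> \<alpha> A i j (t - \<tau>) * v \<tau> $ j))"
    by (intro integral_sum set_lebesgue_integral_eq_integral(1)[OF int]) auto
  finally show "duhamel \<alpha> A v t $ i = (\<Sum>j\<in>UNIV. integral {0..t} (\<lambda>\<tau>. entry_kernel \<alpha> \<alpha> A i j (t - \<tau>) * v \<tau> $ j))" .
qed

lemma convolution_AE_integrable_real:
  fixes k f :: "real \<Rightarrow> real"
  assumes k: "\<And>T. k absolutely_integrable_on {0..T}" and f: "\<And>T. f absolutely_integrable_on {0..T}"
  shows "AE t in lebesgue. 0 < t \<longrightarrow> (\<lambda>\<tau>. k (t - \<tau>) * f \<tau>) absolutely_integrable_on {0..t}"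
proof -
  \<comment> \<open>The convolution result is for bounded intervals; the null sets belonging to
    [0, n] are united over all n.\<close>
  have "AE t in lborel. t \<in> {0..real n} \<longrightarrow> (\<lambda>\<tau>. complex_of_real (k (t - \<tau>)) * complex_of_real (f \<tau>)) absolutely_integrable_on {0..t}" for n
    by (rule convolution_AE_integrable) (simp_all only: absolutely_integrable_of_real_iff k f)
  then have "AE t in lborel. \<forall>n. t \<in> {0..real n} \<longrightarrow> (\<lambda>\<tau>. k (t - \<tau>) * f \<tau>) absolutely_integrable_on {0..t}"
    by (simp only: of_real_mult[symmetric] absolutely_integrable_of_real_iff AE_all_countable) blast
  then have "AE t in lborel. 0 < t \<longrightarrow> (\<lambda>\<tau>. k (t - \<tau>) * f \<tau>) absolutely_integrable_on {0..t}"
  proof eventually_elim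
    case (elim t)
    obtain n where "t \<le> real n" using real_arch_simple by blast
    then show ?case using elim by auto
  qed
  then show ?thesis by (rule AE_completion)
qed

lemma duhamel_AE_componentwise:
  fixes A :: "real^'n^'n"
  assumes "\<alpha> > 0" and v: "\<And>T. v absolutely_integrable_on {0..T}"
  shows "AE t in lebesgue. 0 < t \<longrightarrow>
    (\<forall>i j. (\<lambda>\<tau>. entry_kernel \<alpha> \<alpha> A i j (t - \<tau>) * v \<tau> $ j) absolutely_integrable_on {0..t})"
proof -
  have "AE t in lebesgue. \<forall>i\<in>UNIV. \<forall>j\<in>UNIV. 0 < t \<longrightarrow>
    (\<lambda>\<tau>. entry_kernel \<alpha> \<alpha> A i j (t - \<tau>) * v \<tau> $ j) absolutely_integrable_on {0..t}"
    using v unfolding absolutely_integrable_vec_iff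
    by (intro AE_finite_allI convolution_AE_integrable_real entry_kernel_absolutely_integrable assms(1)) auto
  then show ?thesis by eventually_elim auto
qed

text \<open>The scalar convolutions are transformed one by one. Their sum is identified with the
  vector convolution where all of them exist as integrals; that is almost every t > 0, which is
  enough under the transform.\<close>

lemma has_vec_laplace_duhamel:
  fixes A :: "real^'n^'n"
  assumes \<alpha>: "\<alpha> > 0" and v: "has_vec_laplace v s L" and s: "Re s > 0" "entry_sum A < Re s powr \<alpha>"
  obtains X where "has_vec_laplace (duhamel \<alpha> A v) s X"
    "(s powr of_real \<alpha>) *s X = map_matrix of_real A *v X + L"
proof
  let ?X = "\<chi> i. \<Sum>j\<in>UNIV. entry_laplace \<alpha> \<alpha> A s i j * L $ j"
  show "(s powr of_real \<alpha>) *s ?X = map_matrix of_real A *v ?X + L"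
    using entry_laplace_resolvent[OF \<alpha> \<alpha> s, of L] s by (auto simp: vector_smult_lid)
  show "has_vec_laplace (duhamel \<alpha> A v) s ?X"
    unfolding has_vec_laplace_def
  proof
    fix i
    let ?c = "\<lambda>j t. integral {0..t} (\<lambda>\<tau>. of_real (entry_kernel \<alpha> \<alpha> A i j (t - \<tau>)) * complex_of_real (v \<tau> $ j))"
    have "has_laplace (\<lambda>t. \<Sum>j\<in>UNIV. ?c j t) s (\<Sum>j\<in>UNIV. entry_laplace \<alpha> \<alpha> A s i j * L $ j)"
    proof (rule has_laplace_sum)
      fix j
      have "has_laplace (\<lambda>t. of_real (v t $ j)) s (L $ j)" using v by (simp add: has_vec_laplace_def)
      then show "has_laplace (?c j) s (entry_laplace \<alpha> \<alpha> A s i j * L $ j)"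
        using has_laplace_convolution[OF entry_kernel_laplace_integrable[OF \<alpha> \<alpha> s]]
        unfolding entry_laplace_def by blast
    qed simp
    moreover have "AE t in lebesgue. 0 < t \<longrightarrow> (\<Sum>j\<in>UNIV. ?c j t) = of_real (duhamel \<alpha> A v t $ i)"
      using duhamel_AE_componentwise[OF \<alpha> has_vec_laplace_absolutely_integrable[OF v], of A]
    proof eventually_elim
      case (elim t)
      show ?case
      proof
        assume "0 < t"
        with elim have int: "(\<lambda>\<tau>. entry_kernel \<alpha> \<alpha> A i j (t - \<tau>) * v \<tau> $ j) absolutely_integrable_on {0..t}" for i j
          by blast
        have "?c j t = of_real (integral {0..t} (\<lambda>\<tau>. entry_kernel \<alpha> \<alpha> A i j (t - \<tau>) * v \<tau> $ j))" for j
          by (simp only: of_real_mult[symmetric] integral_complex_of_real_eq[OF set_lebesgue_integral_eq_integral(1)[OF int]])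
        then show "(\<Sum>j\<in>UNIV. ?c j t) = of_real (duhamel \<alpha> A v t $ i)"
          by (simp add: duhamel_componentwise(2)[OF \<alpha> int])
      qed
    qed
    ultimately show "has_laplace (\<lambda>t. of_real (duhamel \<alpha> A v t $ i)) s (?X $ i)"
      by (simp add: has_laplace_AE_cong)
  qed
qed

lemma has_vec_laplace_mittag_leffler:
  fixes A :: "real^'n^'n"
  assumes \<alpha>: "\<alpha> > 0" and s: "Re s > 0" "entry_sum A < Re s powr \<alpha>"
  obtains Y where "has_vec_laplace (\<lambda>t. mittag_leffler \<alpha> 1 ((t powr \<alpha>) *\<^sub>R A) *v a) s Y"
    "(s powr of_real \<alpha>) *s Y = map_matrix of_real A *v Y + (s powr of_real (\<alpha> - 1)) *s cvec a"
proof
  let ?Y = "\<chi> i. \<Sum>j\<in>UNIV. entry_laplace \<alpha> 1 A s i j * cvec a $ j"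
  show "(s powr of_real \<alpha>) *s ?Y = map_matrix of_real A *v ?Y + (s powr of_real (\<alpha> - 1)) *s cvec a"
    by (rule entry_laplace_resolvent[OF \<alpha> zero_less_one s])
  show "has_vec_laplace (\<lambda>t. mittag_leffler \<alpha> 1 ((t powr \<alpha>) *\<^sub>R A) *v a) s ?Y"
    unfolding has_vec_laplace_def
  proof
    fix i
    have "has_laplace (\<lambda>t. \<Sum>j\<in>UNIV. cvec a $ j * of_real (entry_kernel \<alpha> 1 A i j t)) s
        (\<Sum>j\<in>UNIV. cvec a $ j * entry_laplace \<alpha> 1 A s i j)"
      by (intro has_laplace_sum has_laplace_cmult has_laplace_entry_kernel \<alpha> s) auto
    moreover have "AE t in lebesgue. 0 < t \<longrightarrow> (\<Sum>j\<in>UNIV. cvec a $ j * of_real (entry_kernel \<alpha> 1 A i j t)) =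
       of_real ((mittag_leffler \<alpha> 1 ((t powr \<alpha>) *\<^sub>R A) *v a) $ i)"
      by (intro AE_I2) (simp add: matrix_vector_mult_def mittag_leffler_one_nth[OF \<alpha>] cvec_def mult.commute)
    ultimately show "has_laplace (\<lambda>t. of_real ((mittag_leffler \<alpha> 1 ((t powr \<alpha>) *\<^sub>R A) *v a) $ i)) s (?Y $ i)"
      by (simp add: has_laplace_AE_cong mult.commute)
  qed
qed

lemma solves_transformed_system_unique:
  fixes A :: "real^'n^'n" and B :: "real^'m^'n"
  assumes \<alpha>: "\<alpha> > 0" and x: "solves_transformed_system \<alpha> A B \<Psi> u x" and y: "solves_transformed_system \<alpha> A B \<Psi> u y"
  shows "AE t in lebesgue. 0 < t \<longrightarrow> x t = y t"
proof -
  obtain \<sigma>x where \<sigma>x: "\<And>s. Re s > \<sigma>x \<Longrightarrow> laplace_converges x s \<and>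
     (s powr of_real \<alpha>) *s laplace x s + \<Psi> s = map_matrix of_real A *v laplace x s + map_matrix of_real B *v laplace u s"
    using x unfolding solves_transformed_system_def by blast
  obtain \<sigma>y where \<sigma>y: "\<And>s. Re s > \<sigma>y \<Longrightarrow> laplace_converges y s \<and>
     (s powr of_real \<alpha>) *s laplace y s + \<Psi> s = map_matrix of_real A *v laplace y s + map_matrix of_real B *v laplace u s"
    using y unfolding solves_transformed_system_def by blast
  obtain \<sigma>A where \<sigma>A: "\<sigma>A > 0" "\<And>x. x > \<sigma>A \<Longrightarrow> entry_sum A < x powr \<alpha>"
    using powr_exceeds_entry_sum[OF \<alpha>] by blast
  define \<sigma> where "\<sigma> = max \<sigma>A (max \<sigma>x \<sigma>y)"
  have "has_vec_laplace (\<lambda>t. x t - y t) (of_real s) 0" if s: "s > \<sigma>" for s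
  proof -
    have s': "s > \<sigma>A" "Re (of_real s) > \<sigma>x" "Re (of_real s) > \<sigma>y" "s > 0"
      using s \<sigma>A by (auto simp: \<sigma>_def)
    define X where "X = laplace x (of_real s)"
    define Y where "Y = laplace y (of_real s)"
    define D where "D = X - Y"
    have "(of_real s powr of_real \<alpha>) *s X - (of_real s powr of_real \<alpha>) *s Y = map_matrix of_real A *v X - map_matrix of_real A *v Y"
      using \<sigma>x[OF s'(2)] \<sigma>y[OF s'(3)] unfolding X_def Y_def by (metis (no_types, lifting) add_diff_cancel_left add_diff_cancel_right)
    then have D: "(of_real s powr of_real \<alpha>) *s D = map_matrix of_real A *v D"
      by (simp add: D_def vector_ssub_ldistrib matrix_vector_mult_diff_distrib)
    have Di: "s powr \<alpha> * norm (D $ i) \<le> (\<Sum>l\<in>UNIV. \<bar>A $ i $ l\<bar> * norm (D $ l))" for i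
    proof -
      have "(of_real s powr of_real \<alpha>) * D $ i = (\<Sum>l\<in>UNIV. of_real (A $ i $ l) * D $ l)"
        using arg_cong[OF D, of "\<lambda>v. v $ i"] by (simp add: matrix_vector_mult_def)
      then have "norm (of_real s powr of_real \<alpha> * D $ i) \<le> (\<Sum>l\<in>UNIV. norm (of_real (A $ i $ l) * D $ l))"
        by (simp only: norm_sum)
      then show ?thesis
        using s'(4) by (simp add: norm_mult powr_of_real)
    qed
    \<comment> \<open>m is the l1 norm of D. Summing the row estimates gives s powr \<alpha> m <=
      \<open>entry_sum A\<close> m, which forces m = 0 as s powr \<alpha> exceeds
      \<open>entry_sum A\<close>.\<close>
    define m where "m = (\<Sum>i\<in>UNIV. norm (D $ i))"
    have "s powr \<alpha> * m \<le> (\<Sum>i\<in>UNIV. \<Sum>l\<in>UNIV. \<bar>A $ i $ l\<bar> * norm (D $ l))"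
      unfolding m_def sum_distrib_left by (intro sum_mono Di)
    also have "\<dots> \<le> (\<Sum>i\<in>UNIV. \<Sum>l\<in>UNIV. \<bar>A $ i $ l\<bar> * m)"
      unfolding m_def by (intro sum_mono mult_left_mono member_le_sum) auto
    also have "\<dots> = entry_sum A * m"
      by (simp add: entry_sum_def sum_distrib_right)
    finally have "(s powr \<alpha> - entry_sum A) * m \<le> 0" by (simp add: algebra_simps)
    then have "m \<le> 0"
      using \<sigma>A(2)[OF s'(1)] by (simp add: mult_le_0_iff)
    then have "m = 0" by (simp add: m_def sum_nonneg antisym)
    then have "D = 0"
      by (simp add: m_def sum_nonneg_eq_0_iff vec_eq_iff)
    then show ?thesis
      using has_vec_laplace_diff[OF has_vec_laplaceI has_vec_laplaceI] \<sigma>x[OF s'(2)] \<sigma>y[OF s'(3)]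
      unfolding D_def X_def Y_def by metis
  qed
  from has_vec_laplace_zero_imp_AE_zero[OF this] show ?thesis by simp
qed

lemma duhamel_of_locally_bounded:
  fixes A :: "real^'n^'n"
  assumes \<alpha>: "\<alpha> > 0" and v: "\<And>T. v absolutely_integrable_on {0..T}"
    and t: "0 < t" and e: "e > 0" "bounded (v ` ball t e)"
  shows "(\<lambda>\<tau>. alpha_exp \<alpha> A (t - \<tau>) *v v \<tau>) absolutely_integrable_on {0..t}"
    and "isCont (duhamel \<alpha> A v) t"
proof -
  obtain C where C: "\<And>\<tau>. \<tau> \<in> ball t e \<Longrightarrow> norm (v \<tau>) \<le> C"
    using e(2) unfolding bounded_iff by (metis imageI)
  have vC: "\<bar>v \<tau> $ j\<bar> \<le> C" if "\<tau> \<in> ball t e" for \<tau> j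
    using C[OF that] component_le_norm_cart[of "v \<tau>" j] by linarith
  have vj: "(\<lambda>\<tau>. v \<tau> $ j) absolutely_integrable_on {0..T}" for j T
    using v by (simp add: absolutely_integrable_vec_iff)
  \<comment> \<open>Integrability is needed at all t' near t as well, so that the componentwise
    formula holds on a neighbourhood. For t' within e / 2 of t, the ball of radius e / 2 around t'
    lies in the ball of radius e around t.\<close>
  have int: "(\<lambda>\<tau>. entry_kernel \<alpha> \<alpha> A i j (t' - \<tau>) * v \<tau> $ j) absolutely_integrable_on {0..t'}"
    if t': "0 < t'" "t' \<in> ball t (e / 2)" for i j t'
  proof (rule convolution_integrable_of_bounded[of _ _ _ "e / 2" C])
    show "\<bar>v \<tau> $ j\<bar> \<le> C" if "\<tau> \<in> ball t' (e / 2)" for \<tau>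
      by (rule vC) (use that t'(2) dist_triangle[of t \<tau> t'] in \<open>simp add: mem_ball\<close>)
  qed (use \<alpha> t' e vj in \<open>auto intro: entry_kernel_absolutely_integrable isCont_entry_kernel\<close>)
  have t0: "t \<in> ball t (e / 2)" using e by simp
  show "(\<lambda>\<tau>. alpha_exp \<alpha> A (t - \<tau>) *v v \<tau>) absolutely_integrable_on {0..t}"
    by (rule duhamel_componentwise(1)[OF \<alpha> int[OF t t0]])
  let ?c = "\<lambda>i t. \<Sum>j\<in>UNIV. integral {0..t} (\<lambda>\<tau>. entry_kernel \<alpha> \<alpha> A i j (t - \<tau>) * v \<tau> $ j)"
  have c: "isCont (?c i) t" for i
    by (intro continuous_sum isCont_convolution_of_bounded[OF _ _ vj t e(1) vC]
          entry_kernel_absolutely_integrable isCont_entry_kernel \<alpha>)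
  have "eventually (\<lambda>t'. t' \<in> {0<..} \<inter> ball t (e / 2)) (nhds t)"
    by (rule eventually_nhds_in_open) (use t t0 in auto)
  then have ev: "eventually (\<lambda>t'. ?c i t' = duhamel \<alpha> A v t' $ i) (nhds t)" for i
    by eventually_elim (use duhamel_componentwise(2)[OF \<alpha> int] in auto)
  show "isCont (duhamel \<alpha> A v) t"
    unfolding isCont_def
  proof (rule vec_tendstoI)
    fix i
    have "?c i t = duhamel \<alpha> A v t $ i"
      using ev[of i] by (rule eventually_nhds_x_imp_x)
    with c[of i] have "(?c i \<longlongrightarrow> duhamel \<alpha> A v t $ i) (at t)"
      by (simp only: isCont_def)
    moreover have "eventually (\<lambda>t'. ?c i t' = duhamel \<alpha> A v t' $ i) (at t)"
      using ev[of i] unfolding eventually_at_filter by eventually_elim simp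
    ultimately show "((\<lambda>t'. duhamel \<alpha> A v t' $ i) \<longlongrightarrow> duhamel \<alpha> A v t $ i) (at t)"
      by (rule Lim_transform_eventually)
  qed
qed

lemma laplace_transformable_halfplane:
  assumes "laplace_transformable f"
  obtains \<sigma> where "\<And>s. Re s > \<sigma> \<Longrightarrow> laplace_converges f s"
proof -
  obtain s0 where "laplace_converges f s0" using assms by (auto simp: laplace_transformable_def)
  then show ?thesis using that[of "Re s0"] laplace_converges_halfplane by blast
qed

lemma laplace_transformable_absolutely_integrable:
  "laplace_transformable f \<Longrightarrow> f absolutely_integrable_on {0..T}"
  by (auto simp: laplace_transformable_def intro: has_vec_laplace_absolutely_integrable[OF has_vec_laplaceI])

lemma duhamel_solves:
  fixes A :: "real^'n^'n" and B :: "real^'m^'n"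
  assumes \<alpha>: "\<alpha> > 0" and \<psi>: "laplace_transformable \<psi>" and u: "laplace_transformable u"
  shows "solves_transformed_system \<alpha> A B (laplace \<psi>) u (duhamel \<alpha> A (\<lambda>\<tau>. B *v u \<tau> - \<psi> \<tau>))"
proof -
  obtain \<sigma>1 where \<sigma>1: "\<And>s. Re s > \<sigma>1 \<Longrightarrow> laplace_converges \<psi> s"
    using laplace_transformable_halfplane[OF \<psi>] by blast
  obtain \<sigma>2 where \<sigma>2: "\<And>s. Re s > \<sigma>2 \<Longrightarrow> laplace_converges u s"
    using laplace_transformable_halfplane[OF u] by blast
  obtain \<sigma>3 where \<sigma>3: "\<sigma>3 > 0" "\<And>x. x > \<sigma>3 \<Longrightarrow> entry_sum A < x powr \<alpha>"
    using powr_exceeds_entry_sum[OF \<alpha>] by blast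
  show ?thesis
    unfolding solves_transformed_system_def
  proof (intro exI allI impI)
    fix s :: complex assume "Re s > max \<sigma>1 (max \<sigma>2 \<sigma>3)"
    then have s: "Re s > \<sigma>1" "Re s > \<sigma>2" "Re s > \<sigma>3" "Re s > 0" using \<sigma>3(1) by auto
    have "has_vec_laplace (\<lambda>\<tau>. B *v u \<tau> - \<psi> \<tau>) s (map_matrix of_real B *v laplace u s - laplace \<psi> s)"
      by (intro has_vec_laplace_diff has_vec_laplace_matrix_mult has_vec_laplaceI \<sigma>1 \<sigma>2 s)
    from has_vec_laplace_duhamel[OF \<alpha> this s(4) \<sigma>3(2)[OF s(3)]]
    obtain X where X: "has_vec_laplace (duhamel \<alpha> A (\<lambda>\<tau>. B *v u \<tau> - \<psi> \<tau>)) s X"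
      "(s powr of_real \<alpha>) *s X = map_matrix of_real A *v X + (map_matrix of_real B *v laplace u s - laplace \<psi> s)"
      by blast
    then show "laplace_converges (duhamel \<alpha> A (\<lambda>\<tau>. B *v u \<tau> - \<psi> \<tau>)) s \<and> laplace_converges u s \<and>
        (s powr of_real \<alpha>) *s laplace (duhamel \<alpha> A (\<lambda>\<tau>. B *v u \<tau> - \<psi> \<tau>)) s + laplace \<psi> s =
        map_matrix of_real A *v laplace (duhamel \<alpha> A (\<lambda>\<tau>. B *v u \<tau> - \<psi> \<tau>)) s + map_matrix of_real B *v laplace u s"
      using \<sigma>2[OF s(2)] by (auto simp: has_vec_laplace_iff)
  qed
qed

text \<open>Superposition: the Mittag-Leffler term answers - \<Psi>, the convolution answers B U.
  Only the transform \<Psi> on Re s > 0 enters, so the Dirac initialization at \<alpha> = 1 is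
  included.\<close>

lemma duhamel_const_solves:
  fixes A :: "real^'n^'n" and B :: "real^'m^'n"
  assumes \<alpha>: "\<alpha> > 0" and u: "laplace_transformable u"
    and \<Psi>: "\<And>s. Re s > 0 \<Longrightarrow> \<Psi> s = - ((s powr of_real (\<alpha> - 1)) *s cvec a)"
  shows "solves_transformed_system \<alpha> A B \<Psi> u
     (\<lambda>t. mittag_leffler \<alpha> 1 ((t powr \<alpha>) *\<^sub>R A) *v a + duhamel \<alpha> A (\<lambda>\<tau>. B *v u \<tau>) t)"
    (is "solves_transformed_system _ _ _ _ _ ?x")
proof -
  obtain \<sigma>2 where \<sigma>2: "\<And>s. Re s > \<sigma>2 \<Longrightarrow> laplace_converges u s"
    using laplace_transformable_halfplane[OF u] by blast
  obtain \<sigma>3 where \<sigma>3: "\<sigma>3 > 0" "\<And>x. x > \<sigma>3 \<Longrightarrow> entry_sum A < x powr \<alpha>"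
    using powr_exceeds_entry_sum[OF \<alpha>] by blast
  show ?thesis
    unfolding solves_transformed_system_def
  proof (intro exI allI impI)
    fix s :: complex assume "Re s > max \<sigma>2 \<sigma>3"
    then have s: "Re s > \<sigma>2" "Re s > \<sigma>3" "Re s > 0" using \<sigma>3(1) by auto
    have "has_vec_laplace (\<lambda>\<tau>. B *v u \<tau>) s (map_matrix of_real B *v laplace u s)"
      by (intro has_vec_laplace_matrix_mult has_vec_laplaceI \<sigma>2 s)
    from has_vec_laplace_duhamel[OF \<alpha> this s(3) \<sigma>3(2)[OF s(2)]]
    obtain X where X: "has_vec_laplace (duhamel \<alpha> A (\<lambda>\<tau>. B *v u \<tau>)) s X"
      "(s powr of_real \<alpha>) *s X = map_matrix of_real A *v X + map_matrix of_real B *v laplace u s"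
      by blast
    obtain Y where Y: "has_vec_laplace (\<lambda>t. mittag_leffler \<alpha> 1 ((t powr \<alpha>) *\<^sub>R A) *v a) s Y"
      "(s powr of_real \<alpha>) *s Y = map_matrix of_real A *v Y + (s powr of_real (\<alpha> - 1)) *s cvec a"
      using has_vec_laplace_mittag_leffler[OF \<alpha> s(3) \<sigma>3(2)[OF s(2)]] by blast
    have "has_vec_laplace ?x s (Y + X)"
      by (rule has_vec_laplace_add[OF Y(1) X(1)])
    then show "laplace_converges ?x s \<and> laplace_converges u s \<and>
        (s powr of_real \<alpha>) *s laplace ?x s + \<Psi> s =
        map_matrix of_real A *v laplace ?x s + map_matrix of_real B *v laplace u s"
      using \<sigma>2[OF s(1)] X(2) Y(2) \<Psi>[OF s(3)]
      by (simp add: has_vec_laplace_iff vector_add_ldistrib matrix_vector_right_distrib)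
  qed
qed

section \<open>Constant histories and the final assembly\<close>

lemma has_vec_laplace_history_init_const:
  fixes a :: "real^'n"
  assumes \<alpha>: "0 < \<alpha>" "\<alpha> < 1" and s: "Re s > 0"
  shows "has_vec_laplace (history_init \<alpha> (\<lambda>\<tau>. a)) s (- ((s powr of_real (\<alpha> - 1)) *s cvec a))"
  unfolding has_vec_laplace_def
proof
  fix i
  \<comment> \<open>p = 1 - \<alpha> turns t^(- \<alpha>) into t^(p - 1) and s^(- p) into
    s^(\<alpha> - 1); the factor Gamma p cancels against the one in the initialization.\<close>
  define p where "p = 1 - \<alpha>"
  have p: "p > 0" using \<alpha> by (simp add: p_def)
  have "has_laplace (\<lambda>t. of_real (t powr (p - 1))) s (Gamma p * s powr (- of_real p))"
    using has_laplace_absolutely_integrable[OF laplace_powr_complex(1)[OF s p]]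
    unfolding laplace_powr_complex(2)[OF s p] .
  from has_laplace_cmult[OF this, of "- of_real (a $ i / Gamma p)"]
  have "has_laplace (\<lambda>t. - of_real (a $ i / Gamma p) * of_real (t powr (p - 1))) s
     ((- ((s powr of_real (\<alpha> - 1)) *s cvec a)) $ i)"
    using Gamma_real_pos[OF p] by (simp add: cvec_def p_def mult.commute)
  moreover have "AE t in lebesgue. 0 < t \<longrightarrow> - of_real (a $ i / Gamma p) * of_real (t powr (p - 1))
      = complex_of_real (history_init \<alpha> (\<lambda>\<tau>. a) t $ i)"
    by (intro AE_I2 impI) (simp add: history_init_const[OF \<alpha>] p_def)
  ultimately show "has_laplace (\<lambda>t. of_real (history_init \<alpha> (\<lambda>\<tau>. a) t $ i)) s
     ((- ((s powr of_real (\<alpha> - 1)) *s cvec a)) $ i)"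
    by (rule has_laplace_AE_cong)
qed

text \<open>Removes the case distinction: at \<alpha> = 1 the power s powr (\<alpha> - 1) is 1 for
  nonzero s, which matches the transform - a of the Dirac term.\<close>

lemma forward_trajectory_const_iff:
  assumes "0 < \<alpha>" "\<alpha> \<le> 1"
  obtains \<Psi> where "\<And>x. forward_trajectory_const \<alpha> A B a u x \<longleftrightarrow> solves_transformed_system \<alpha> A B \<Psi> u x"
    and "\<And>s. Re s > 0 \<Longrightarrow> \<Psi> s = - ((s powr of_real (\<alpha> - 1)) *s cvec a)"
proof (cases "\<alpha> = 1")
  case True
  show ?thesis
    by (rule that[of "\<lambda>s. - cvec a"]) (auto simp: True forward_trajectory_const_def)
next
  case False
  then have \<alpha>: "0 < \<alpha>" "\<alpha> < 1" using assms by auto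
  have h: "laplace_converges (history_init \<alpha> (\<lambda>\<tau>. a)) s \<and>
     laplace (history_init \<alpha> (\<lambda>\<tau>. a)) s = - ((s powr of_real (\<alpha> - 1)) *s cvec a)" if "Re s > 0" for s
    using has_vec_laplace_history_init_const[OF \<alpha> that] by (simp add: has_vec_laplace_iff)
  have "laplace_transformable (history_init \<alpha> (\<lambda>\<tau>. a))"
    unfolding laplace_transformable_def using h[of 1] by auto
  then show ?thesis
    using that[of "laplace (history_init \<alpha> (\<lambda>\<tau>. a))"] h False
    by (simp add: forward_trajectory_const_def forward_trajectory_def)
qed

lemma isCont_mittag_leffler:
  fixes A :: "real^'n^'n"
  assumes \<alpha>: "\<alpha> > 0" and t: "t > 0"
  shows "isCont (\<lambda>t. mittag_leffler \<alpha> 1 ((t powr \<alpha>) *\<^sub>R A) *v a) t"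
  unfolding isCont_def
proof (rule vec_tendstoI)
  fix i
  let ?c = "\<lambda>t. \<Sum>j\<in>UNIV. entry_kernel \<alpha> 1 A i j t * a $ j"
  have eq: "?c r = (mittag_leffler \<alpha> 1 ((r powr \<alpha>) *\<^sub>R A) *v a) $ i" if "r > 0" for r
    using that by (simp add: matrix_vector_mult_def mittag_leffler_one_nth[OF \<alpha>])
  have "isCont ?c t"
    by (intro continuous_intros isCont_entry_kernel \<alpha> t) auto
  then have "(?c \<longlongrightarrow> (mittag_leffler \<alpha> 1 ((t powr \<alpha>) *\<^sub>R A) *v a) $ i) (at t)"
    by (simp add: isCont_def eq[OF t])
  moreover have "eventually (\<lambda>r. ?c r = (mittag_leffler \<alpha> 1 ((r powr \<alpha>) *\<^sub>R A) *v a) $ i) (at t)"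
    using eventually_at_in_open'[of "{0<..}" t] t by (auto elim!: eventually_mono simp: eq)
  ultimately show "((\<lambda>r. (mittag_leffler \<alpha> 1 ((r powr \<alpha>) *\<^sub>R A) *v a) $ i) \<longlongrightarrow>
      (mittag_leffler \<alpha> 1 ((t powr \<alpha>) *\<^sub>R A) *v a) $ i) (at t)"
    by (rule Lim_transform_eventually)
qed

lemma absolutely_integrable_matrix_mult:
  fixes B :: "real^'m^'n"
  assumes "f absolutely_integrable_on S"
  shows "(\<lambda>t. B *v f t) absolutely_integrable_on S"
  using absolutely_integrable_linear[OF assms matrix_vector_mul_bounded_linear[of B]]
  by (simp add: o_def)

lemma bounded_matrix_image:
  fixes B :: "real^'m^'n"
  assumes "bounded (u ` S)"
  shows "bounded ((\<lambda>\<tau>. B *v u \<tau>) ` S)"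
  using bounded_linear_image[OF assms matrix_vector_mul_bounded_linear[of B]]
  by (simp add: image_image)

text \<open>The transform fixes a trajectory only up to null sets, so the formula is stated as
  existence together with uniqueness almost everywhere, and pointwise where the trajectory is
  continuous. In the first part the pointwise claims are tied to local boundedness of \<psi>, since
  a singularity of \<psi> at t can meet that of the kernel and make the integral diverge; in the
  second part only u is left in the integral.\<close>

theorem proposition3p1:
  fixes \<alpha> :: real and A :: "real^'n^'n" and B :: "real^'m^'n" and u :: "real \<Rightarrow> real^'m"
  assumes "0 < \<alpha>" and "\<alpha> \<le> 1"
    and "piecewise_constant u" and "laplace_transformable u"
  shows "(\<forall>\<psi>. laplace_transformable \<psi> \<longrightarrow>
            (let integrand = (\<lambda>t \<tau>. alpha_exp \<alpha> A (t - \<tau>) *v (B *v u \<tau> - \<psi> \<tau>));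
                 \<gamma> = (\<lambda>t. integral {0..t} (integrand t))
             in (AE t in lebesgue. 0 < t \<longrightarrow> integrand t absolutely_integrable_on {0..t}) \<and>
                (\<forall>t>0. (\<exists>e>0. bounded (\<psi> ` ball t e)) \<longrightarrow>
                   integrand t absolutely_integrable_on {0..t}) \<and>
                forward_trajectory \<alpha> A B \<psi> u \<gamma> \<and>
                (\<forall>x. forward_trajectory \<alpha> A B \<psi> u x \<longrightarrow>
                   (AE t in lebesgue. 0 < t \<longrightarrow> x t = \<gamma> t) \<and>
                   (\<forall>t>0. (\<exists>e>0. bounded (\<psi> ` ball t e)) \<and> isCont x t \<longrightarrow> x t = \<gamma> t))))
       \<and> (\<forall>a.
            (let integrand = (\<lambda>t \<tau>. alpha_exp \<alpha> A (t - \<tau>) *v (B *v u \<tau>));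
                 \<gamma> = (\<lambda>t. mittag_leffler \<alpha> 1 ((t powr \<alpha>) *\<^sub>R A) *v a + integral {0..t} (integrand t))
             in (\<forall>t>0. integrand t absolutely_integrable_on {0..t}) \<and>
                forward_trajectory_const \<alpha> A B a u \<gamma> \<and>
                (\<forall>x. forward_trajectory_const \<alpha> A B a u x \<longrightarrow>
                   (AE t in lebesgue. 0 < t \<longrightarrow> x t = \<gamma> t) \<and>
                   (\<forall>t>0. isCont x t \<longrightarrow> x t = \<gamma> t))))"
proof (intro conjI allI impI)
  note \<alpha> = \<open>0 < \<alpha>\<close> and u = \<open>laplace_transformable u\<close>
  have Bu: "(\<lambda>\<tau>. B *v u \<tau>) absolutely_integrable_on {0..T}" for T
    by (intro absolutely_integrable_matrix_mult laplace_transformable_absolutely_integrable u)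
  fix \<psi> :: "real \<Rightarrow> real^'n"
  assume \<psi>: "laplace_transformable \<psi>"
  let ?v = "\<lambda>\<tau>. B *v u \<tau> - \<psi> \<tau>"
  have v: "?v absolutely_integrable_on {0..T}" for T
    by (intro set_integral_diff(1) Bu laplace_transformable_absolutely_integrable[OF \<psi>])
  \<comment> \<open>A piecewise constant u is bounded near every t > 0, so local boundedness of
    \<psi> passes to B u - \<psi>.\<close>
  have bdd: "\<exists>e>0. bounded (?v ` ball t e)" if t: "t > 0" and ex: "\<exists>e>0. bounded (\<psi> ` ball t e)" for t
  proof -
    obtain e1 where e1: "e1 > 0" "bounded (\<psi> ` ball t e1)" using ex by blast
    obtain e2 where e2: "e2 > 0" "bounded (u ` ball t e2)"
      using piecewise_constant_locally_bounded[OF assms(3) t] by blast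
    have "bounded (\<psi> ` ball t (min e1 e2))" "bounded (u ` ball t (min e1 e2))"
      using e1(2) e2(2) by (auto elim!: bounded_subset)
    then have "bounded (?v ` ball t (min e1 e2))"
      by (intro bounded_minus_comp bounded_matrix_image)
    then show ?thesis using e1(1) e2(1) by (intro exI[of _ "min e1 e2"]) auto
  qed
  have AE_int: "AE t in lebesgue. 0 < t \<longrightarrow> (\<lambda>\<tau>. alpha_exp \<alpha> A (t - \<tau>) *v ?v \<tau>) absolutely_integrable_on {0..t}"
    using duhamel_AE_componentwise[OF \<alpha> v, of A]
    by eventually_elim (auto intro!: duhamel_componentwise(1)[OF \<alpha>])
  have sol: "forward_trajectory \<alpha> A B \<psi> u (duhamel \<alpha> A ?v)"
    unfolding forward_trajectory_def using duhamel_solves[OF \<alpha> \<psi> u] \<psi> by blast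
  have uniq: "AE t in lebesgue. 0 < t \<longrightarrow> x t = duhamel \<alpha> A ?v t" if "forward_trajectory \<alpha> A B \<psi> u x" for x
    using that sol unfolding forward_trajectory_def
    by (blast intro: solves_transformed_system_unique[OF \<alpha>])
  show "let integrand = (\<lambda>t \<tau>. alpha_exp \<alpha> A (t - \<tau>) *v (B *v u \<tau> - \<psi> \<tau>));
                 \<gamma> = (\<lambda>t. integral {0..t} (integrand t))
             in (AE t in lebesgue. 0 < t \<longrightarrow> integrand t absolutely_integrable_on {0..t}) \<and>
                (\<forall>t>0. (\<exists>e>0. bounded (\<psi> ` ball t e)) \<longrightarrow>
                   integrand t absolutely_integrable_on {0..t}) \<and>
                forward_trajectory \<alpha> A B \<psi> u \<gamma> \<and>
                (\<forall>x. forward_trajectory \<alpha> A B \<psi> u x \<longrightarrow>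
                   (AE t in lebesgue. 0 < t \<longrightarrow> x t = \<gamma> t) \<and>
                   (\<forall>t>0. (\<exists>e>0. bounded (\<psi> ` ball t e)) \<and> isCont x t \<longrightarrow> x t = \<gamma> t))"
    unfolding Let_def duhamel_def[symmetric]
  proof (intro conjI allI impI AE_int sol uniq)
    fix t :: real assume t: "t > 0" and "\<exists>e>0. bounded (\<psi> ` ball t e)"
    with bdd obtain e where "e > 0" "bounded (?v ` ball t e)" by blast
    with t show "(\<lambda>\<tau>. alpha_exp \<alpha> A (t - \<tau>) *v ?v \<tau>) absolutely_integrable_on {0..t}"
      by (rule duhamel_of_locally_bounded(1)[OF \<alpha> v])
  next
    fix x t assume x: "forward_trajectory \<alpha> A B \<psi> u x" and t: "(t::real) > 0"
      and b: "(\<exists>e>0. bounded (\<psi> ` ball t e)) \<and> isCont x t"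
    with bdd obtain e where "e > 0" "bounded (?v ` ball t e)" by blast
    with t have "isCont (duhamel \<alpha> A ?v) t"
      by (rule duhamel_of_locally_bounded(2)[OF \<alpha> v])
    with b t show "x t = duhamel \<alpha> A ?v t"
      by (intro isCont_AE_eq[OF uniq[OF x]]) auto
  qed
next
  note \<alpha> = \<open>0 < \<alpha>\<close> and u = \<open>laplace_transformable u\<close>
  have Bu: "(\<lambda>\<tau>. B *v u \<tau>) absolutely_integrable_on {0..T}" for T
    by (intro absolutely_integrable_matrix_mult laplace_transformable_absolutely_integrable u)
  have loc: "\<exists>e>0. bounded ((\<lambda>\<tau>. B *v u \<tau>) ` ball t e)" if "t > 0" for t
    using piecewise_constant_locally_bounded[OF assms(3) that] bounded_matrix_image by metis
  fix a :: "real^'n"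
  let ?\<gamma> = "\<lambda>t. mittag_leffler \<alpha> 1 ((t powr \<alpha>) *\<^sub>R A) *v a + duhamel \<alpha> A (\<lambda>\<tau>. B *v u \<tau>) t"
  obtain \<Psi> where \<Psi>: "\<And>x. forward_trajectory_const \<alpha> A B a u x \<longleftrightarrow> solves_transformed_system \<alpha> A B \<Psi> u x"
    "\<And>s. Re s > 0 \<Longrightarrow> \<Psi> s = - ((s powr of_real (\<alpha> - 1)) *s cvec a)"
    using forward_trajectory_const_iff[OF assms(1,2)] by blast
  have sol: "forward_trajectory_const \<alpha> A B a u ?\<gamma>"
    unfolding \<Psi>(1) by (rule duhamel_const_solves[OF \<alpha> u \<Psi>(2)])
  have uniq: "AE t in lebesgue. 0 < t \<longrightarrow> x t = ?\<gamma> t" if "forward_trajectory_const \<alpha> A B a u x" for x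
    using that sol unfolding \<Psi>(1) by (rule solves_transformed_system_unique[OF \<alpha>])
  show "let integrand = (\<lambda>t \<tau>. alpha_exp \<alpha> A (t - \<tau>) *v (B *v u \<tau>));
                 \<gamma> = (\<lambda>t. mittag_leffler \<alpha> 1 ((t powr \<alpha>) *\<^sub>R A) *v a + integral {0..t} (integrand t))
             in (\<forall>t>0. integrand t absolutely_integrable_on {0..t}) \<and>
                forward_trajectory_const \<alpha> A B a u \<gamma> \<and>
                (\<forall>x. forward_trajectory_const \<alpha> A B a u x \<longrightarrow>
                   (AE t in lebesgue. 0 < t \<longrightarrow> x t = \<gamma> t) \<and>
                   (\<forall>t>0. isCont x t \<longrightarrow> x t = \<gamma> t))"
    unfolding Let_def duhamel_def[symmetric]
  proof (intro conjI allI impI sol uniq)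
    fix t :: real assume t: "t > 0"
    with loc obtain e where "e > 0" "bounded ((\<lambda>\<tau>. B *v u \<tau>) ` ball t e)" by blast
    with t show "(\<lambda>\<tau>. alpha_exp \<alpha> A (t - \<tau>) *v (B *v u \<tau>)) absolutely_integrable_on {0..t}"
      by (rule duhamel_of_locally_bounded(1)[OF \<alpha> Bu])
  next
    fix x t assume x: "forward_trajectory_const \<alpha> A B a u x" and t: "(t::real) > 0" and c: "isCont x t"
    with loc obtain e where "e > 0" "bounded ((\<lambda>\<tau>. B *v u \<tau>) ` ball t e)" by blast
    with t have "isCont (duhamel \<alpha> A (\<lambda>\<tau>. B *v u \<tau>)) t"
      by (rule duhamel_of_locally_bounded(2)[OF \<alpha> Bu])
    then have "isCont ?\<gamma> t"
      by (intro continuous_add isCont_mittag_leffler \<alpha> t)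
    then show "x t = ?\<gamma> t"
      by (rule isCont_AE_eq[OF uniq[OF x] c _ t])
  qed
qed

end
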